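(* Let $\varepsilon\in(0,1]$, let $\mathrm{bo}>0$ be small enough and $0<\mu<1$ with $\tfrac{\sqrt\mu}{\mathrm{bo}}+\tfrac{\mu}{3}>1$, and let $\zeta_0\in\mathbb{A}^0_0$ be a real-valued zero-mean function with $$|\zeta_0|_{0,0}<\frac{\frac{\sqrt\mu}{\mathrm{bo}}+\frac{\mu}{3}-1}{128\varepsilon\left(\frac{\sqrt\mu}{\mathrm{bo}}+\frac{55}{6}\mu+1\right)}.$$ Then there exists a global weak solution $\zeta$ (on $[0,T]$ for every $T>0$) of the refined thin film equation $$\partial_t\zeta+\partial_x\left((1+\varepsilon\zeta)(\partial_x\zeta+\tfrac{\sqrt\mu}{\mathrm{bo}}\partial_x^3\zeta)\right)+\tfrac{\mu}{3}\partial_x^2\left((1+\varepsilon\zeta)^3\partial_x^2\zeta\right)=0$$ with initial datum $\zeta_0$, which becomes instantaneously analytic in a growing strip of the complex plane. More precisely, for every $\nu\in\left[0,\tfrac12(\tfrac{\sqrt\mu}{\mathrm{bo}}+\tfrac{\mu}{3}-1)\right)$ and every $T>0$, $\zeta\in L^\infty([0,T];\mathbb{A}^0_{\nu t})\cap L^1([0,T];\mathbb{A}^4_{\nu t})$ and for all $t\in[0,T]$ $$|\zeta(t)|_{0,\nu t}+\tfrac{1}{64}\left(\tfrac{\sqrt\mu}{\mathrm{bo}}+\tfrac{\mu}{3}-1\right)\int_0^t|\zeta(t')|_{4,\nu t'}dt'\leq|\zeta_0|_{0,0},\qquad |\zeta(t)|_{0,\nu t}\leq|\zeta_0|_{0,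0}\,e^{-\frac{t}{64}\left(\frac{\sqrt\mu}{\mathrm{bo}}+\frac{\mu}{3}-1\right)}.$$
   Context: Let $\mathbb{T}=\mathbb{R}/2\pi\mathbb{Z}$. For $f\in L^1(\mathbb{T})$, $\widehat f(n)=\frac{1}{2\pi}\int_{\mathbb{T}}f(x)e^{-inx}\,dx$. For $s,\lambda\geq 0$ the Wiener space $\mathbb{A}^s_\lambda$ is the space of $f\in L^1(\mathbb{T})$ with finite norm $|f|_{s,\lambda}:=\sum_{n\in\mathbb{Z}}(1+|n|)^s e^{\lambda|n|}|\widehat f(n)|$. The membership $\zeta\in L^\infty([0,T];\mathbb{A}^0_{\nu t})\cap L^1([0,T];\mathbb{A}^4_{\nu t})$ means $\sup_{t\in[0,T]}|\zeta(t)|_{0,\nu t}<\infty$ and $\int_0^T|\zeta(t)|_{4,\nu t}dt<\infty$. Weak solution: $\zeta\in L^\infty([0,T],L^\infty(\mathbb{T}))\cap L^1([0,T],W^{3,\infty}(\mathbb{T}))$ with initial datum $\zeta_0\in L^\infty(\mathbb{T})$ such that for every $\varphi\in C^\infty([0,T]\times\mathbb{T})$ and $t\in[0,T]$, $$\int_{\mathbb{T}}\zeta(t)\varphi(t)dx-\int_{\mathbb{T}}\zeta_0\varphi(0)dx-\int_0^t\!\!\int_{\mathbb{T}}\zeta\partial_t\varphi\,dx\,dt'=\int_0^t\!\!\int_{\mathbb{T}}(1+\varepsilon\zeta)\partial_x\zeta\partial_x\varphi+\frac{\sqrt\mu}{\mathrm{bo}}\int_0^t\!\!\int_{\mathbb{T}}(1+\varepsilon\zeta)\partial_x^3\zeta\partial_x\varphi-\frac{\mu}{3}\int_0^t\!\!\int_{\mathbb{T}}(1+\varepsilon\zeta)^3\partial_x^2\zeta\,\partial_x^2\varphi.$$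 *)

theory Defs
  imports "HOL-Analysis.Analysis"
begin

text \<open>Functions on the torus T = R/2piZ are represented as 2pi-periodic functions real => real.\<close>

definition per :: "(real \<Rightarrow> real) \<Rightarrow> bool" where
  "per f \<longleftrightarrow> (\<forall>x. f (x + 2*pi) = f x)"

definition fcoeff :: "(real \<Rightarrow> real) \<Rightarrow> int \<Rightarrow> complex" where
  "fcoeff f n = complex_of_real (1 / (2*pi)) *
     (LINT x:{0..2*pi}|lborel. complex_of_real (f x) * cis (- (of_int n * x)))"

definition wiener_in :: "real \<Rightarrow> real \<Rightarrow> (real \<Rightarrow> real) \<Rightarrow> bool" where
  "wiener_in s l f \<longleftrightarrow> per f \<and> set_integrable lborel {0..2*pi} f \<and>
     (\<lambda>n::int. (1 + \<bar>real_of_int n\<bar>) powr s * exp (l * \<bar>real_of_int n\<bar>) * cmod (fcoeff f n))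
       summable_on UNIV"

definition wnorm :: "real \<Rightarrow> real \<Rightarrow> (real \<Rightarrow> real) \<Rightarrow> real" where
  "wnorm s l f = (\<Sum>\<^sub>\<infinity>n::int. (1 + \<bar>real_of_int n\<bar>) powr s * exp (l * \<bar>real_of_int n\<bar>) * cmod (fcoeff f n))"

definition smooth1 :: "(real \<Rightarrow> real) \<Rightarrow> bool" where
  "smooth1 \<phi> \<longleftrightarrow> (\<forall>k x. ((deriv ^^ k) \<phi>) differentiable (at x))"

definition weak_deriv :: "(real \<Rightarrow> real) \<Rightarrow> (real \<Rightarrow> real) \<Rightarrow> bool" where
  "weak_deriv f g \<longleftrightarrow> per g \<and> set_integrable lborel {0..2*pi} g \<and>
     (\<forall>\<phi>. smooth1 \<phi> \<and> per \<phi> \<longrightarrow>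
        (LINT x:{0..2*pi}|lborel. f x * deriv \<phi> x) = - (LINT x:{0..2*pi}|lborel. g x * \<phi> x))"

fun pd :: "bool list \<Rightarrow> (real \<Rightarrow> real \<Rightarrow> real) \<Rightarrow> real \<Rightarrow> real \<Rightarrow> real" where
  "pd [] \<phi> = \<phi>"
| "pd (b # bs) \<phi> = (if b then (\<lambda>t x. deriv (\<lambda>s. pd bs \<phi> s x) t)
                          else (\<lambda>t x. deriv (\<lambda>y. pd bs \<phi> t y) x))"

definition smooth2 :: "(real \<Rightarrow> real \<Rightarrow> real) \<Rightarrow> bool" where
  "smooth2 \<phi> \<longleftrightarrow> (\<forall>ds. continuous_on UNIV (\<lambda>p. pd ds \<phi> (fst p) (snd p)) \<and>
      (\<forall>t x. (\<lambda>s. pd ds \<phi> s x) differentiable (at t) \<and> (\<lambda>y. pd ds \<phi> t y) differentiable (at x)))"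

text \<open>Weak solution on [0,T] of the refined thin film equation with datum zeta0.
  D1, D2, D3 are the weak x-derivatives of zeta(t) of orders 1,2,3;
  zeta in L^infty([0,T], L^infty(T)) and zeta in L^1([0,T], W^{3,infty}(T)).\<close>
definition weak_sol :: "real \<Rightarrow> real \<Rightarrow> real \<Rightarrow> real \<Rightarrow> (real \<Rightarrow> real) \<Rightarrow> (real \<Rightarrow> real \<Rightarrow> real) \<Rightarrow> bool" where
  "weak_sol \<epsilon> \<mu> bo T \<zeta>0 \<zeta> \<longleftrightarrow>
    per \<zeta>0 \<and> (\<exists>M0. AE x in lborel. x \<in> {0..2*pi} \<longrightarrow> \<bar>\<zeta>0 x\<bar> \<le> M0) \<and>
    (\<exists>D1 D2 D3 g M.
      (\<forall>t. per (\<zeta> t)) \<and>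
      (\<lambda>p. \<zeta> (fst p) (snd p)) \<in> borel_measurable borel \<and>
      (\<lambda>p. D1 (fst p) (snd p)) \<in> borel_measurable borel \<and>
      (\<lambda>p. D2 (fst p) (snd p)) \<in> borel_measurable borel \<and>
      (\<lambda>p. D3 (fst p) (snd p)) \<in> borel_measurable borel \<and>
      (AE p in lborel. p \<in> {0..T} \<times> {0..2*pi} \<longrightarrow> \<bar>\<zeta> (fst p) (snd p)\<bar> \<le> M) \<and>
      set_integrable lborel {0..T} g \<and>
      (AE t in lborel. t \<in> {0..T} \<longrightarrow>
          weak_deriv (\<zeta> t) (D1 t) \<and> weak_deriv (D1 t) (D2 t) \<and> weak_deriv (D2 t) (D3 t) \<and>
          (AE x in lborel. x \<in> {0..2*pi} \<longrightarrow>
             \<bar>\<zeta> t x\<bar> \<le> g t \<and> \<bar>D1 t x\<bar> \<le> g t \<and> \<bar>D2 t x\<bar> \<le> g t \<and> \<bar>D3 t x\<bar> \<le> g t)) \<and>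
      (\<forall>\<phi>. smooth2 \<phi> \<and> (\<forall>t x. \<phi> t (x + 2*pi) = \<phi> t x) \<longrightarrow>
        (\<forall>t\<in>{0..T}.
          (LINT x:{0..2*pi}|lborel. \<zeta> t x * \<phi> t x)
          - (LINT x:{0..2*pi}|lborel. \<zeta>0 x * \<phi> 0 x)
          - (LINT s:{0..t}|lborel. LINT x:{0..2*pi}|lborel. \<zeta> s x * pd [True] \<phi> s x)
          = (LINT s:{0..t}|lborel. LINT x:{0..2*pi}|lborel.
                (1 + \<epsilon> * \<zeta> s x) * D1 s x * pd [False] \<phi> s x)
            + sqrt \<mu> / bo * (LINT s:{0..t}|lborel. LINT x:{0..2*pi}|lborel.
                (1 + \<epsilon> * \<zeta> s x) * D3 s x * pd [False] \<phi> s x)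
            - \<mu> / 3 * (LINT s:{0..t}|lborel. LINT x:{0..2*pi}|lborel.
                (1 + \<epsilon> * \<zeta> s x) ^ 3 * D2 s x * pd [False, False] \<phi> s x))))"

end

theory Submission
  imports Defs
begin

text \<open>On the Fourier side the equation reads \<open>a\<^sub>n' = - \<lambda>\<^sub>n a\<^sub>n + N(a)\<^sub>n\<close> with
  \<open>\<lambda>\<^sub>n = (\<alpha> + \<beta>) n^4 - n^2 \<ge> d n^4\<close>, where \<open>\<alpha> = sqrt \<mu> / bo\<close>, \<open>\<beta> = \<mu> / 3\<close>, \<open>d = \<alpha> + \<beta> - 1\<close>, and \<open>N\<close> a
  sum of discrete convolutions. The Picard iterates of Duhamel's formula are compared with those of
  the scalar system in which every coefficient of \<open>N\<close> is replaced by its absolute value. The latter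
  iterates increase, and differences of complex iterates are dominated by differences of majorants,
  so a uniform bound for the majorants yields convergence without any contraction estimate.
  The bound follows from the identity \<open>z(t) + m \<integral>z = c + \<integral>f\<close> for \<open>z' = - m z + f\<close>, applied with the
  submultiplicative weight \<open>exp ((d |n| / 2 + d / 64) t)\<close> and summed over \<open>n\<close>: the nonlinearity costs at
  most \<open>d / 32\<close> of the dissipation, and what is left gives analyticity and decay at once.\<close>

text \<open>The obstacle is that the datum has absolutely summable coefficients but no derivatives,
  while the nonlinearity carries four. It is controlled only at positive times, so time integrals
  run over \<open>{0<..t}\<close>. The weight supplies four moments at every \<open>t > 0\<close>,
  but with a constant of order \<open>t ^ -4\<close> that cannot be integrated up to 0;
  integrability in time comes from the dissipation alone. Majorants take values in
  \<open>[0, \<infinity>]\<close>, so Tonelli and monotone convergence apply before anything is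
  known to be finite. In units of \<open>d / 64\<close> the balance is this: the dissipation is
  worth 64, the growth of the weight takes 32 + 1, the nonlinearity takes 2, and 29 remain. The
  claim needs 16, because \<open>(1 + |n|) ^ 4 \<le> 16 * |n| ^ 4\<close> for
  \<open>n \<noteq> 0\<close>, and the frequency 0 is absent by the zero mean. The construction
  yields coefficients; their Fourier series at time 0 is matched with the datum almost everywhere,
  through uniqueness of Fourier coefficients of integrable functions.\<close>

lemma ennreal_norm_triangle: "ennreal (norm (x + y)) \<le> ennreal (norm x) + ennreal (norm y)"
  by (metis ennreal_leI ennreal_plus norm_ge_zero norm_triangle_ineq)

text \<open>Sums are integrals against counting measure, so Fubini, monotone and dominated
  convergence cover sums, time integrals and mixtures of the two.\<close>

abbreviation zsum :: "(int \<Rightarrow> 'a::{banach,second_countable_topology}) \<Rightarrow> 'a" where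
  "zsum f \<equiv> integral\<^sup>L (count_space UNIV) f"

abbreviation zsummable :: "(int \<Rightarrow> 'a::{banach,second_countable_topology}) \<Rightarrow> bool" where
  "zsummable f \<equiv> integrable (count_space UNIV) f"

abbreviation esum :: "(int \<Rightarrow> ennreal) \<Rightarrow> ennreal" where
  "esum f \<equiv> integral\<^sup>N (count_space UNIV) f"

interpretation zz: pair_sigma_finite "count_space (UNIV :: int set)" "count_space (UNIV :: int set)"
  by (intro pair_sigma_finite.intro sigma_finite_measure_count_space)

interpretation zl: pair_sigma_finite "count_space (UNIV :: int set)" "lborel :: real measure"
  by (intro pair_sigma_finite.intro sigma_finite_measure_count_space lborel.sigma_finite_measure_axioms)

interpretation lz: pair_sigma_finite "lborel :: real measure" "count_space (UNIV :: int set)"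
  by (intro pair_sigma_finite.intro sigma_finite_measure_count_space lborel.sigma_finite_measure_axioms)

lemma measurable_zz:
  "f \<in> borel_measurable (count_space (UNIV :: int set) \<Otimes>\<^sub>M count_space (UNIV :: int set))"
  by (simp add: pair_measure_countable)

lemma measurable_case_zl:
  assumes "\<And>n::int. (\<lambda>x. f n x) \<in> measurable M N"
  shows "(\<lambda>(n, x). f n x) \<in> measurable (count_space UNIV \<Otimes>\<^sub>M M) N"
  by (rule measurable_pair_measure_countable1) (use assms in auto)

lemma measurable_case_lz:
  assumes "\<And>n::int. (\<lambda>x. f n x) \<in> measurable M N"
  shows "(\<lambda>(x, n). f n x) \<in> measurable (M \<Otimes>\<^sub>M count_space UNIV) N"
proof -
  have "(\<lambda>(n, x). f n x) \<circ> prod.swap \<in> measurable (M \<Otimes>\<^sub>M count_space UNIV) N"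
    unfolding prod.swap_def
    by (intro measurable_comp[OF _ measurable_case_zl[OF assms]] measurable_Pair measurable_fst measurable_snd)
  then show ?thesis by (simp add: comp_def case_prod_unfold prod.swap_def)
qed

lemma measurable_zsum:
  fixes f :: "int \<Rightarrow> 'b \<Rightarrow> 'a::{banach,second_countable_topology}"
  assumes "\<And>n. (\<lambda>x. f n x) \<in> borel_measurable M"
  shows "(\<lambda>x. zsum (\<lambda>n. f n x)) \<in> borel_measurable M"
  by (rule sigma_finite_measure.borel_measurable_lebesgue_integral[OF sigma_finite_measure_count_space])
     (rule measurable_case_lz[OF assms])

lemma measurable_esum:
  assumes "\<And>n. (\<lambda>x. f n x) \<in> borel_measurable M"
  shows "(\<lambda>x. esum (\<lambda>n. f n x)) \<in> borel_measurable M"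
  by (rule sigma_finite_measure.borel_measurable_nn_integral[OF sigma_finite_measure_count_space])
     (rule measurable_case_lz[OF assms])

lemma esum_swap: "esum (\<lambda>k. esum (\<lambda>n. f k n)) = esum (\<lambda>n. esum (\<lambda>k. f k n))"
  by (rule zz.Fubini'[symmetric]) (rule measurable_zz)

lemma esum_shift: "esum (\<lambda>n. f (n - k)) = esum f"
  by (rule nn_integral_bij_count_space[where g="\<lambda>n. n - k"])
     (rule bij_betwI[where g="\<lambda>n. n + k"], auto)

lemma zsum_shift: "zsum (\<lambda>n. f (n - k)) = zsum f"
  by (rule integral_bij_count_space[where g="\<lambda>n. n - k"])
     (rule bij_betwI[where g="\<lambda>n. n + k"], auto)

lemma zsum_uminus: "zsum (\<lambda>n. f (- n)) = zsum f"
  by (rule integral_bij_count_space[where g="\<lambda>n. - n"])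
     (rule bij_betwI[where g="\<lambda>n. - n"], auto)

lemma esum_finite_imp: "esum f < \<infinity> \<Longrightarrow> f n < \<infinity>"
  using nn_integral_PInf_AE[of f "count_space UNIV"]
  by (auto simp: AE_count_space less_top)

lemma le_esum: "f n \<le> esum f"
proof -
  have "f n = esum (\<lambda>k. f k * indicator {n} k)" by simp
  also have "\<dots> \<le> esum f" by (intro nn_integral_mono) (auto simp: indicator_def)
  finally show ?thesis .
qed

lemma zsummable_iff: "zsummable f \<longleftrightarrow> esum (\<lambda>n. ennreal (norm (f n))) < \<infinity>"
  by (simp add: integrable_iff_bounded)

abbreviation sint :: "real set \<Rightarrow> (real \<Rightarrow> complex) \<Rightarrow> complex" where
  "sint S f \<equiv> (\<integral>s. indicator S s * f s \<partial>lborel)"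

abbreviation esint :: "real set \<Rightarrow> (real \<Rightarrow> ennreal) \<Rightarrow> ennreal" where
  "esint S f \<equiv> (\<integral>\<^sup>+s. indicator S s * f s \<partial>lborel)"

section \<open>Convolution\<close>

definition conv :: "(int \<Rightarrow> complex) \<Rightarrow> (int \<Rightarrow> complex) \<Rightarrow> int \<Rightarrow> complex" where
  "conv a b n = zsum (\<lambda>k. a k * b (n - k))"

definition econv :: "(int \<Rightarrow> ennreal) \<Rightarrow> (int \<Rightarrow> ennreal) \<Rightarrow> int \<Rightarrow> ennreal" where
  "econv u v n = esum (\<lambda>k. u k * v (n - k))"

text \<open>Tonelli and the substitution \<open>n = k + m\<close>: a weight on the output frequency
  becomes a function of the two input frequencies. The weighted convolution estimates start
  here.\<close>

lemma esum_econv: "esum (\<lambda>n. g n * econv u v n) = esum (\<lambda>k. esum (\<lambda>m. g (k + m) * (u k * v m)))"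
proof -
  have "esum (\<lambda>n. g n * econv u v n) = esum (\<lambda>n. esum (\<lambda>k. g n * (u k * v (n - k))))"
    unfolding econv_def by (simp add: nn_integral_cmult)
  also have "\<dots> = esum (\<lambda>k. esum (\<lambda>n. g n * (u k * v (n - k))))"
    by (rule esum_swap)
  also have "\<dots> = esum (\<lambda>k. esum (\<lambda>m. g (k + m) * (u k * v m)))"
  proof (rule nn_integral_cong)
    fix k :: int
    show "esum (\<lambda>n. g n * (u k * v (n - k))) = esum (\<lambda>m. g (k + m) * (u k * v m))"
      using esum_shift[of "\<lambda>m. g (k + m) * (u k * v m)" k] by simp
  qed
  finally show ?thesis .
qed

lemma esum_econv_1: "esum (econv u v) = esum u * esum v"
  using esum_econv[of "\<lambda>_. 1" u v] by (simp add: nn_integral_cmult nn_integral_multc)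

lemma econv_mono: "(\<And>n. u n \<le> u' n) \<Longrightarrow> (\<And>n. v n \<le> v' n) \<Longrightarrow> econv u v n \<le> econv u' v' n"
  unfolding econv_def by (intro nn_integral_mono mult_mono) auto

lemma econv_finite:
  assumes "esum u < \<infinity>" "esum v < \<infinity>"
  shows "econv u v n < \<infinity>"
proof -
  have "esum (econv u v) < \<infinity>" using assms by (simp add: esum_econv_1 ennreal_mult_less_top)
  then show ?thesis by (rule esum_finite_imp)
qed

text \<open>No summability is required: a divergent sum is 0 by the convention for the Bochner
  integral, and the bound is then trivial.\<close>

lemma norm_conv_le: "ennreal (norm (conv a b n)) \<le> econv (\<lambda>n. norm (a n)) (\<lambda>n. norm (b n)) n"
proof (cases "zsummable (\<lambda>k. a k * b (n - k))")
  case True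
  then show ?thesis
    unfolding conv_def econv_def
    by (intro order.trans[OF integral_norm_bound_ennreal]) (auto simp: norm_mult ennreal_mult)
qed (simp add: conv_def not_integrable_integral_eq)

lemma zsummable_conv:
  assumes "zsummable a" "zsummable b"
  shows "zsummable (conv a b)"
proof -
  have "esum (\<lambda>n. ennreal (norm (conv a b n))) \<le> esum (econv (\<lambda>n. norm (a n)) (\<lambda>n. norm (b n)))"
    by (intro nn_integral_mono norm_conv_le)
  also have "\<dots> < \<infinity>"
    using assms by (simp add: esum_econv_1 zsummable_iff ennreal_mult_less_top)
  finally show ?thesis by (simp add: zsummable_iff)
qed

definition synth :: "(int \<Rightarrow> complex) \<Rightarrow> real \<Rightarrow> complex" where
  "synth a x = zsum (\<lambda>n. a n * cis (of_int n * x))"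

lemma zsummable_cis: "zsummable a \<Longrightarrow> zsummable (\<lambda>n. a n * cis (of_int n * x))"
  by (simp add: zsummable_iff norm_mult)

text \<open>Absolute convergence of the double series justifies exchanging the sums. In the weak
  formulation this turns convolutions of coefficients back into products of functions.\<close>

lemma synth_conv:
  assumes "zsummable a" "zsummable b"
  shows "synth (conv a b) x = synth a x * synth b x"
proof -
  let ?a = "\<lambda>n. a n * cis (of_int n * x)" and ?b = "\<lambda>n. b n * cis (of_int n * x)"
  have *: "integrable (count_space UNIV \<Otimes>\<^sub>M count_space UNIV) (\<lambda>(k, n). ?a k * ?b (n - k))"
  proof -
    have "integral\<^sup>N (count_space UNIV \<Otimes>\<^sub>M count_space UNIV) (\<lambda>(k, n). ennreal (norm (?a k * ?b (n - k))))
       = esum (\<lambda>k. esum (\<lambda>n. norm (?a k * ?b (n - k))))"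
      by (subst zz.M1.nn_integral_fst[symmetric]) (auto simp: measurable_zz)
    also have "\<dots> = esum (econv (\<lambda>n. norm (a n)) (\<lambda>n. norm (b n)))"
      unfolding econv_def by (subst esum_swap) (simp add: norm_mult ennreal_mult)
    also have "\<dots> < \<infinity>"
      using assms by (simp add: esum_econv_1 zsummable_iff ennreal_mult_less_top)
    finally show ?thesis
      by (intro integrableI_bounded) (auto simp: case_prod_unfold measurable_zz)
  qed
  have "synth a x * synth b x = zsum (\<lambda>k. ?a k * zsum ?b)"
    unfolding synth_def by simp
  also have "\<dots> = zsum (\<lambda>k. zsum (\<lambda>n. ?a k * ?b (n - k)))"
  proof -
    have "zsum ?b = zsum (\<lambda>n. ?b (n - k))" for k
      using zsum_shift[of ?b k] by simp
    then show ?thesis by (simp del: of_int_diff)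
  qed
  also have "\<dots> = zsum (\<lambda>n. zsum (\<lambda>k. ?a k * ?b (n - k)))"
    by (rule zz.Fubini_integral[OF *, symmetric])
  also have "\<dots> = zsum (\<lambda>n. conv a b n * cis (of_int n * x))"
  proof -
    have "(\<lambda>k. ?a k * ?b (n - k)) = (\<lambda>k. a k * b (n - k) * cis (of_int n * x))" for n
      by (auto simp: fun_eq_iff cis_mult algebra_simps)
    then show ?thesis by (simp add: conv_def)
  qed
  finally show ?thesis by (simp add: synth_def)
qed

text \<open>The symmetry that characterizes the Fourier coefficients of real-valued
  functions.\<close>

definition hermit :: "(int \<Rightarrow> complex) \<Rightarrow> bool" where
  "hermit a \<longleftrightarrow> (\<forall>n. a (- n) = cnj (a n))"

lemma hermit_conv: "hermit a \<Longrightarrow> hermit b \<Longrightarrow> hermit (conv a b)"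
  unfolding hermit_def
proof
  fix n assume *: "\<forall>n. a (- n) = cnj (a n)" "\<forall>n. b (- n) = cnj (b n)"
  have "cnj (conv a b n) = zsum (\<lambda>k. cnj (a k) * cnj (b (n - k)))"
    unfolding conv_def by (simp flip: Bochner_Integration.integral_cnj)
  also have "\<dots> = zsum (\<lambda>k. a (- k) * b (- n - - k))"
  proof -
    have "cnj (b (n - k)) = b (- n - - k)" for k
      using *(2)[rule_format, of "n - k"] by simp
    then show ?thesis using *(1) by simp
  qed
  also have "\<dots> = conv a b (- n)"
    unfolding conv_def by (rule zsum_uminus)
  finally show "conv a b (- n) = cnj (conv a b n)" ..
qed

lemma hermit_synth: "hermit a \<Longrightarrow> complex_of_real (Re (synth a x)) = synth a x"
proof -
  assume *: "hermit a"
  have "cnj (synth a x) = zsum (\<lambda>n. cnj (a n * cis (of_int n * x)))"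
    unfolding synth_def by (simp flip: Bochner_Integration.integral_cnj)
  also have "\<dots> = zsum (\<lambda>n. a (- n) * cis (of_int (- n) * x))"
    using * by (simp add: cis_cnj hermit_def)
  also have "\<dots> = synth a x"
    unfolding synth_def by (rule zsum_uminus[of "\<lambda>n. a n * cis (of_int n * x)"])
  finally show ?thesis
    by (metis Reals_cnj_iff of_real_Re)
qed

lemma norm_synth_le: "ennreal (norm (synth a x)) \<le> esum (\<lambda>n. norm (a n))"
proof (cases "zsummable (\<lambda>n. a n * cis (of_int n * x))")
  case True
  then show ?thesis
    unfolding synth_def
    by (intro order.trans[OF integral_norm_bound_ennreal]) (auto simp: norm_mult)
qed (simp add: synth_def not_integrable_integral_eq)

lemma synth_periodic: "synth a (x + 2 * pi) = synth a x"
proof -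
  have "cis (real_of_int n * (x + 2 * pi)) = cis (of_int n * x)" for n
    by (simp add: distrib_left flip: cis_mult)
       (metis cis_multiple_2pi Ints_of_int mult.commute mult.assoc)
  then show ?thesis by (simp add: synth_def)
qed

section \<open>Majorants\<close>

text \<open>\<open>majd a b u v\<close> encodes \<open>|b| \<le> v\<close> and \<open>|a - b| \<le> u - v\<close>; subtraction is avoided since
  the majorants may be infinite.\<close>

definition majd :: "(int \<Rightarrow> complex) \<Rightarrow> (int \<Rightarrow> complex) \<Rightarrow> (int \<Rightarrow> ennreal) \<Rightarrow> (int \<Rightarrow> ennreal) \<Rightarrow> bool" where
  "majd a b u v \<longleftrightarrow> (\<forall>n. ennreal (norm (b n)) \<le> v n \<and> ennreal (norm (a n - b n)) + v n \<le> u n)"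

text \<open>The pointwise relation behind \<open>majd\<close> survives integration. It serves twice:
  with counting measure for convolutions, with Lebesgue measure for Duhamel integrals. Finiteness is
  asked of the largest majorant \<open>p\<close> only; integrability of \<open>f\<close> and
  \<open>g\<close> follows.\<close>

lemma majd_integral:
  fixes f g :: "'a \<Rightarrow> complex"
  assumes [measurable]: "f \<in> borel_measurable M" "g \<in> borel_measurable M"
    "p \<in> borel_measurable M" "q \<in> borel_measurable M"
    and g: "\<And>x. x \<in> space M \<Longrightarrow> ennreal (norm (g x)) \<le> q x"
    and fg: "\<And>x. x \<in> space M \<Longrightarrow> ennreal (norm (f x - g x)) + q x \<le> p x"
    and fin: "integral\<^sup>N M p < \<infinity>"
  shows "integrable M f" "integrable M g"
    "ennreal (norm (integral\<^sup>L M g)) \<le> integral\<^sup>N M q"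
    "ennreal (norm (integral\<^sup>L M f - integral\<^sup>L M g)) + integral\<^sup>N M q \<le> integral\<^sup>N M p"
proof -
  have qp: "integral\<^sup>N M q \<le> integral\<^sup>N M p"
    by (intro nn_integral_mono) (use fg in \<open>fastforce intro: order.trans[OF _ fg]\<close>)
  have f: "ennreal (norm (f x)) \<le> p x" if "x \<in> space M" for x
  proof -
    have "norm (f x) \<le> norm (f x - g x) + norm (g x)" by norm
    then have "ennreal (norm (f x)) \<le> ennreal (norm (f x - g x)) + ennreal (norm (g x))"
      by (metis ennreal_leI ennreal_plus norm_ge_zero)
    also have "\<dots> \<le> p x"
      using g[OF that] fg[OF that] by (meson add_left_mono order.trans)
    finally show ?thesis .
  qed
  show i: "integrable M f"
    by (rule integrableI_bounded) (use f fin in \<open>auto intro: le_less_trans[OF nn_integral_mono]\<close>)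
  show j: "integrable M g"
    by (rule integrableI_bounded)
       (use g fin qp in \<open>auto intro: le_less_trans[OF order.trans[OF nn_integral_mono]]\<close>)
  show "ennreal (norm (integral\<^sup>L M g)) \<le> integral\<^sup>N M q"
    by (rule order.trans[OF integral_norm_bound_ennreal[OF j] nn_integral_mono]) (use g in auto)
  have "ennreal (norm (integral\<^sup>L M f - integral\<^sup>L M g)) + integral\<^sup>N M q
      \<le> (\<integral>\<^sup>+x. norm (f x - g x) \<partial>M) + integral\<^sup>N M q"
    using integral_norm_bound_ennreal[of M "\<lambda>x. f x - g x"] i j
    by (intro add_right_mono) (simp add: Bochner_Integration.integral_diff)
  also have "\<dots> = (\<integral>\<^sup>+x. ennreal (norm (f x - g x)) + q x \<partial>M)"
    by (intro nn_integral_add[symmetric]) auto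
  also have "\<dots> \<le> integral\<^sup>N M p"
    by (intro nn_integral_mono) (use fg in auto)
  finally show "ennreal (norm (integral\<^sup>L M f - integral\<^sup>L M g)) + integral\<^sup>N M q \<le> integral\<^sup>N M p" .
qed

lemma majd_prod:
  fixes a b a' b' :: complex
  assumes "ennreal (norm b) \<le> v" "ennreal (norm (a - b)) + v \<le> u"
    and "ennreal (norm b') \<le> v'" "ennreal (norm (a' - b')) + v' \<le> u'"
  shows "ennreal (norm (b * b')) \<le> v * v'" "ennreal (norm (a * a' - b * b')) + v * v' \<le> u * u'"
proof -
  show "ennreal (norm (b * b')) \<le> v * v'"
    using assms by (auto simp: norm_mult ennreal_mult intro!: mult_mono)
  have a': "ennreal (norm a') \<le> u'"
  proof -
    have "norm a' \<le> norm (a' - b') + norm b'" by norm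
    then have "ennreal (norm a') \<le> ennreal (norm (a' - b')) + ennreal (norm b')"
      by (metis ennreal_leI ennreal_plus norm_ge_zero)
    also have "\<dots> \<le> u'"
      using assms by (meson add_left_mono order.trans)
    finally show ?thesis .
  qed
  \<comment> \<open>The majorants obey the same telescoping,
    \<open>u * u' - v * v' = (u - v) * u' + v * (u' - v')\<close>, so the two sides match term by
    term.\<close>
  have "a * a' - b * b' = (a - b) * a' + b * (a' - b')" by algebra
  then have "norm (a * a' - b * b') \<le> norm (a - b) * norm a' + norm b * norm (a' - b')"
    by (metis norm_mult norm_triangle_ineq)
  then have "ennreal (norm (a * a' - b * b')) \<le> ennreal (norm (a - b)) * ennreal (norm a') + ennreal (norm b) * ennreal (norm (a' - b'))"
    by (metis ennreal_leI ennreal_plus ennreal_mult norm_ge_zero mult_nonneg_nonneg)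
  also have "\<dots> \<le> ennreal (norm (a - b)) * u' + v * ennreal (norm (a' - b'))"
    using a' assms by (intro add_mono mult_mono) auto
  finally have "ennreal (norm (a * a' - b * b')) + v * v' \<le>
     ennreal (norm (a - b)) * u' + v * (ennreal (norm (a' - b')) + v')"
    by (simp add: add_right_mono add.assoc distrib_left flip: add.assoc)
  also have "\<dots> \<le> ennreal (norm (a - b)) * u' + v * u'"
    using assms by (intro add_mono mult_mono) auto
  also have "\<dots> \<le> u * u'"
    using assms by (simp add: distrib_right[symmetric] mult_right_mono)
  finally show "ennreal (norm (a * a' - b * b')) + v * v' \<le> u * u'" .
qed

lemma majd_conv:
  assumes "majd a b u v" "majd a' b' u' v'" "esum u < \<infinity>" "esum u' < \<infinity>"
  shows "majd (conv a a') (conv b b') (econv u u') (econv v v')"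
  unfolding majd_def
proof (intro allI)
  fix n
  have fin: "esum (\<lambda>k. u k * u' (n - k)) < \<infinity>"
    using econv_finite[OF assms(3,4)] by (simp add: econv_def)
  show "ennreal (norm (conv b b' n)) \<le> econv v v' n \<and>
    ennreal (norm (conv a a' n - conv b b' n)) + econv v v' n \<le> econv u u' n"
    unfolding conv_def econv_def
    by (rule conjI; rule majd_integral[where p="\<lambda>k. u k * u' (n - k)" and f="\<lambda>k. a k * a' (n - k)"])
       (use assms(1,2) fin in \<open>auto simp: majd_def intro!: majd_prod\<close>)
qed

lemma majd_cmult:
  assumes "majd a b u v" "\<And>n. ennreal (norm (c n)) \<le> g n"
  shows "majd (\<lambda>n. c n * a n) (\<lambda>n. c n * b n) (\<lambda>n. g n * u n) (\<lambda>n. g n * v n)"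
proof -
  have "ennreal (norm (c n * b n)) \<le> g n * v n" for n
    using assms by (auto simp: norm_mult ennreal_mult majd_def intro!: mult_mono)
  moreover have "ennreal (norm (c n * a n - c n * b n)) + g n * v n \<le> g n * u n" for n
  proof -
    have "ennreal (norm (c n * a n - c n * b n)) \<le> g n * ennreal (norm (a n - b n))"
      unfolding right_diff_distrib[symmetric] norm_mult
      by (simp add: ennreal_mult assms(2) mult_right_mono)
    then have "ennreal (norm (c n * a n - c n * b n)) + g n * v n \<le> g n * (ennreal (norm (a n - b n)) + v n)"
      by (simp add: distrib_left add_right_mono)
    also have "\<dots> \<le> g n * u n" using assms(1) by (auto simp: majd_def intro!: mult_left_mono)
    finally show ?thesis .
  qed
  ultimately show ?thesis by (simp add: majd_def)
qed

lemma majd_add: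
  assumes "majd a b u v" "majd a' b' u' v'"
  shows "majd (\<lambda>n. a n + a' n) (\<lambda>n. b n + b' n) (\<lambda>n. u n + u' n) (\<lambda>n. v n + v' n)"
  unfolding majd_def
proof (intro allI conjI)
  fix n
  have "ennreal (norm (b n + b' n)) \<le> ennreal (norm (b n)) + ennreal (norm (b' n))"
    by (metis ennreal_leI ennreal_plus norm_ge_zero norm_triangle_ineq)
  also have "\<dots> \<le> v n + v' n" using assms by (intro add_mono) (auto simp: majd_def)
  finally show "ennreal (norm (b n + b' n)) \<le> v n + v' n" .
  have "norm (a n + a' n - (b n + b' n)) \<le> norm (a n - b n) + norm (a' n - b' n)"
    by (rule norm_diff_triangle_ineq)
  then have "ennreal (norm (a n + a' n - (b n + b' n))) \<le> ennreal (norm (a n - b n)) + ennreal (norm (a' n - b' n))"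
    by (metis ennreal_leI ennreal_plus norm_ge_zero)
  then have "ennreal (norm (a n + a' n - (b n + b' n))) + (v n + v' n)
     \<le> (ennreal (norm (a n - b n)) + v n) + (ennreal (norm (a' n - b' n)) + v' n)"
    by (metis (no_types, lifting) add.assoc add.commute add_right_mono)
  also have "\<dots> \<le> u n + u' n" using assms by (intro add_mono) (auto simp: majd_def)
  finally show "ennreal (norm (a n + a' n - (b n + b' n))) + (v n + v' n) \<le> u n + u' n" .
qed

text \<open>Dominated convergence in the summation index. With equal arguments
  \<open>majd a a u u\<close> reduces to \<open>norm (a n) \<le> u n\<close>, which provides the
  dominating function.\<close>

lemma conv_tendsto:
  assumes "\<And>k. majd (a k) (a k) u u" "\<And>k. majd (b k) (b k) v v"
    and "\<And>n. (\<lambda>k. a k n) \<longlonglongrightarrow> a' n" "\<And>n. (\<lambda>k. b k n) \<longlonglongrightarrow> b' n"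
    and "esum u < \<infinity>" "esum v < \<infinity>"
  shows "(\<lambda>k. conv (a k) (b k) n) \<longlonglongrightarrow> conv a' b' n"
proof -
  let ?w = "\<lambda>k. enn2real (u k * v (n - k))"
  have fin: "u k * v (n - k) < \<infinity>" for k
    using esum_finite_imp[OF assms(5), of k] esum_finite_imp[OF assms(6), of "n - k"]
    by (simp add: ennreal_mult_less_top)
  have "integral\<^sup>N (count_space UNIV) (\<lambda>k. ennreal (?w k)) = econv u v n"
    unfolding econv_def by (intro nn_integral_cong) (use fin in auto)
  also have "\<dots> < \<infinity>" by (rule econv_finite[OF assms(5,6)])
  finally have w: "zsummable ?w" by (simp add: zsummable_iff)
  show ?thesis unfolding conv_def
  proof (rule integral_dominated_convergence[OF _ _ w])
    show "AE k in count_space UNIV. (\<lambda>i. a i k * b i (n - k)) \<longlonglongrightarrow> a' k * b' (n - k)"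
      by (intro AE_I2 tendsto_mult assms)
    show "AE k in count_space UNIV. norm (a i k * b i (n - k)) \<le> ?w k" for i
    proof (intro AE_I2)
      fix k
      have "ennreal (norm (a i k * b i (n - k))) \<le> u k * v (n - k)"
        using assms(1,2) by (auto simp: norm_mult ennreal_mult majd_def intro!: mult_mono)
      with fin[of k] show "norm (a i k * b i (n - k)) \<le> ?w k"
        by (metis enn2real_mono enn2real_ennreal infinity_ennreal_def norm_ge_zero)
    qed
  qed auto
qed

section \<open>Weighted sums\<close>

text \<open>For \<open>j = 4\<close> the factor is homogeneous and ignores the frequency 0; for
  \<open>j = 0\<close> the convention \<open>0 ^ 0 = 1\<close> keeps it.\<close>

definition wsum :: "nat \<Rightarrow> (int \<Rightarrow> ennreal) \<Rightarrow> (int \<Rightarrow> ennreal) \<Rightarrow> ennreal" where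
  "wsum j W u = esum (\<lambda>n. ennreal (\<bar>of_int n\<bar> ^ j) * (W n * u n))"

lemma wsum_cmult: "wsum j W (\<lambda>n. c * u n) = c * wsum j W u"
  unfolding wsum_def by (subst nn_integral_cmult[symmetric]) (auto simp: mult_ac)

lemma wsum_add: "wsum j W (\<lambda>n. u n + v n) = wsum j W u + wsum j W v"
  unfolding wsum_def by (subst nn_integral_add[symmetric]) (auto simp: distrib_left)

lemma wsum_mono: "(\<And>n. u n \<le> v n) \<Longrightarrow> wsum j W u \<le> wsum j W v"
  unfolding wsum_def by (intro nn_integral_mono mult_left_mono) auto

text \<open>\<open>G\<close> is the multiplier outside the product and \<open>H\<close> the one on
  the second factor. Once \<open>GH\<close> splits them into fourth powers of the input frequencies,
  each term has all four derivatives on one factor, and the other factor enters through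
  \<open>wsum 0\<close> only.\<close>

lemma wsum_econv_gen:
  assumes W: "\<And>k m. W (k + m) \<le> W k * W m"
    and GH: "\<And>k m. G (k + m) * H m \<le> a * \<bar>real_of_int k\<bar> ^ 4 + b * \<bar>real_of_int m\<bar> ^ 4"
    and nn: "\<And>n. 0 \<le> G n" "\<And>n. 0 \<le> H n" "0 \<le> a" "0 \<le> b"
  shows "wsum 0 W (\<lambda>n. ennreal (G n) * econv p (\<lambda>m. ennreal (H m) * u m) n)
    \<le> ennreal a * (wsum 4 W p * wsum 0 W u) + ennreal b * (wsum 0 W p * wsum 4 W u)"
proof -
  let ?q = "\<lambda>n::int. ennreal (\<bar>of_int n\<bar> ^ 4)"
  have "wsum 0 W (\<lambda>n. ennreal (G n) * econv p (\<lambda>m. ennreal (H m) * u m) n)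
      = esum (\<lambda>n. (W n * ennreal (G n)) * econv p (\<lambda>m. ennreal (H m) * u m) n)"
    by (simp add: wsum_def mult_ac)
  also have "\<dots> = esum (\<lambda>k. esum (\<lambda>m. (W (k + m) * ennreal (G (k + m))) * (p k * (ennreal (H m) * u m))))"
    by (rule esum_econv)
  also have "\<dots> \<le> esum (\<lambda>k. esum (\<lambda>m. (W k * W m) * (p k * u m) * (ennreal a * ?q k + ennreal b * ?q m)))"
  proof (intro nn_integral_mono)
    fix k m :: int
    have "ennreal (G (k + m)) * ennreal (H m) \<le> ennreal a * ?q k + ennreal b * ?q m"
      using GH[of k m] nn by (simp flip: ennreal_mult ennreal_plus add: ennreal_leI)
    then have "W (k + m) * (p k * u m) * (ennreal (G (k + m)) * ennreal (H m))
       \<le> (W k * W m) * (p k * u m) * (ennreal a * ?q k + ennreal b * ?q m)"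
      by (intro mult_mono W) auto
    then show "(W (k + m) * ennreal (G (k + m))) * (p k * (ennreal (H m) * u m))
       \<le> (W k * W m) * (p k * u m) * (ennreal a * ?q k + ennreal b * ?q m)"
      by (simp add: mult_ac)
  qed
  also have "\<dots> = esum (\<lambda>k. esum (\<lambda>m. ennreal a * (?q k * (W k * p k)) * (W m * u m)
        + ennreal b * (W k * p k) * (?q m * (W m * u m))))"
    by (intro nn_integral_cong) (simp add: algebra_simps)
  also have "\<dots> = esum (\<lambda>k. ennreal a * (?q k * (W k * p k)) * wsum 0 W u
        + ennreal b * (W k * p k) * wsum 4 W u)"
    by (intro nn_integral_cong) (simp add: wsum_def nn_integral_add nn_integral_cmult)
  also have "\<dots> = ennreal a * (wsum 4 W p * wsum 0 W u) + ennreal b * (wsum 0 W p * wsum 4 W u)"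
    by (simp add: nn_integral_add nn_integral_cmult nn_integral_multc) (simp add: wsum_def mult.assoc)
  finally show ?thesis .
qed

lemma wsum_econv_0:
  assumes W: "\<And>k m. W (k + m) \<le> W k * W m"
  shows "wsum 0 W (econv p u) \<le> wsum 0 W p * wsum 0 W u"
proof -
  have "wsum 0 W (econv p u) = esum (\<lambda>k. esum (\<lambda>m. W (k + m) * (p k * u m)))"
    unfolding wsum_def by (simp add: esum_econv)
  also have "\<dots> \<le> esum (\<lambda>k. esum (\<lambda>m. (W k * p k) * (W m * u m)))"
  proof (intro nn_integral_mono)
    fix k m :: int
    show "W (k + m) * (p k * u m) \<le> (W k * p k) * (W m * u m)"
      using mult_right_mono[OF W[of k m], of "p k * u m"] by (simp add: mult_ac)
  qed
  also have "\<dots> = wsum 0 W p * wsum 0 W u"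
    by (simp add: wsum_def nn_integral_cmult nn_integral_multc)
  finally show ?thesis .
qed

text \<open>Convexity used twice, through squares. The constant 8 is the source of 16 and 136 in
  \<open>wsum_EN\<close>.\<close>

lemma power4_add_le: "\<bar>x + y\<bar> ^ 4 \<le> 8 * \<bar>x\<bar> ^ 4 + 8 * \<bar>y\<bar> ^ 4" for x y :: real
proof -
  have "(x + y)\<^sup>2 \<le> 2 * x\<^sup>2 + 2 * y\<^sup>2" by (simp add: power2_sum) (use sum_squares_bound[of x y] in simp)
  then have "((x + y)\<^sup>2)\<^sup>2 \<le> (2 * x\<^sup>2 + 2 * y\<^sup>2)\<^sup>2" by (intro power_mono) auto
  also have "\<dots> \<le> 8 * (x\<^sup>2)\<^sup>2 + 8 * (y\<^sup>2)\<^sup>2"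
    using sum_squares_bound[of "x\<^sup>2" "y\<^sup>2"] by (simp add: power2_sum)
  finally show ?thesis by (simp add: power_even_abs)
qed

lemma wsum_econv_4:
  assumes W: "\<And>k m. W (k + m) \<le> W k * W m"
  shows "wsum 4 W (econv p u) \<le> 8 * (wsum 4 W p * wsum 0 W u) + 8 * (wsum 0 W p * wsum 4 W u)"
proof -
  have "wsum 4 W (econv p u) = wsum 0 W (\<lambda>n. ennreal (\<bar>of_int n\<bar> ^ 4) * econv p (\<lambda>m. ennreal 1 * u m) n)"
    by (simp add: wsum_def mult_ac)
  also have "\<dots> \<le> ennreal 8 * (wsum 4 W p * wsum 0 W u) + ennreal 8 * (wsum 0 W p * wsum 4 W u)"
    by (rule wsum_econv_gen[OF W]) (use power4_add_le in auto)
  finally show ?thesis by simp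
qed

text \<open>A nonzero integer has modulus at least 1. This is what lets second-order terms be
  absorbed by fourth-order dissipation.\<close>

lemma int_square_le_power4: "x\<^sup>2 \<le> x ^ 4" if "x \<in> \<int>" for x :: real
proof (cases "x = 0")
  case False
  then have "1 \<le> \<bar>x\<bar>" using that by (metis Ints_nonzero_abs_ge1)
  then have "\<bar>x\<bar> ^ 2 \<le> \<bar>x\<bar> ^ 4" by (intro power_increasing) auto
  then show ?thesis by simp
qed simp

lemma mult_cube_le: "x * y ^ 3 \<le> x ^ 4 + y ^ 4" if "0 \<le> x" "0 \<le> y" for x y :: real
proof (cases "x \<le> y")
  case True
  then have "x * y ^ 3 \<le> y * y ^ 3" using that by (intro mult_right_mono) auto
  then show ?thesis using that by (simp add: power_numeral_reduce add_increasing)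
next
  case False
  then have "x * y ^ 3 \<le> x * x ^ 3" using that by (intro mult_left_mono power_mono) auto
  then show ?thesis using that by (simp add: power_numeral_reduce add_increasing2)
qed

text \<open>The three products are the multipliers of the three fluxes: one derivative outside and
  one inside, one outside and three inside, two and two. Here \<open>k\<close> belongs to the
  undifferentiated factor and \<open>m\<close> to the differentiated one. All rest on
  \<open>z \<le> x + y\<close> and Young's inequality; the first has degree 2 and needs integrality
  to reach degree 4.\<close>

lemma frequency_bounds:
  fixes k m :: int
  defines "x \<equiv> \<bar>real_of_int k\<bar>" and "y \<equiv> \<bar>real_of_int m\<bar>" and "z \<equiv> \<bar>real_of_int (k + m)\<bar>"
  shows "z * y \<le> x ^ 4 + 3 * y ^ 4" "z * y ^ 3 \<le> x ^ 4 + 3 * y ^ 4" "z\<^sup>2 * y\<^sup>2 \<le> x ^ 4 + 3 * y ^ 4"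
proof -
  have z: "z \<le> x + y" "0 \<le> x" "0 \<le> y" "0 \<le> z" by (auto simp: x_def y_def z_def)
  have x2: "x\<^sup>2 \<le> x ^ 4" and y2: "y\<^sup>2 \<le> y ^ 4"
    by (auto simp: x_def y_def intro!: int_square_le_power4)
  have xy: "2 * (x * y) \<le> x\<^sup>2 + y\<^sup>2" using sum_squares_bound[of x y] by simp
  have "z * y \<le> (x + y) * y" using z by (intro mult_right_mono) auto
  also have "\<dots> = x * y + y\<^sup>2" by (simp add: algebra_simps power2_eq_square)
  also have "\<dots> \<le> x ^ 4 + 3 * y ^ 4" using x2 y2 xy zero_le_power2[of x] zero_le_power2[of y] by linarith
  finally show "z * y \<le> x ^ 4 + 3 * y ^ 4" .
  have "z * y ^ 3 \<le> (x + y) * y ^ 3" using z by (intro mult_right_mono) auto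
  also have "\<dots> = x * y ^ 3 + y ^ 4" by (simp add: algebra_simps power_numeral_reduce)
  also have "\<dots> \<le> x ^ 4 + 3 * y ^ 4" using mult_cube_le[of x y] z by (simp, smt (verit) zero_le_power)
  finally show "z * y ^ 3 \<le> x ^ 4 + 3 * y ^ 4" .
  have "z\<^sup>2 \<le> (x + y)\<^sup>2" using z by (intro power_mono) auto
  also have "\<dots> \<le> 2 * x\<^sup>2 + 2 * y\<^sup>2" using xy by (simp add: power2_sum)
  finally have "z\<^sup>2 * y\<^sup>2 \<le> (2 * x\<^sup>2 + 2 * y\<^sup>2) * y\<^sup>2" by (intro mult_right_mono) auto
  also have "\<dots> = 2 * (x\<^sup>2 * y\<^sup>2) + 2 * (y\<^sup>2)\<^sup>2" by (simp add: algebra_simps power2_eq_square)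
  also have "\<dots> \<le> (x\<^sup>2)\<^sup>2 + 3 * (y\<^sup>2)\<^sup>2" using sum_squares_bound[of "x\<^sup>2" "y\<^sup>2"] by simp
  finally show "z\<^sup>2 * y\<^sup>2 \<le> x ^ 4 + 3 * y ^ 4" by simp
qed

text \<open>Here \<open>z\<close> is the solution of \<open>z' = - m z + f\<close>,
  \<open>z(0) = c\<close>. Tonelli replaces differentiation, so \<open>c\<close> and
  \<open>f\<close> may be infinite and the identity still holds in
  \<open>[0, \<infinity>]\<close>.\<close>

lemma duhamel_energy:
  fixes f :: "real \<Rightarrow> ennreal" and c :: ennreal
  assumes m: "0 < m" and t: "0 \<le> t" and [measurable]: "f \<in> borel_measurable borel"
  defines "z \<equiv> \<lambda>r. ennreal (exp (- m * r)) * c + esint {0<..r} (\<lambda>s. ennreal (exp (- m * (r - s))) * f s)"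
  shows "z t + ennreal m * esint {0..t} z
    = c + esint {0<..t} f"
proof -
  have ex: "(\<integral>\<^sup>+r. indicator {s..t} r * ennreal (exp (- m * (r - s))) \<partial>lborel) = ennreal ((1 - exp (- m * (t - s))) / m)"
    if "s \<le> t" for s
  proof -
    have "(\<integral>\<^sup>+r. ennreal (exp (- m * (r - s))) * indicator {s..t} r \<partial>lborel)
        = ennreal (- exp (- m * (t - s)) / m - - exp (- m * (s - s)) / m)"
      by (rule nn_integral_FTC_Icc) (use m that in \<open>auto intro!: derivative_eq_intros\<close>)
    then show ?thesis by (simp add: mult.commute diff_divide_distrib)
  qed
  \<comment> \<open>What survives at age \<open>s\<close> plus what has been dissipated is the
    whole. Applied to the datum and to the source at each instant, this gives the identity.\<close>
  have ex': "ennreal (exp (- m * s)) + ennreal m * ennreal ((1 - exp (- m * s)) / m) = 1" if "0 \<le> s" for s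
    using m that by (simp flip: ennreal_mult ennreal_plus)
  have ind: "indicator {0..t} r * indicator {0<..r} s = (if 0 < s \<and> s \<le> r \<and> r \<le> t then 1 else 0 :: ennreal)"
      "indicator {0<..t} s * indicator {s..t} r = (if 0 < s \<and> s \<le> r \<and> r \<le> t then 1 else 0 :: ennreal)" for r s
    by (auto simp: indicator_def)
  have [measurable]: "(\<lambda>r. esint {0<..r} (\<lambda>s. ennreal (exp (- m * (r - s))) * f s)) \<in> borel_measurable borel"
  proof -
    have *: "indicator {0<..r} s = (if 0 < s \<and> s \<le> r then 1 else 0 :: ennreal)" for r s :: real
      by (auto simp: indicator_def)
    show ?thesis unfolding * by measurable
  qed
  have "esint {0..t} z
     = (\<integral>\<^sup>+r. c * (indicator {0..t} r * ennreal (exp (- m * (r - 0)))) + 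
        indicator {0..t} r * esint {0<..r} (\<lambda>s. ennreal (exp (- m * (r - s))) * f s) \<partial>lborel)"
    unfolding z_def by (intro nn_integral_cong) (simp add: algebra_simps)
  also have "\<dots> = (\<integral>\<^sup>+r. c * (indicator {0..t} r * ennreal (exp (- m * (r - 0)))) \<partial>lborel) +
        (esint {0..t} (\<lambda>r. esint {0<..r} (\<lambda>s. ennreal (exp (- m * (r - s))) * f s)))"
    by (rule nn_integral_add) measurable
  also have "(\<integral>\<^sup>+r. c * (indicator {0..t} r * ennreal (exp (- m * (r - 0)))) \<partial>lborel) = c * ennreal ((1 - exp (- m * t)) / m)"
    using ex[OF t] by (subst nn_integral_cmult) auto
  also have "esint {0..t} (\<lambda>r. esint {0<..r} (\<lambda>s. ennreal (exp (- m * (r - s))) * f s))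
     = (\<integral>\<^sup>+r. \<integral>\<^sup>+s. (if 0 < s \<and> s \<le> r \<and> r \<le> t then 1 else 0) * (ennreal (exp (- m * (r - s))) * f s) \<partial>lborel \<partial>lborel)"
    by (subst nn_integral_cmult[symmetric]) (auto simp flip: ind(1) simp: mult.assoc)
  also have "\<dots> = (\<integral>\<^sup>+s. \<integral>\<^sup>+r. (if 0 < s \<and> s \<le> r \<and> r \<le> t then 1 else 0) * (ennreal (exp (- m * (r - s))) * f s) \<partial>lborel \<partial>lborel)"
    by (rule lborel_pair.Fubini') measurable
  also have "\<dots> = (\<integral>\<^sup>+s. (indicator {0<..t} s * f s) * ennreal ((1 - exp (- m * (t - s))) / m) \<partial>lborel)"
  proof (intro nn_integral_cong)
    fix s :: real
    have "(\<integral>\<^sup>+r. (if 0 < s \<and> s \<le> r \<and> r \<le> t then 1 else 0) * (ennreal (exp (- m * (r - s))) * f s) \<partial>lborel)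
       = (\<integral>\<^sup>+r. (indicator {0<..t} s * f s) * (indicator {s..t} r * ennreal (exp (- m * (r - s)))) \<partial>lborel)"
      unfolding ind(2)[symmetric] by (intro nn_integral_cong) (simp add: mult_ac)
    also have "\<dots> = (indicator {0<..t} s * f s) * (\<integral>\<^sup>+r. indicator {s..t} r * ennreal (exp (- m * (r - s))) \<partial>lborel)"
      by (rule nn_integral_cmult) simp
    also have "\<dots> = (indicator {0<..t} s * f s) * ennreal ((1 - exp (- m * (t - s))) / m)"
      using ex[of s] by (cases "s \<le> t") (auto simp: indicator_def)
    finally show "(\<integral>\<^sup>+r. (if 0 < s \<and> s \<le> r \<and> r \<le> t then 1 else 0) * (ennreal (exp (- m * (r - s))) * f s) \<partial>lborel)
       = (indicator {0<..t} s * f s) * ennreal ((1 - exp (- m * (t - s))) / m)" .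
  qed
  finally have I: "esint {0..t} z = c * ennreal ((1 - exp (- m * t)) / m)
     + (\<integral>\<^sup>+s. (indicator {0<..t} s * f s) * ennreal ((1 - exp (- m * (t - s))) / m) \<partial>lborel)" .
  have "z t + ennreal m * esint {0..t} z
     = c * (ennreal (exp (- m * t)) + ennreal m * ennreal ((1 - exp (- m * t)) / m))
     + ((esint {0<..t} (\<lambda>s. ennreal (exp (- m * (t - s))) * f s))
     + ennreal m * (\<integral>\<^sup>+s. (indicator {0<..t} s * f s) * ennreal ((1 - exp (- m * (t - s))) / m) \<partial>lborel))"
    unfolding I unfolding z_def by (simp add: distrib_left mult_ac add_ac)
  also have "esint {0<..t} (\<lambda>s. ennreal (exp (- m * (t - s))) * f s)
     + ennreal m * (\<integral>\<^sup>+s. (indicator {0<..t} s * f s) * ennreal ((1 - exp (- m * (t - s))) / m) \<partial>lborel)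
     = (\<integral>\<^sup>+s. indicator {0<..t} s * (ennreal (exp (- m * (t - s))) * f s)
       + ennreal m * ((indicator {0<..t} s * f s) * ennreal ((1 - exp (- m * (t - s))) / m)) \<partial>lborel)"
    by (subst nn_integral_cmult[symmetric], simp, subst nn_integral_add) simp_all
  also have "\<dots> = (\<integral>\<^sup>+s. indicator {0<..t} s * f s * (ennreal (exp (- m * (t - s))) + ennreal m * ennreal ((1 - exp (- m * (t - s))) / m)) \<partial>lborel)"
    by (intro nn_integral_cong) (simp add: algebra_simps)
  also have "\<dots> = esint {0<..t} f"
  proof (intro nn_integral_cong)
    fix s
    show "indicator {0<..t} s * f s * (ennreal (exp (- m * (t - s))) + ennreal m * ennreal ((1 - exp (- m * (t - s))) / m))
      = indicator {0<..t} s * f s"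
      using ex'[of "t - s"] by (cases "s \<in> {0<..t}") auto
  qed
  finally show ?thesis using ex'[OF t] by simp
qed

section \<open>The equation in Fourier variables\<close>

text \<open>The class of majorants for which every convolution in the equation converges
  absolutely.\<close>

definition fin4 :: "(int \<Rightarrow> ennreal) \<Rightarrow> bool" where
  "fin4 u \<longleftrightarrow> wsum 0 (\<lambda>_. 1) u < \<infinity> \<and> wsum 4 (\<lambda>_. 1) u < \<infinity>"

lemma esum_ennreal_mult_finite:
  assumes "fin4 u" and "\<And>n. g n \<le> c * \<bar>real_of_int n\<bar> ^ 4"
  shows "esum (\<lambda>n. ennreal (g n) * u n) < \<infinity>"
proof -
  have "esum (\<lambda>n. ennreal (g n) * u n) \<le> esum (\<lambda>n. ennreal \<bar>c\<bar> * (ennreal (\<bar>real_of_int n\<bar> ^ 4) * u n))"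
  proof (intro nn_integral_mono)
    fix n :: int
    have "g n \<le> \<bar>c\<bar> * \<bar>real_of_int n\<bar> ^ 4"
      by (rule order.trans[OF assms(2)]) (intro mult_right_mono, auto)
    then have "ennreal (g n) \<le> ennreal \<bar>c\<bar> * ennreal (\<bar>real_of_int n\<bar> ^ 4)"
      by (simp flip: ennreal_mult add: ennreal_leI)
    then show "ennreal (g n) * u n \<le> ennreal \<bar>c\<bar> * (ennreal (\<bar>real_of_int n\<bar> ^ 4) * u n)"
      by (metis mult.assoc mult_right_mono zero_le)
  qed
  also have "\<dots> = ennreal \<bar>c\<bar> * wsum 4 (\<lambda>_. 1) u"
    unfolding wsum_def by (subst nn_integral_cmult) auto
  also have "\<dots> < \<infinity>" using assms(1) by (simp add: fin4_def ennreal_mult_less_top)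
  finally show ?thesis .
qed

lemma int_abs_le_power4: "\<bar>real_of_int n\<bar> ^ j \<le> \<bar>real_of_int n\<bar> ^ 4" if "1 \<le> j" "j \<le> 4"
proof (cases "n = 0")
  case False
  then have "1 \<le> \<bar>real_of_int n\<bar>" by linarith
  then show ?thesis using that by (intro power_increasing) auto
qed (use that in \<open>simp add: power_0_left\<close>)

text \<open>Instantiated with \<open>al = sqrt \<mu> / bo\<close>, \<open>be = \<mu> / 3\<close> and
  \<open>A\<close> the Fourier coefficients of the datum. The assumption \<open>small\<close> is the
  smallness condition in the shape in which \<open>wsum_EN\<close> consumes it.\<close>

locale thin_film =
  fixes eps al be :: real and A :: "int \<Rightarrow> complex"
  assumes eps: "0 < eps" and al: "0 \<le> al" and be: "0 \<le> be" and albe: "1 < al + be"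
    and hermit_A: "hermit A" and A_0: "A 0 = 0" and summable_A: "zsummable A"
    and small: "128 * eps * zsum (\<lambda>n. norm (A n)) * (1 + al + 5 * be) \<le> al + be - 1"
begin

definition "M0 = zsum (\<lambda>n. norm (A n))"
definition "d = al + be - 1"
definition lam :: "int \<Rightarrow> real" where "lam n = (al + be) * \<bar>of_int n\<bar> ^ 4 - (of_int n)\<^sup>2"
definition th :: "int \<Rightarrow> real" where "th n = d / 2 * \<bar>of_int n\<bar> + d / 64"
definition W :: "real \<Rightarrow> int \<Rightarrow> ennreal" where "W t n = ennreal (exp (th n * t))"

text \<open>\<open>P3 a\<close> and \<open>NN a\<close> are the Fourier coefficients of \<open>(1 + \<epsilon>\<zeta>)^3 - 1\<close> and of the nonlinear part of the
  equation; \<open>EP3\<close> and \<open>EN\<close> are their majorants. The part \<open>d |n| / 2\<close> of \<open>th\<close> gives analyticity for every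
  \<open>\<nu> < d / 2\<close>, the part \<open>d / 64\<close> gives the exponential decay.\<close>

definition P3 :: "(int \<Rightarrow> complex) \<Rightarrow> int \<Rightarrow> complex" where
  "P3 a n = of_real (3 * eps) * a n + of_real (3 * eps\<^sup>2) * conv a a n + of_real (eps ^ 3) * conv a (conv a a) n"

definition NN :: "(int \<Rightarrow> complex) \<Rightarrow> int \<Rightarrow> complex" where
  "NN a n = - (\<i> * of_int n) * conv (\<lambda>k. of_real eps * a k) (\<lambda>k. (\<i> * of_int k + of_real al * (\<i> * of_int k) ^ 3) * a k) n
     + of_real (be * \<bar>of_int n\<bar>\<^sup>2) * conv (P3 a) (\<lambda>k. (\<i> * of_int k)\<^sup>2 * a k) n"

definition EP3 :: "(int \<Rightarrow> ennreal) \<Rightarrow> int \<Rightarrow> ennreal" where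
  "EP3 u n = ennreal (3 * eps) * u n + ennreal (3 * eps\<^sup>2) * econv u u n + ennreal (eps ^ 3) * econv u (econv u u) n"

definition EN :: "(int \<Rightarrow> ennreal) \<Rightarrow> int \<Rightarrow> ennreal" where
  "EN u n = ennreal \<bar>of_int n\<bar> * econv (\<lambda>k. ennreal eps * u k) (\<lambda>k. ennreal (\<bar>of_int k\<bar> + al * \<bar>of_int k\<bar> ^ 3) * u k) n
     + ennreal (be * \<bar>of_int n\<bar>\<^sup>2) * econv (EP3 u) (\<lambda>k. ennreal (\<bar>of_int k\<bar>\<^sup>2) * u k) n"

lemma d_pos: "0 < d" using albe by (simp add: d_def)

lemma M0_nonneg: "0 \<le> M0" by (simp add: M0_def)

lemma esum_A: "esum (\<lambda>n. ennreal (norm (A n))) = ennreal M0"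
  unfolding M0_def by (rule nn_integral_eq_integral) (use summable_A in auto)

lemma EP3_mono: "(\<And>n. u n \<le> v n) \<Longrightarrow> EP3 u n \<le> EP3 v n"
  unfolding EP3_def by (intro add_mono mult_left_mono econv_mono) auto

lemma EN_mono: "(\<And>n. u n \<le> v n) \<Longrightarrow> EN u n \<le> EN v n"
  unfolding EN_def by (intro add_mono mult_left_mono econv_mono EP3_mono) auto

text \<open>Every term of the nonlinearity is an x-derivative and so has the factor
  \<open>n\<close>. Hence a zero mean persists.\<close>

lemma EN_0: "EN u 0 = 0" and NN_0: "NN a 0 = 0"
  by (simp_all add: EN_def NN_def)

lemma EN_zero: "EN (\<lambda>_. 0) n = 0" and NN_zero: "NN (\<lambda>_. 0) n = 0"
  by (simp_all add: EN_def NN_def econv_def conv_def)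

lemma esum_EP3_finite: "esum u < \<infinity> \<Longrightarrow> esum (EP3 u) < \<infinity>"
  unfolding EP3_def
  by (simp add: nn_integral_add nn_integral_cmult esum_econv_1 ennreal_mult_less_top)

lemma fin4_esum: "fin4 u \<Longrightarrow> esum u < \<infinity>"
  by (simp add: fin4_def wsum_def)

lemma symbol_le: "\<bar>of_int k\<bar> + al * \<bar>of_int k\<bar> ^ 3 \<le> (1 + al) * \<bar>real_of_int k\<bar> ^ 4"
  using int_abs_le_power4[of 1 k] mult_left_mono[OF int_abs_le_power4[of 3 k] al]
  by (simp add: algebra_simps)

lemma majd_P3:
  assumes "majd a b u v" "esum u < \<infinity>"
  shows "majd (P3 a) (P3 b) (EP3 u) (EP3 v)"
  unfolding P3_def[abs_def] EP3_def[abs_def] using assms eps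
  by (intro majd_add majd_cmult majd_conv)
     (auto simp: esum_econv_1 ennreal_mult_less_top norm_mult norm_power)

text \<open>The nonlinearity is assembled from multipliers, sums and convolutions, each of which
  preserves \<open>majd\<close>; \<open>fin4 u\<close> supplies the finite sums that the
  convolutions require.\<close>

lemma majd_NN:
  assumes "majd a b u v" "fin4 u"
  shows "majd (NN a) (NN b) (EN u) (EN v)"
  unfolding NN_def[abs_def] EN_def[abs_def]
proof (intro majd_add majd_cmult majd_conv majd_P3 assms esum_EP3_finite fin4_esum[OF assms(2)])
  show "esum (\<lambda>k. ennreal eps * u k) < \<infinity>"
    using fin4_esum[OF assms(2)] by (simp add: nn_integral_cmult ennreal_mult_less_top)
  show "esum (\<lambda>k. ennreal (\<bar>of_int k\<bar> + al * \<bar>of_int k\<bar> ^ 3) * u k) < \<infinity>"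
    by (rule esum_ennreal_mult_finite[OF assms(2) symbol_le])
  show "esum (\<lambda>k. ennreal (\<bar>of_int k\<bar>\<^sup>2) * u k) < \<infinity>"
    by (rule esum_ennreal_mult_finite[OF assms(2), of _ 1]) (use int_abs_le_power4[of 2] in simp)
  fix n :: int
  have "norm (\<i> * of_int n + of_real al * (\<i> * of_int n) ^ 3) \<le> \<bar>of_int n\<bar> + al * \<bar>of_int n\<bar> ^ 3"
    by (rule order.trans[OF norm_triangle_ineq]) (use al in \<open>simp add: norm_mult norm_power\<close>)
  then show "ennreal (norm (\<i> * of_int n + of_real al * (\<i> * of_int n) ^ 3)) \<le> ennreal (\<bar>of_int n\<bar> + al * \<bar>of_int n\<bar> ^ 3)"
    by (rule ennreal_leI)
qed (use eps be in \<open>auto simp: norm_mult norm_power\<close>)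

lemma P3_tendsto:
  assumes "\<And>k. majd (a k) (a k) u u" "\<And>n. (\<lambda>k. a k n) \<longlonglongrightarrow> a' n" "esum u < \<infinity>"
  shows "(\<lambda>k. P3 (a k) n) \<longlonglongrightarrow> P3 a' n"
proof -
  have aa: "(\<lambda>k. conv (a k) (a k) n) \<longlonglongrightarrow> conv a' a' n" for n
    by (rule conv_tendsto[OF assms(1) assms(1) assms(2) assms(2) assms(3) assms(3)])
  have "majd (conv (a k) (a k)) (conv (a k) (a k)) (econv u u) (econv u u)" for k
    by (rule majd_conv[OF assms(1) assms(1) assms(3) assms(3)])
  moreover have "esum (econv u u) < \<infinity>"
    using assms(3) by (simp add: esum_econv_1 ennreal_mult_less_top)
  ultimately have "(\<lambda>k. conv (a k) (conv (a k) (a k)) n) \<longlonglongrightarrow> conv a' (conv a' a') n"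
    by (intro conv_tendsto[OF assms(1) _ assms(2) aa assms(3)])
  with aa show ?thesis
    unfolding P3_def by (intro tendsto_add tendsto_mult tendsto_const assms(2))
qed

text \<open>Continuity of the nonlinearity along coefficientwise limits with a common majorant,
  needed to pass to the limit in Duhamel's formula.\<close>

lemma NN_tendsto:
  assumes "\<And>k. majd (a k) (a k) u u" "\<And>n. (\<lambda>k. a k n) \<longlonglongrightarrow> a' n" "fin4 u"
  shows "(\<lambda>k. NN (a k) n) \<longlonglongrightarrow> NN a' n"
  unfolding NN_def
proof (intro tendsto_add tendsto_mult tendsto_const)
  note fin = fin4_esum[OF assms(3)]
  show "(\<lambda>k. conv (\<lambda>m. of_real eps * a k m) (\<lambda>m. (\<i> * of_int m + of_real al * (\<i> * of_int m) ^ 3) * a k m) n)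
     \<longlonglongrightarrow> conv (\<lambda>m. of_real eps * a' m) (\<lambda>m. (\<i> * of_int m + of_real al * (\<i> * of_int m) ^ 3) * a' m) n"
  proof (rule conv_tendsto)
    show "majd (\<lambda>m. of_real eps * a k m) (\<lambda>m. of_real eps * a k m) (\<lambda>m. ennreal eps * u m) (\<lambda>m. ennreal eps * u m)" for k
      by (intro majd_cmult assms) (use eps in auto)
    show "esum (\<lambda>m. ennreal eps * u m) < \<infinity>"
      using fin by (simp add: nn_integral_cmult ennreal_mult_less_top)
    have "norm (\<i> * of_int n + of_real al * (\<i> * of_int n) ^ 3) \<le> \<bar>of_int n\<bar> + al * \<bar>of_int n\<bar> ^ 3" for n
      by (rule order.trans[OF norm_triangle_ineq]) (use al in \<open>simp add: norm_mult norm_power\<close>)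
    then show "majd (\<lambda>m. (\<i> * of_int m + of_real al * (\<i> * of_int m) ^ 3) * a k m) (\<lambda>m. (\<i> * of_int m + of_real al * (\<i> * of_int m) ^ 3) * a k m)
      (\<lambda>k. ennreal (\<bar>of_int k\<bar> + al * \<bar>of_int k\<bar> ^ 3) * u k) (\<lambda>k. ennreal (\<bar>of_int k\<bar> + al * \<bar>of_int k\<bar> ^ 3) * u k)" for k
      by (intro majd_cmult assms ennreal_leI)
    show "esum (\<lambda>k. ennreal (\<bar>of_int k\<bar> + al * \<bar>of_int k\<bar> ^ 3) * u k) < \<infinity>"
      by (rule esum_ennreal_mult_finite[OF assms(3) symbol_le])
  qed (intro tendsto_intros assms)+
  show "(\<lambda>k. conv (P3 (a k)) (\<lambda>m. (\<i> * of_int m)\<^sup>2 * a k m) n) \<longlonglongrightarrow> conv (P3 a') (\<lambda>m. (\<i> * of_int m)\<^sup>2 * a' m) n"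
  proof (rule conv_tendsto)
    show "majd (P3 (a k)) (P3 (a k)) (EP3 u) (EP3 u)" for k
      by (intro majd_P3 assms fin)
    show "majd (\<lambda>m. (\<i> * of_int m)\<^sup>2 * a k m) (\<lambda>m. (\<i> * of_int m)\<^sup>2 * a k m) (\<lambda>k. ennreal (\<bar>of_int k\<bar>\<^sup>2) * u k) (\<lambda>k. ennreal (\<bar>of_int k\<bar>\<^sup>2) * u k)" for k
      by (intro majd_cmult assms) (simp add: norm_mult norm_power)
    show "esum (\<lambda>k. ennreal (\<bar>of_int k\<bar>\<^sup>2) * u k) < \<infinity>"
      by (rule esum_ennreal_mult_finite[OF assms(3), of _ 1]) (use int_abs_le_power4[of 2] in simp)
    show "(\<lambda>k. P3 (a k) n) \<longlonglongrightarrow> P3 a' n" for n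
      by (rule P3_tendsto[OF assms(1,2) fin])
  qed (intro tendsto_intros assms esum_EP3_finite fin)+
qed

lemma hermit_NN: assumes "hermit a" shows "hermit (NN a)"
proof -
  have c: "hermit (conv b c)" if "hermit b" "hermit c" for b c using that by (rule hermit_conv)
  have aa: "hermit (conv a a)" and aaa: "hermit (conv a (conv a a))" using assms c by auto
  have P: "hermit (P3 a)"
    using assms aa aaa by (simp add: hermit_def P3_def)
  have 1: "hermit (\<lambda>k. of_real eps * a k)" "hermit (\<lambda>k. (\<i> * of_int k + of_real al * (\<i> * of_int k) ^ 3) * a k)"
    "hermit (\<lambda>k. (\<i> * of_int k)\<^sup>2 * a k)"
    using assms by (auto simp: hermit_def power_mult_distrib)
  show ?thesis
    using c[OF 1(1,2)] c[OF P 1(3)] unfolding hermit_def NN_def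
    by simp
qed

text \<open>Since \<open>d = al + be - 1\<close> is smaller than \<open>1 + al + 5 * be\<close>, the
  smallness condition bounds \<open>eps * M0\<close> by an absolute constant, which tames the
  quadratic and cubic parts of \<open>P3\<close>.\<close>

lemma epsM0: "eps * M0 \<le> 1 / 128" and small': "128 * (eps * M0) * (1 + al + 5 * be) \<le> d"
proof -
  show s: "128 * (eps * M0) * (1 + al + 5 * be) \<le> d" using small by (simp add: M0_def d_def mult.assoc)
  show "eps * M0 \<le> 1 / 128"
  proof (rule ccontr)
    assume "\<not> ?thesis"
    then have "1 < 128 * (eps * M0)" by simp
    then have "1 * (1 + al + 5 * be) < 128 * (eps * M0) * (1 + al + 5 * be)"
      using al be by (intro mult_strict_right_mono) auto
    from less_le_trans[OF this s[unfolded d_def]] show False using al be by simp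
  qed
qed

text \<open>The central nonlinear estimate. Each term puts \<open>wsum 4\<close> on one factor and
  \<open>wsum 0\<close>, at most \<open>M0\<close>, on all others, so the nonlinearity is a small
  multiple of the dissipation. The weight needs nothing beyond submultiplicativity.\<close>

lemma wsum_EN:
  assumes W: "\<And>k m. w (k + m) \<le> w k * w m" and X: "wsum 0 w u \<le> ennreal M0"
  shows "wsum 0 w (EN u) \<le> ennreal (d / 32) * wsum 4 w u"
proof -
  let ?X = "wsum 0 w u" and ?Y = "wsum 4 w u" and ?m = "ennreal M0"
  let ?T1 = "wsum 0 w (\<lambda>n. ennreal \<bar>of_int n\<bar> * econv (\<lambda>k. ennreal eps * u k) (\<lambda>k. ennreal (\<bar>of_int k\<bar> + al * \<bar>of_int k\<bar> ^ 3) * u k) n)"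
  let ?T2 = "wsum 0 w (\<lambda>n. ennreal (be * \<bar>of_int n\<bar>\<^sup>2) * econv (EP3 u) (\<lambda>k. ennreal (\<bar>of_int k\<bar>\<^sup>2) * u k) n)"
  let ?B = "be * ((3 * eps + 3 * eps\<^sup>2 * (16 * M0) + eps ^ 3 * (136 * (M0 * M0))) * M0)
      + 3 * be * (3 * eps * M0 + 3 * eps\<^sup>2 * (M0 * M0) + eps ^ 3 * (M0 * (M0 * M0)))"
  have P0: "wsum 0 w (EP3 u) \<le> ennreal (3 * eps) * ?m + ennreal (3 * eps\<^sup>2) * (?m * ?m) + ennreal (eps ^ 3) * (?m * (?m * ?m))"
    unfolding EP3_def[abs_def] wsum_add wsum_cmult
    using X by (intro add_mono mult_left_mono order.trans[OF wsum_econv_0[OF W]] mult_mono) auto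
  have uu4: "wsum 4 w (econv u u) \<le> 16 * (?m * ?Y)"
  proof -
    have "wsum 4 w (econv u u) \<le> 8 * (?Y * ?X) + 8 * (?X * ?Y)" by (rule wsum_econv_4[OF W])
    also have "\<dots> = 16 * (?X * ?Y)" by (simp add: mult.commute flip: distrib_right)
    also have "\<dots> \<le> 16 * (?m * ?Y)" using X by (intro mult_left_mono mult_right_mono) auto
    finally show ?thesis .
  qed
  \<comment> \<open>The constant is \<open>8 + 8 * 16\<close>, from \<open>power4_add_le\<close> and
    the bound for two factors.\<close>
  have uuu4: "wsum 4 w (econv u (econv u u)) \<le> 136 * (?m * ?m * ?Y)"
  proof -
    have "wsum 4 w (econv u (econv u u)) \<le> 8 * (?Y * wsum 0 w (econv u u)) + 8 * (?X * wsum 4 w (econv u u))"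
      by (rule wsum_econv_4[OF W])
    also have "\<dots> \<le> 8 * (?Y * (?m * ?m)) + 8 * (?m * (16 * (?m * ?Y)))"
      using X by (intro add_mono mult_left_mono mult_mono order.trans[OF wsum_econv_0[OF W]] uu4) auto
    also have "\<dots> = 8 * (?m * ?m * ?Y) + 128 * (?m * ?m * ?Y)" by (simp add: mult_ac)
    also have "\<dots> = 136 * (?m * ?m * ?Y)" by (simp flip: distrib_right)
    finally show ?thesis .
  qed
  have P4: "wsum 4 w (EP3 u) \<le> ennreal (3 * eps) * ?Y + ennreal (3 * eps\<^sup>2) * (16 * (?m * ?Y)) + ennreal (eps ^ 3) * (136 * (?m * ?m * ?Y))"
    unfolding EP3_def[abs_def] wsum_add wsum_cmult
    by (intro add_mono mult_left_mono uu4 uuu4) auto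
  have "?T1
     \<le> ennreal (1 + al) * (wsum 4 w (\<lambda>k. ennreal eps * u k) * ?X) + ennreal (3 * (1 + al)) * (wsum 0 w (\<lambda>k. ennreal eps * u k) * ?Y)"
  proof (rule wsum_econv_gen[OF W])
    fix k m :: int
    have "\<bar>real_of_int (k + m)\<bar> * (\<bar>of_int m\<bar> + al * \<bar>of_int m\<bar> ^ 3)
        = \<bar>real_of_int (k + m)\<bar> * \<bar>of_int m\<bar> + al * (\<bar>real_of_int (k + m)\<bar> * \<bar>of_int m\<bar> ^ 3)"
      by (simp add: algebra_simps)
    also have "\<dots> \<le> (\<bar>real_of_int k\<bar> ^ 4 + 3 * \<bar>real_of_int m\<bar> ^ 4) + al * (\<bar>real_of_int k\<bar> ^ 4 + 3 * \<bar>real_of_int m\<bar> ^ 4)"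
      by (intro add_mono mult_left_mono frequency_bounds al)
    finally show "\<bar>real_of_int (k + m)\<bar> * (\<bar>of_int m\<bar> + al * \<bar>of_int m\<bar> ^ 3) \<le> (1 + al) * \<bar>real_of_int k\<bar> ^ 4 + 3 * (1 + al) * \<bar>real_of_int m\<bar> ^ 4"
      by (simp add: algebra_simps)
  qed (use al in auto)
  also have "\<dots> = ennreal (4 * (1 + al) * eps) * (?X * ?Y)"
  proof -
    have "ennreal (4 * (1 + al) * eps) = ennreal (1 + al) * ennreal eps + ennreal (3 * (1 + al)) * ennreal eps"
      using al eps by (simp flip: ennreal_mult ennreal_plus add: algebra_simps)
    then show ?thesis unfolding wsum_cmult by (simp only: distrib_left distrib_right mult_ac)
  qed
  also have "\<dots> \<le> ennreal (4 * (1 + al) * eps) * (?m * ?Y)"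
    using X by (intro mult_left_mono mult_right_mono) auto
  finally have T1: "?T1
     \<le> ennreal (4 * (1 + al) * eps) * (?m * ?Y)" .
  have "?T2
     \<le> ennreal be * (wsum 4 w (EP3 u) * ?X) + ennreal (3 * be) * (wsum 0 w (EP3 u) * ?Y)"
  proof (rule wsum_econv_gen[OF W])
    fix k m :: int
    have "be * (\<bar>real_of_int (k + m)\<bar>\<^sup>2 * \<bar>real_of_int m\<bar>\<^sup>2) \<le> be * (\<bar>real_of_int k\<bar> ^ 4 + 3 * \<bar>real_of_int m\<bar> ^ 4)"
      by (intro mult_left_mono frequency_bounds be)
    then show "be * \<bar>real_of_int (k + m)\<bar>\<^sup>2 * \<bar>real_of_int m\<bar>\<^sup>2 \<le> be * \<bar>real_of_int k\<bar> ^ 4 + 3 * be * \<bar>real_of_int m\<bar> ^ 4"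
      by (simp only: algebra_simps)
  qed (use be in auto)
  also have "\<dots> \<le> ennreal be * ((ennreal (3 * eps) * ?Y + ennreal (3 * eps\<^sup>2) * (16 * (?m * ?Y)) + ennreal (eps ^ 3) * (136 * (?m * ?m * ?Y))) * ?m)
     + ennreal (3 * be) * ((ennreal (3 * eps) * ?m + ennreal (3 * eps\<^sup>2) * (?m * ?m) + ennreal (eps ^ 3) * (?m * (?m * ?m))) * ?Y)"
    using X by (intro add_mono mult_left_mono mult_mono P0 P4) auto
  also have "\<dots> = ennreal (?B) * ?Y"
  proof -
    have *: "ennreal b * ((ennreal c1 * y + ennreal c2 * (ennreal s * (ennreal m * y)) + ennreal c3 * (ennreal r * (ennreal m * ennreal m * y))) * ennreal m)
        + ennreal b' * ((ennreal c1 * ennreal m + ennreal c2 * (ennreal m * ennreal m) + ennreal c3 * (ennreal m * (ennreal m * ennreal m))) * y)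
        = ennreal (b * ((c1 + c2 * (s * m) + c3 * (r * (m * m))) * m) + b' * (c1 * m + c2 * (m * m) + c3 * (m * (m * m)))) * y"
      if "0 \<le> b" "0 \<le> b'" "0 \<le> c1" "0 \<le> c2" "0 \<le> c3" "0 \<le> m" "0 \<le> s" "0 \<le> r" for b b' c1 c2 c3 m s r :: real and y
      using that by (simp add: ennreal_mult ennreal_plus distrib_left distrib_right mult_ac add_ac)
    have 16: "16 = ennreal 16" "136 = ennreal 136" by auto
    show ?thesis unfolding 16 by (rule *) (use be eps M0_nonneg in auto)
  qed
  finally have T2: "?T2
     \<le> ennreal (?B) * ?Y" .
  define x where "x = eps * M0"
  have x: "0 \<le> x" "x \<le> 1 / 128" using eps M0_nonneg epsM0 by (auto simp: x_def)
  \<comment> \<open>For \<open>x \<le> 1 / 128\<close> the bracket is below 20, and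
    \<open>4 * (1 + al) + 20 * be = 4 * (1 + al + 5 * be)\<close>. This explains the 5 in
    \<open>small\<close>, and \<open>128 = 4 * 32\<close> gives the bound
    \<open>d / 32\<close>.\<close>
  have B: "?B = be * (x * (12 + 57 * x + 139 * (x * x)))"
    unfolding x_def by (simp add: algebra_simps power2_eq_square power3_eq_cube)
  have xx: "x * x \<le> 1 / 128 * (1 / 128)" using x by (intro mult_mono) auto
  have "?B \<le> be * (x * 20)" unfolding B using x xx be by (intro mult_left_mono) auto
  moreover have "4 * (1 + al) * eps * M0 + be * (x * 20) \<le> d / 32"
    using small' by (simp add: x_def algebra_simps)
  ultimately have le: "4 * (1 + al) * eps * M0 + ?B \<le> d / 32" by linarith
  have Bn: "0 \<le> ?B" unfolding B using x be by auto
  have "wsum 0 w (EN u) \<le> ennreal (4 * (1 + al) * eps) * (?m * ?Y) + ennreal ?B * ?Y"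
    unfolding EN_def[abs_def] wsum_add by (intro add_mono T1 T2)
  also have "\<dots> = ennreal (4 * (1 + al) * eps * M0 + ?B) * ?Y"
  proof -
    have "ennreal (4 * (1 + al) * eps * M0 + ?B) = ennreal (4 * (1 + al) * eps) * ?m + ennreal ?B"
      using al eps M0_nonneg Bn by (subst ennreal_plus) (auto simp: ennreal_mult)
    then show ?thesis by (simp only: distrib_right mult.assoc)
  qed
  also have "\<dots> \<le> ennreal (d / 32) * ?Y"
    by (intro mult_right_mono ennreal_leI le) auto
  finally show ?thesis .
qed


section \<open>Measurability in time of the nonlinear operators\<close>

lemma measurable_econv:
  assumes "\<And>n. (\<lambda>s. u s n) \<in> borel_measurable M" "\<And>n. (\<lambda>s. v s n) \<in> borel_measurable M"
  shows "(\<lambda>s. econv (u s) (v s) n) \<in> borel_measurable M"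
  unfolding econv_def by (intro measurable_esum borel_measurable_times_ennreal assms)

lemma measurable_conv:
  assumes "\<And>n. (\<lambda>s. a s n) \<in> borel_measurable M" "\<And>n. (\<lambda>s. b s n) \<in> borel_measurable M"
  shows "(\<lambda>s. conv (a s) (b s) n) \<in> borel_measurable M"
  unfolding conv_def by (intro measurable_zsum borel_measurable_times assms)

lemma measurable_EN:
  assumes "\<And>n. (\<lambda>s. u s n) \<in> borel_measurable M"
  shows "(\<lambda>s. EN (u s) n) \<in> borel_measurable M"
  unfolding EN_def EP3_def
  by (intro measurable_econv borel_measurable_times_ennreal borel_measurable_add borel_measurable_const assms)

lemma measurable_NN:
  assumes "\<And>n. (\<lambda>s. a s n) \<in> borel_measurable M"
  shows "(\<lambda>s. NN (a s) n) \<in> borel_measurable M"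
  unfolding NN_def P3_def
  by (intro measurable_conv borel_measurable_times borel_measurable_add borel_measurable_const assms)

lemma measurable_wsum:
  assumes "\<And>n. (\<lambda>s. u s n) \<in> borel_measurable M" "\<And>n. (\<lambda>s. w s n) \<in> borel_measurable M"
  shows "(\<lambda>s. wsum j (w s) (u s)) \<in> borel_measurable M"
  unfolding wsum_def by (intro measurable_esum borel_measurable_times_ennreal borel_measurable_const assms)

section \<open>Picard iteration\<close>

text \<open>The value may be infinite until \<open>energy\<close> is available. The open left end of
  \<open>{0<..t}\<close> leaves out time 0, where the datum has no four moments in general.\<close>

primrec majorant :: "nat \<Rightarrow> real \<Rightarrow> int \<Rightarrow> ennreal" where
  "majorant 0 = (\<lambda>t n. 0)"
| "majorant (Suc k) = (\<lambda>t n. ennreal (exp (- lam n * t)) * ennreal (norm (A n)) +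
     (esint {0<..t} (\<lambda>s. ennreal (exp (- lam n * (t - s))) * EN (majorant k s) n)))"

primrec picard :: "nat \<Rightarrow> real \<Rightarrow> int \<Rightarrow> complex" where
  "picard 0 = (\<lambda>t n. 0)"
| "picard (Suc k) = (\<lambda>t n. of_real (exp (- lam n * t)) * A n +
     (sint {0<..t} (\<lambda>s. of_real (exp (- lam n * (t - s))) * NN (picard k s) n)))"

lemma indicator_Ioc: "indicator {0<..t} s = (if 0 < s \<and> s \<le> t then 1 else 0 :: 'b::zero_neq_one)" for s t :: real
  by (auto simp: indicator_def)

lemma measurable_majorant: "(\<lambda>t. majorant k t n) \<in> borel_measurable borel"
proof (induction k arbitrary: n)
  case (Suc k)
  note [measurable] = measurable_EN[OF Suc]
  show ?case by (simp add: indicator_Ioc)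
qed simp

lemma measurable_picard: "(\<lambda>t. picard k t n) \<in> borel_measurable borel"
proof (induction k arbitrary: n)
  case (Suc k)
  note [measurable] = measurable_NN[OF Suc]
  show ?case by (simp add: indicator_Ioc)
qed simp

lemma measurable_W: "(\<lambda>t. W t n) \<in> borel_measurable borel"
  unfolding W_def by simp

lemma majorant_mono: "majorant k t n \<le> majorant (Suc k) t n"
proof (induction k arbitrary: t n)
  case (Suc k)
  show ?case
    unfolding majorant.simps(2)[of "Suc k"] unfolding majorant.simps(2)[of k]
    by (intro add_mono order_refl nn_integral_mono mult_left_mono EN_mono) (use Suc in simp_all)
qed simp

lemma incseq_majorant: "incseq (\<lambda>k. majorant k t n)"
  by (rule incseq_SucI) (rule majorant_mono)

lemma majorant_freq_0: "majorant k t 0 = 0"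
  by (cases k) (simp_all add: A_0 EN_0)

text \<open>The triangle inequality for \<open>|n|\<close>; the constant part \<open>d / 64\<close>
  occurs once on the left and twice on the right.\<close>

lemma W_submult: "0 \<le> t \<Longrightarrow> W t (k + m) \<le> W t k * W t m"
proof -
  assume t: "0 \<le> t"
  have "th (k + m) \<le> th k + th m"
    using d_pos mult_left_mono[OF abs_triangle_ineq[of "real_of_int k" "of_int m"], of "d / 2"]
    by (simp add: th_def algebra_simps)
  then have "th (k + m) * t \<le> th k * t + th m * t" using t by (metis distrib_right mult_right_mono)
  then show ?thesis by (simp add: W_def exp_add[symmetric] flip: ennreal_mult)
qed

lemma W_ge_1: "0 \<le> t \<Longrightarrow> 1 \<le> W t n"
  unfolding W_def using d_pos by (simp add: th_def)

text \<open>For \<open>n \<noteq> 0\<close>, \<open>lam n\<close> is at least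
  \<open>d * |n| ^ 4\<close> and \<open>th n\<close> at most
  \<open>(1 / 2 + 1 / 64) * d * |n| ^ 4\<close>. The difference of the factors is
  \<open>31 / 64\<close>.\<close>

lemma gap: "n \<noteq> 0 \<Longrightarrow> 31 / 64 * d * \<bar>real_of_int n\<bar> ^ 4 \<le> lam n - th n"
proof -
  assume "n \<noteq> 0"
  define x where "x = \<bar>real_of_int n\<bar>"
  have x1: "1 \<le> x" using \<open>n \<noteq> 0\<close> unfolding x_def by linarith
  have x: "x \<le> x ^ 4" "1 \<le> x ^ 4" "x\<^sup>2 \<le> x ^ 4"
    using x1 power_increasing[of 1 4 x] power_increasing[of 0 4 x] power_increasing[of 2 4 x] by auto
  have "d / 2 * x + d / 64 * 1 \<le> d / 2 * x ^ 4 + d / 64 * x ^ 4"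
    using d_pos x by (intro add_mono mult_left_mono) auto
  moreover have "lam n = (1 + d) * x ^ 4 - x\<^sup>2" by (simp add: lam_def d_def x_def)
  ultimately show ?thesis
    using x(3) by (simp add: th_def x_def[symmetric] algebra_simps)
qed

definition diss :: "(real \<Rightarrow> int \<Rightarrow> ennreal) \<Rightarrow> real \<Rightarrow> ennreal" where
  "diss u t = esint {0..t} (\<lambda>r. wsum 4 (W r) (u r))"

text \<open>\<open>duhamel_energy\<close> for the weighted mode, whose decay rate is
  \<open>lam n - th n\<close>; \<open>gap\<close> then bounds that rate from below. At frequency 0
  the left side vanishes.\<close>

lemma mode_energy:
  assumes t: "0 \<le> t"
  shows "W t n * majorant (Suc k) t n + ennreal (31 / 64 * d) *
      (esint {0..t} (\<lambda>r. ennreal (\<bar>of_int n\<bar> ^ 4) * (W r n * majorant (Suc k) r n)))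
    \<le> ennreal (norm (A n)) + esint {0<..t} (\<lambda>s. W s n * EN (majorant k s) n)"
proof (cases "n = 0")
  case True
  then show ?thesis by (simp add: majorant_freq_0 del: majorant.simps)
next
  case False
  define m where "m = lam n - th n"
  have pos: "0 < \<bar>real_of_int n\<bar> ^ 4" using False by simp
  have m: "31 / 64 * d * \<bar>real_of_int n\<bar> ^ 4 \<le> m" using gap[OF False] by (simp add: m_def)
  have m0: "0 < m" by (rule less_le_trans[OF _ m]) (use d_pos pos in auto)
  note meas[measurable] = measurable_EN[OF measurable_majorant[of k]] measurable_W[of n] measurable_majorant[of "Suc k" n]
  \<comment> \<open>Multiplying Duhamel's formula by the weight preserves its form: the rate
    \<open>lam n\<close> becomes \<open>m\<close>, and the source acquires the weight at its own
    time \<open>s\<close>.\<close>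
  have z: "W r n * majorant (Suc k) r n = ennreal (exp (- m * r)) * ennreal (norm (A n)) +
     (esint {0<..r} (\<lambda>s. ennreal (exp (- m * (r - s))) * (W s n * EN (majorant k s) n)))" for r
  proof -
    have 1: "W r n * ennreal (exp (- lam n * r)) = ennreal (exp (- m * r))"
      unfolding W_def m_def by (simp flip: ennreal_mult exp_add add: algebra_simps)
    have 2: "W r n * ennreal (exp (- lam n * (r - s))) = ennreal (exp (- m * (r - s))) * W s n" for s
      unfolding W_def m_def by (simp flip: ennreal_mult exp_add add: algebra_simps)
    have "W r n * majorant (Suc k) r n = (W r n * ennreal (exp (- lam n * r))) * ennreal (norm (A n)) +
      (\<integral>\<^sup>+s. W r n * (indicator {0<..r} s * (ennreal (exp (- lam n * (r - s))) * EN (majorant k s) n)) \<partial>lborel)"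
      by (simp add: distrib_left nn_integral_cmult mult.assoc)
    also have "(\<lambda>s. W r n * (indicator {0<..r} s * (ennreal (exp (- lam n * (r - s))) * EN (majorant k s) n)))
       = (\<lambda>s. indicator {0<..r} s * ((W r n * ennreal (exp (- lam n * (r - s)))) * EN (majorant k s) n))"
      by (simp add: mult_ac)
    finally show ?thesis unfolding 1 2 by (simp only: mult.assoc)
  qed
  have E: "W t n * majorant (Suc k) t n + ennreal m * esint {0..t} (\<lambda>r. W r n * majorant (Suc k) r n)
    = ennreal (norm (A n)) + esint {0<..t} (\<lambda>s. W s n * EN (majorant k s) n)"
    unfolding z by (rule duhamel_energy[OF m0 t]) measurable
  have "ennreal (31 / 64 * d) *
      (esint {0..t} (\<lambda>r. ennreal (\<bar>of_int n\<bar> ^ 4) * (W r n * majorant (Suc k) r n)))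
      = ennreal (31 / 64 * d) * (ennreal (\<bar>of_int n\<bar> ^ 4) *
      (esint {0..t} (\<lambda>r. W r n * majorant (Suc k) r n)))"
    by (subst nn_integral_cmult[symmetric]) (simp_all add: mult_ac del: majorant.simps)
  also have "\<dots> = ennreal (31 / 64 * d * \<bar>of_int n\<bar> ^ 4) * esint {0..t} (\<lambda>r. W r n * majorant (Suc k) r n)"
  proof -
    have "ennreal (31 / 64 * d * \<bar>real_of_int n\<bar> ^ 4) = ennreal (31 / 64 * d) * ennreal (\<bar>real_of_int n\<bar> ^ 4)"
      by (rule ennreal_mult) (use d_pos in auto)
    then show ?thesis by (simp only: mult.assoc)
  qed
  also have "\<dots> \<le> ennreal m * esint {0..t} (\<lambda>r. W r n * majorant (Suc k) r n)"
    by (intro mult_right_mono ennreal_leI m) auto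
  finally show ?thesis unfolding E[symmetric] by (intro add_left_mono)
qed

lemma esum_nn_integral:
  assumes "\<And>n. f n \<in> borel_measurable borel"
  shows "esum (\<lambda>n. \<integral>\<^sup>+r. f n r \<partial>lborel) = (\<integral>\<^sup>+r. esum (\<lambda>n. f n r) \<partial>(lborel :: real measure))"
  by (rule zl.Fubini'[symmetric]) (use assms in \<open>simp add: measurable_case_zl\<close>)

text \<open>Sum of \<open>mode_energy\<close> over all frequencies, exchanged with the time integral
  by Tonelli. The bound on the k-th majorant is exactly what \<open>wsum_EN\<close> demands of
  it.\<close>

lemma energy_step:
  assumes t: "0 \<le> t" and IH: "\<And>t. 0 \<le> t \<Longrightarrow> wsum 0 (W t) (majorant k t) \<le> ennreal M0"
  shows "wsum 0 (W t) (majorant (Suc k) t) + ennreal (31 / 64 * d) * diss (majorant (Suc k)) t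
    \<le> ennreal M0 + ennreal (d / 32) * diss (majorant k) t"
proof -
  note meas[measurable] = measurable_EN[OF measurable_majorant[of k]] measurable_W measurable_majorant[of "Suc k"] measurable_majorant[of k]
  have "wsum 0 (W t) (majorant (Suc k) t) + ennreal (31 / 64 * d) * diss (majorant (Suc k)) t
     = esum (\<lambda>n. W t n * majorant (Suc k) t n + ennreal (31 / 64 * d) *
      (esint {0..t} (\<lambda>r. ennreal (\<bar>of_int n\<bar> ^ 4) * (W r n * majorant (Suc k) r n))))"
    unfolding diss_def wsum_def
    by (subst nn_integral_add) (auto simp: nn_integral_cmult esum_nn_integral simp del: majorant.simps)
  also have "\<dots> \<le> esum (\<lambda>n. ennreal (norm (A n)) + esint {0<..t} (\<lambda>s. W s n * EN (majorant k s) n))"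
    by (intro nn_integral_mono mode_energy t)
  also have "\<dots> = ennreal M0 + esint {0<..t} (\<lambda>s. wsum 0 (W s) (EN (majorant k s)))"
    unfolding wsum_def by (subst nn_integral_add) (auto simp: esum_A esum_nn_integral nn_integral_cmult)
  also have "esint {0<..t} (\<lambda>s. wsum 0 (W s) (EN (majorant k s)))
    \<le> (\<integral>\<^sup>+s. ennreal (d / 32) * (indicator {0..t} s * wsum 4 (W s) (majorant k s)) \<partial>lborel)"
  proof (intro nn_integral_mono)
    fix s
    show "indicator {0<..t} s * wsum 0 (W s) (EN (majorant k s)) \<le> ennreal (d / 32) * (indicator {0..t} s * wsum 4 (W s) (majorant k s))"
    proof (cases "s \<in> {0<..t}")
      case True
      then have "wsum 0 (W s) (EN (majorant k s)) \<le> ennreal (d / 32) * wsum 4 (W s) (majorant k s)"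
        by (intro wsum_EN W_submult IH) auto
      then show ?thesis using True by simp
    qed simp
  qed
  also have "\<dots> = ennreal (d / 32) * diss (majorant k) t"
    unfolding diss_def by (rule nn_integral_cmult) (auto intro!: borel_measurable_times_ennreal measurable_wsum)
  finally show ?thesis by (simp add: add_left_mono)
qed

lemma diss_mono: "(\<And>r n. u r n \<le> u' r n) \<Longrightarrow> diss u t \<le> diss u' t"
  unfolding diss_def by (intro nn_integral_mono mult_left_mono wsum_mono) auto

text \<open>Here \<open>p\<close> and \<open>q\<close> are the old and the new dissipation in units
  of \<open>d / 64\<close>. As \<open>p \<le> q\<close>, the cost \<open>2 * p\<close> is absorbed
  by \<open>31 * q\<close>. Cancelling \<open>2 * q\<close> in \<open>[0, \<infinity>]\<close>
  requires \<open>q\<close> finite, which follows from the finiteness of \<open>p\<close>.\<close>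

lemma ennreal_absorb:
  fixes X Y :: ennreal
  assumes "X + ennreal 31 * q \<le> Y + ennreal 2 * p" "p \<le> q" "ennreal 29 * p \<le> Y" "Y < \<infinity>"
  shows "X + ennreal 29 * q \<le> Y"
proof -
  have "p < \<infinity>"
    using le_less_trans[OF assms(3,4)] by (auto simp: ennreal_mult_less_top)
  then have "Y + ennreal 2 * p < \<infinity>" using assms(4) by (simp add: ennreal_mult_less_top)
  then have "X + ennreal 31 * q < \<infinity>" by (rule le_less_trans[OF assms(1)])
  then have q: "q < \<infinity>" by (auto simp: ennreal_mult_less_top)
  have "ennreal 2 * q + (X + ennreal 29 * q) = X + (ennreal 29 + ennreal 2) * q"
    by (simp only: distrib_right add_ac)
  also have "\<dots> = X + ennreal 31 * q" by (simp flip: ennreal_plus)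
  also have "\<dots> \<le> ennreal 2 * q + Y"
    using assms(1,2) by (metis add.commute add_left_mono mult_left_mono order_trans zero_le)
  finally show ?thesis
    using q by (auto simp: ennreal_add_left_cancel_le ennreal_mult_eq_top_iff)
qed

text \<open>The induction reproduces its own smallness: a majorant bounded by \<open>M0\<close>
  produces a next one bounded by \<open>M0\<close>, because the nonlinear cost is paid out of the
  dissipation.\<close>

lemma energy:
  "0 \<le> t \<Longrightarrow> wsum 0 (W t) (majorant k t) + ennreal (29 / 64 * d) * diss (majorant k) t \<le> ennreal M0"
proof (induction k arbitrary: t)
  case 0
  then show ?case by (simp add: wsum_def diss_def)
next
  case (Suc k)
  have c: "ennreal (x / 64 * d) * y = ennreal x * (ennreal (d / 64) * y)" if "0 \<le> x" for x y
    using that d_pos by (simp flip: ennreal_mult' mult.assoc)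
  have IH: "wsum 0 (W t) (majorant k t) \<le> ennreal M0" if "0 \<le> t" for t
    using Suc.IH[OF that] by (rule order.trans[rotated]) simp
  have "wsum 0 (W t) (majorant (Suc k) t) + ennreal 31 * (ennreal (d / 64) * diss (majorant (Suc k)) t)
     \<le> ennreal M0 + ennreal 2 * (ennreal (d / 64) * diss (majorant k) t)"
    using energy_step[OF Suc.prems IH] c[of 31] c[of 2] by simp
  moreover have "ennreal (d / 64) * diss (majorant k) t \<le> ennreal (d / 64) * diss (majorant (Suc k)) t"
    by (intro mult_left_mono diss_mono majorant_mono) simp
  moreover have "ennreal 29 * (ennreal (d / 64) * diss (majorant k) t) \<le> ennreal M0"
    unfolding c[of 29, OF zero_le_numeral, symmetric]
    by (rule order.trans[OF _ Suc.IH[OF Suc.prems]]) simp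
  ultimately have "wsum 0 (W t) (majorant (Suc k) t) + ennreal 29 * (ennreal (d / 64) * diss (majorant (Suc k)) t) \<le> ennreal M0"
    by (rule ennreal_absorb) simp
  then show ?case by (simp only: c[OF zero_le_numeral])
qed

end

section \<open>Limits of the majorants and of the complex iterates\<close>

lemma wsum_SUP:
  assumes "\<And>n. incseq (\<lambda>k. u k n)"
  shows "wsum j w (\<lambda>n. SUP k. u k n) = (SUP k. wsum j w (u k))"
proof -
  have "wsum j w (\<lambda>n. SUP k. u k n) = esum (\<lambda>n. SUP k. ennreal (\<bar>of_int n\<bar> ^ j) * (w n * u k n))"
    unfolding wsum_def by (simp add: SUP_mult_left_ennreal)
  also have "\<dots> = (SUP k. wsum j w (u k))"
    unfolding wsum_def
    by (rule nn_integral_monotone_convergence_SUP)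
       (use assms in \<open>auto simp: incseq_def le_fun_def intro!: mult_left_mono\<close>)
  finally show ?thesis .
qed

lemma incseq_wsum: "(\<And>n. incseq (\<lambda>k. u k n)) \<Longrightarrow> incseq (\<lambda>k. wsum j w (u k))"
  unfolding incseq_def by (auto intro!: wsum_mono)

context thin_film
begin

declare majorant.simps(2) [simp del] picard.simps(2) [simp del]

definition mlim :: "real \<Rightarrow> int \<Rightarrow> ennreal" where "mlim t n = (SUP k. majorant k t n)"

lemma majorant_le_mlim: "majorant k t n \<le> mlim t n"
  unfolding mlim_def by (rule SUP_upper) simp

lemma measurable_mlim: "(\<lambda>t. mlim t n) \<in> borel_measurable borel"
  unfolding mlim_def by (intro borel_measurable_SUP measurable_majorant) simp

lemma wsum_mlim: "wsum j w (mlim t) = (SUP k. wsum j w (majorant k t))"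
  unfolding mlim_def by (rule wsum_SUP[OF incseq_majorant])

lemma diss_mlim: "diss mlim t = (SUP k. diss (majorant k) t)"
proof -
  have "diss mlim t = (\<integral>\<^sup>+r. (SUP k. indicator {0..t} r * wsum 4 (W r) (majorant k r)) \<partial>lborel)"
    unfolding diss_def wsum_mlim by (simp add: SUP_mult_left_ennreal)
  also have "\<dots> = (SUP k. diss (majorant k) t)"
    unfolding diss_def
  proof (rule nn_integral_monotone_convergence_SUP)
    show "incseq (\<lambda>k r. indicator {0..t} r * wsum 4 (W r) (majorant k r))"
      by (intro incseq_SucI le_funI mult_left_mono wsum_mono majorant_mono) simp
    show "(\<lambda>r. indicator {0..t} r * wsum 4 (W r) (majorant k r)) \<in> borel_measurable lborel" for k
      by (auto intro!: borel_measurable_times_ennreal measurable_wsum simp: measurable_majorant measurable_W)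
  qed
  finally show ?thesis .
qed

lemma energy_mlim:
  assumes "0 \<le> t"
  shows "wsum 0 (W t) (mlim t) + ennreal (29 / 64 * d) * diss mlim t \<le> ennreal M0"
proof -
  have "wsum 0 (W t) (mlim t) + ennreal (29 / 64 * d) * diss mlim t
     = (SUP k. wsum 0 (W t) (majorant k t)) + (SUP k. ennreal (29 / 64 * d) * diss (majorant k) t)"
    by (simp add: wsum_mlim diss_mlim SUP_mult_left_ennreal)
  also have "\<dots> = (SUP k. wsum 0 (W t) (majorant k t) + ennreal (29 / 64 * d) * diss (majorant k) t)"
    by (rule ennreal_SUP_add[symmetric])
       (auto intro!: incseq_wsum incseq_majorant incseq_SucI mult_left_mono diss_mono wsum_mono majorant_mono)
  also have "\<dots> \<le> ennreal M0"
    by (intro SUP_least energy assms)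
  finally show ?thesis .
qed

lemma wsum_mlim_le: "0 \<le> t \<Longrightarrow> wsum 0 (W t) (mlim t) \<le> ennreal M0"
  by (rule order.trans[OF _ energy_mlim]) simp_all

lemma diss_mlim_finite: "0 \<le> t \<Longrightarrow> diss mlim t < \<infinity>"
proof -
  assume "0 \<le> t"
  have "ennreal (29 / 64 * d) * diss mlim t \<le> ennreal M0"
    by (rule order.trans[OF _ energy_mlim[OF \<open>0 \<le> t\<close>]]) simp
  then have "ennreal (29 / 64 * d) * diss mlim t < \<infinity>"
    by (rule le_less_trans) simp
  then show ?thesis using d_pos by (auto simp: ennreal_mult_less_top)
qed

lemma freq4_le_W:
  assumes "0 < t"
  shows "ennreal (\<bar>real_of_int n\<bar> ^ 4) \<le> ennreal ((8 / (d * t)) ^ 4) * W t n"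
proof -
  \<comment> \<open>With \<open>y = x / 4 = d * |n| * t / 8\<close> one has
    \<open>y ^ 4 \<le> exp y ^ 4 = exp x\<close>; solving for \<open>|n|\<close> yields the factor
    \<open>8 / (d * t)\<close>.\<close>
  define x where "x = d / 2 * \<bar>real_of_int n\<bar> * t"
  have x0: "0 \<le> x" using d_pos assms by (simp add: x_def)
  have "(x / 4) ^ 4 \<le> exp (x / 4) ^ 4"
    using exp_ge_add_one_self[of "x / 4"] x0 by (intro power_mono) linarith+
  also have "\<dots> = exp x" by (simp flip: exp_of_nat_mult)
  also have "\<dots> \<le> exp (th n * t)"
    using assms d_pos by (simp add: th_def x_def algebra_simps)
  finally have "(x / 4) ^ 4 \<le> exp (th n * t)" .
  then have "(8 / (d * t)) ^ 4 * (x / 4) ^ 4 \<le> (8 / (d * t)) ^ 4 * exp (th n * t)"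
    by (rule mult_left_mono) simp
  also have "(8 / (d * t)) ^ 4 * (x / 4) ^ 4 = \<bar>real_of_int n\<bar> ^ 4"
    using assms d_pos by (simp add: x_def flip: power_mult_distrib)
  finally show ?thesis by (simp add: W_def ennreal_leI flip: ennreal_mult)
qed

text \<open>The dissipation gives four moments for almost every time only. The exponential weight
  gives them at each positive time, so the nonlinearity is controlled pointwise in time.\<close>

lemma fin4_mlim: "0 < t \<Longrightarrow> fin4 (mlim t)"
  unfolding fin4_def
proof
  assume t: "0 < t"
  have fin: "wsum 0 (W t) (mlim t) < \<infinity>" by (rule le_less_trans[OF wsum_mlim_le]) (use t in auto)
  have "wsum 0 (\<lambda>_. 1) (mlim t) \<le> wsum 0 (W t) (mlim t)"
    unfolding wsum_def using W_ge_1[of t] t by (intro nn_integral_mono mult_left_mono mult_right_mono) auto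
  also note fin
  finally show "wsum 0 (\<lambda>_. 1) (mlim t) < \<infinity>" .
  have "wsum 4 (\<lambda>_. 1) (mlim t) \<le> esum (\<lambda>n. ennreal ((8 / (d * t)) ^ 4) * (W t n * mlim t n))"
    unfolding wsum_def
  proof (intro nn_integral_mono)
    fix n
    show "ennreal (\<bar>real_of_int n\<bar> ^ 4) * (1 * mlim t n) \<le> ennreal ((8 / (d * t)) ^ 4) * (W t n * mlim t n)"
      using mult_right_mono[OF freq4_le_W[OF t, of n], of "mlim t n"] by (simp add: mult_ac)
  qed
  also have "\<dots> = ennreal ((8 / (d * t)) ^ 4) * wsum 0 (W t) (mlim t)"
    by (simp add: wsum_def nn_integral_cmult)
  also have "\<dots> < \<infinity>" using fin by (simp add: ennreal_mult_less_top)
  finally show "wsum 4 (\<lambda>_. 1) (mlim t) < \<infinity>" .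
qed

lemma fin4_mono: "fin4 u \<Longrightarrow> (\<And>n. u' n \<le> u n) \<Longrightarrow> fin4 u'"
  unfolding fin4_def by (meson le_less_trans wsum_mono)

lemma EN_finite: assumes "fin4 u" shows "EN u n < \<infinity>"
proof -
  have "esum (\<lambda>k. ennreal eps * u k) < \<infinity>"
    using fin4_esum[OF assms] by (simp add: nn_integral_cmult ennreal_mult_less_top)
  moreover have "esum (\<lambda>k. ennreal (\<bar>of_int k\<bar> + al * \<bar>of_int k\<bar> ^ 3) * u k) < \<infinity>"
    by (rule esum_ennreal_mult_finite[OF assms symbol_le])
  moreover have "esum (\<lambda>k. ennreal (\<bar>of_int k\<bar>\<^sup>2) * u k) < \<infinity>"
    by (rule esum_ennreal_mult_finite[OF assms, of _ 1]) (use int_abs_le_power4[of 2] in simp)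
  ultimately show ?thesis
    using econv_finite esum_EP3_finite[OF fin4_esum[OF assms]]
    unfolding EN_def by (simp add: ennreal_mult_less_top del: infinity_ennreal_def) (simp add: ennreal_mult_less_top)
qed

text \<open>The bound behind \<open>fin4_mlim\<close> is not integrable at time 0, so the
  dissipation is used instead, by way of \<open>wsum_EN\<close>.\<close>

lemma nn_integral_esum_EN_finite:
  assumes "0 \<le> t"
  shows "esint {0<..t} (\<lambda>s. esum (EN (mlim s))) < \<infinity>"
proof -
  have "esint {0<..t} (\<lambda>s. esum (EN (mlim s)))
     \<le> (\<integral>\<^sup>+s. ennreal (d / 32) * (indicator {0..t} s * wsum 4 (W s) (mlim s)) \<partial>lborel)"
  proof (intro nn_integral_mono)
    fix s
    show "indicator {0<..t} s * esum (EN (mlim s)) \<le> ennreal (d / 32) * (indicator {0..t} s * wsum 4 (W s) (mlim s))"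
    proof (cases "s \<in> {0<..t}")
      case True
      then have "esum (EN (mlim s)) \<le> wsum 0 (W s) (EN (mlim s))"
        unfolding wsum_def using mult_right_mono[OF W_ge_1[of s], of "EN (mlim s) _"]
        by (intro nn_integral_mono) auto
      also have "\<dots> \<le> ennreal (d / 32) * wsum 4 (W s) (mlim s)"
        using True by (intro wsum_EN W_submult wsum_mlim_le) auto
      finally show ?thesis using True by simp
    qed simp
  qed
  also have "\<dots> = ennreal (d / 32) * diss mlim t"
    unfolding diss_def
    by (rule nn_integral_cmult) (auto intro!: borel_measurable_times_ennreal measurable_wsum simp: measurable_mlim measurable_W)
  also have "\<dots> < \<infinity>" using diss_mlim_finite[OF assms] by (simp add: ennreal_mult_less_top)
  finally show ?thesis .
qed

lemma nn_integral_EN_finite: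
  assumes "0 \<le> t"
  shows "esint {0<..t} (\<lambda>s. ennreal (exp (- lam n * (t - s))) * EN (mlim s) n) < \<infinity>"
proof (cases "n = 0")
  case False
  have "0 \<le> lam n"
  proof -
    have "0 \<le> th n" "0 \<le> 31 / 64 * d * \<bar>real_of_int n\<bar> ^ 4" using d_pos by (simp_all add: th_def)
    then show ?thesis using gap[OF False] by linarith
  qed
  have "esint {0<..t} (\<lambda>s. ennreal (exp (- lam n * (t - s))) * EN (mlim s) n)
     \<le> esint {0<..t} (\<lambda>s. esum (EN (mlim s)))"
  proof (intro nn_integral_mono)
    fix s
    show "indicator {0<..t} s * (ennreal (exp (- lam n * (t - s))) * EN (mlim s) n) \<le> indicator {0<..t} s * esum (EN (mlim s))"
    proof (cases "s \<in> {0<..t}")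
      case True
      then have "ennreal (exp (- lam n * (t - s))) \<le> 1"
        using \<open>0 \<le> lam n\<close> by simp
      then have "ennreal (exp (- lam n * (t - s))) * EN (mlim s) n \<le> 1 * esum (EN (mlim s))"
        by (intro mult_mono le_esum) auto
      then show ?thesis using True by simp
    qed simp
  qed
  also have "\<dots> < \<infinity>" by (rule nn_integral_esum_EN_finite[OF assms])
  finally show ?thesis .
qed (simp add: EN_0)

text \<open>Each ingredient of Duhamel's formula preserves \<open>majd\<close>: the nonlinearity,
  the exponential factor, the time integral and the addition of the common linear evolution. Only
  times \<open>s > 0\<close> enter the integral, where \<open>fin4_mlim\<close> applies.\<close>

lemma majd_picard: "0 \<le> t \<Longrightarrow> majd (picard (Suc k) t) (picard k t) (majorant (Suc k) t) (majorant k t)"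
proof (induction k arbitrary: t)
  case 0
  show ?case by (simp add: majd_def NN_zero EN_zero norm_mult ennreal_mult picard.simps majorant.simps)
next
  case (Suc k)
  note [measurable] = measurable_EN[OF measurable_majorant[of k]] measurable_EN[OF measurable_majorant[of "Suc k"]]
    measurable_NN[OF measurable_picard[of k]] measurable_NN[OF measurable_picard[of "Suc k"]]
  show ?case unfolding majd_def
  proof
    fix n
    let ?e = "\<lambda>s. exp (- lam n * (t - s))"
    let ?f = "\<lambda>s. indicator {0<..t} s * (complex_of_real (?e s) * NN (picard (Suc k) s) n)"
    let ?g = "\<lambda>s. indicator {0<..t} s * (complex_of_real (?e s) * NN (picard k s) n)"
    let ?p = "\<lambda>s. indicator {0<..t} s * (ennreal (?e s) * EN (majorant (Suc k) s) n)"
    let ?q = "\<lambda>s. indicator {0<..t} s * (ennreal (?e s) * EN (majorant k s) n)"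
    have pw: "ennreal (norm (?g s)) \<le> ?q s \<and> ennreal (norm (?f s - ?g s)) + ?q s \<le> ?p s" for s
    proof (cases "s \<in> {0<..t}")
      case True
      then have "majd (NN (picard (Suc k) s)) (NN (picard k s)) (EN (majorant (Suc k) s)) (EN (majorant k s))"
        by (intro majd_NN Suc.IH fin4_mono[OF fin4_mlim majorant_le_mlim]) auto
      from majd_cmult[OF this, of "\<lambda>_. complex_of_real (?e s)" "\<lambda>_. ennreal (?e s)"]
      show ?thesis using True by (simp add: majd_def)
    qed simp
    have fin: "(\<integral>\<^sup>+s. ?p s \<partial>lborel) < \<infinity>"
      by (rule le_less_trans[OF _ nn_integral_EN_finite[OF Suc.prems, of n]])
         (intro nn_integral_mono mult_left_mono EN_mono majorant_le_mlim, auto)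
    have meas: "?f \<in> borel_measurable lborel" "?g \<in> borel_measurable lborel"
        "?p \<in> borel_measurable lborel" "?q \<in> borel_measurable lborel"
      by simp_all
    note I = majd_integral[OF meas conjunct1[OF pw] conjunct2[OF pw] fin]
    define E where "E = ennreal (exp (- lam n * t)) * ennreal (norm (A n))"
    define C where "C = of_real (exp (- lam n * t)) * A n"
    have CE: "ennreal (norm C) = E" unfolding C_def E_def by (simp add: norm_mult ennreal_mult)
    have a1: "picard (Suc k) t n = C + (\<integral>s. ?g s \<partial>lborel)" "majorant (Suc k) t n = E + (\<integral>\<^sup>+s. ?q s \<partial>lborel)"
      by (simp_all add: C_def E_def picard.simps majorant.simps)
    have a2: "picard (Suc (Suc k)) t n = C + (\<integral>s. ?f s \<partial>lborel)" "majorant (Suc (Suc k)) t n = E + (\<integral>\<^sup>+s. ?p s \<partial>lborel)"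
      by (simp_all add: C_def E_def picard.simps(2)[of "Suc k"] majorant.simps(2)[of "Suc k"])
    have "ennreal (norm (C + (\<integral>s. ?g s \<partial>lborel))) \<le> ennreal (norm C) + ennreal (norm (\<integral>s. ?g s \<partial>lborel))"
      by (rule ennreal_norm_triangle)
    also have "\<dots> \<le> E + (\<integral>\<^sup>+s. ?q s \<partial>lborel)"
      unfolding CE by (intro add_left_mono I(3))
    finally have 1: "ennreal (norm (picard (Suc k) t n)) \<le> majorant (Suc k) t n" unfolding a1 .
    \<comment> \<open>The linear evolution cancels in the difference of iterates but is kept once in
      the majorants, on both sides.\<close>
    have "ennreal (norm (picard (Suc (Suc k)) t n - picard (Suc k) t n)) + majorant (Suc k) t n
       = E + (ennreal (norm ((\<integral>s. ?f s \<partial>lborel) - (\<integral>s. ?g s \<partial>lborel))) + (\<integral>\<^sup>+s. ?q s \<partial>lborel))"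
      unfolding a1 a2 by (simp only: add_diff_cancel_left add_ac)
    also have "\<dots> \<le> majorant (Suc (Suc k)) t n"
      unfolding a2 by (intro add_left_mono I(4))
    finally have 2: "ennreal (norm (picard (Suc (Suc k)) t n - picard (Suc k) t n)) + majorant (Suc k) t n \<le> majorant (Suc (Suc k)) t n" .
    show "ennreal (norm (picard (Suc k) t n)) \<le> majorant (Suc k) t n \<and>
      ennreal (norm (picard (Suc (Suc k)) t n - picard (Suc k) t n)) + majorant (Suc k) t n \<le> majorant (Suc (Suc k)) t n"
      using 1 2 by (rule conjI)
  qed
qed

lemma norm_picard_le: "0 \<le> t \<Longrightarrow> ennreal (norm (picard k t n)) \<le> mlim t n"
  using majd_picard[of t k] unfolding majd_def by (meson order.trans majorant_le_mlim)

lemma mlim_finite: "0 \<le> t \<Longrightarrow> mlim t n < \<infinity>"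
proof -
  assume t: "0 \<le> t"
  have "W t n * mlim t n \<le> wsum 0 (W t) (mlim t)"
    unfolding wsum_def using le_esum[of "\<lambda>n. ennreal (\<bar>of_int n\<bar> ^ 0) * (W t n * mlim t n)" n] by simp
  also have "\<dots> \<le> ennreal M0" by (rule wsum_mlim_le[OF t])
  finally have "W t n * mlim t n < \<infinity>" by (rule le_less_trans) simp
  then show ?thesis using W_ge_1[OF t, of n] by (auto simp: ennreal_mult_less_top)
qed

definition sol :: "real \<Rightarrow> int \<Rightarrow> complex" where "sol t n = lim (\<lambda>k. picard k t n)"

lemma measurable_sol: "(\<lambda>t. sol t n) \<in> borel_measurable borel"
  unfolding sol_def by (intro borel_measurable_lim_metric measurable_picard)

lemma sol_lim: assumes t: "0 \<le> t" shows "(\<lambda>k. picard k t n) \<longlonglongrightarrow> sol t n"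
proof -
  define r where "r k = enn2real (majorant k t n)" for k
  have vr: "majorant k t n = ennreal (r k)" for k
    unfolding r_def using le_less_trans[OF majorant_le_mlim mlim_finite[OF t]] by simp
  have rn: "0 \<le> r k" for k by (simp add: r_def)
  have inc: "incseq r" by (rule incseq_SucI) (use majorant_mono[of _ t n] rn in \<open>simp add: vr\<close>)
  have "r k \<le> enn2real (mlim t n)" for k
    unfolding r_def using majorant_le_mlim mlim_finite[OF t] by (intro enn2real_mono) auto
  then obtain l where "r \<longlonglongrightarrow> l" using incseq_convergent[OF inc, of "enn2real (mlim t n)"] by blast
  \<comment> \<open>The increments of a bounded increasing sequence telescope to a convergent
    series, which dominates the increments of the complex iterates.\<close>
  then have "summable (\<lambda>k. r (Suc k) - r k)" by (rule telescope_summable)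
  moreover have "norm (picard (Suc k) t n - picard k t n) \<le> r (Suc k) - r k" for k
  proof -
    have "ennreal (norm (picard (Suc k) t n - picard k t n)) + ennreal (r k) \<le> ennreal (r (Suc k))"
      using majd_picard[OF t, of k] unfolding majd_def vr[symmetric] by blast
    then have "ennreal (norm (picard (Suc k) t n - picard k t n) + r k) \<le> ennreal (r (Suc k))"
      using rn by simp
    then have "norm (picard (Suc k) t n - picard k t n) + r k \<le> r (Suc k)"
      using rn by (subst (asm) ennreal_le_iff) auto
    then show ?thesis by simp
  qed
  ultimately have "summable (\<lambda>k. picard (Suc k) t n - picard k t n)"
    by (rule summable_comparison_test'[where N=0])
  then have "(\<lambda>N. \<Sum>k<N. picard (Suc k) t n - picard k t n) \<longlonglongrightarrow> (\<Sum>k. picard (Suc k) t n - picard k t n)"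
    by (rule summable_LIMSEQ)
  then have "(\<lambda>N. picard N t n) \<longlonglongrightarrow> (\<Sum>k. picard (Suc k) t n - picard k t n)"
    using sum_lessThan_telescope[of "\<lambda>k. picard k t n"] by simp
  then show ?thesis unfolding sol_def by (simp add: limI)
qed

lemma norm_sol_le: assumes t: "0 \<le> t" shows "ennreal (norm (sol t n)) \<le> mlim t n"
proof -
  have fin: "mlim t n = ennreal (enn2real (mlim t n))" using mlim_finite[OF t, of n] by simp
  have "norm (picard k t n) \<le> enn2real (mlim t n)" for k
    using norm_picard_le[OF t, of k n] by (subst (asm) fin) simp
  then have "norm (sol t n) \<le> enn2real (mlim t n)"
    by (intro LIMSEQ_le_const2[OF tendsto_norm[OF sol_lim[OF t]]]) auto
  then show ?thesis by (subst fin) (rule ennreal_leI)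
qed

lemma majd_self: "(\<And>n. ennreal (norm (b n)) \<le> u n) \<Longrightarrow> majd b b u u"
  by (simp add: majd_def)

lemma norm_NN_sol_le: "0 < t \<Longrightarrow> ennreal (norm (NN (sol t) n)) \<le> EN (mlim t) n"
  using majd_NN[OF majd_self fin4_mlim, of "sol t" t] norm_sol_le[of t] by (simp add: majd_def)

text \<open>Dominated convergence in time; \<open>EN (mlim s)\<close>, damped by the exponential,
  dominates the nonlinearity of every iterate.\<close>

lemma duhamel_sol:
  assumes t: "0 \<le> t"
  shows "sol t n = of_real (exp (- lam n * t)) * A n +
     (sint {0<..t} (\<lambda>s. of_real (exp (- lam n * (t - s))) * NN (sol s) n))"
proof -
  let ?e = "\<lambda>s. exp (- lam n * (t - s))"
  let ?p = "\<lambda>s. indicator {0<..t} s * (ennreal (?e s) * EN (mlim s) n)"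
  note [measurable] = measurable_EN[OF measurable_mlim] measurable_NN[OF measurable_picard] measurable_NN[OF measurable_sol]
  have pf: "?p s < \<infinity>" for s
    using EN_finite[OF fin4_mlim, of s n] by (auto simp: indicator_def ennreal_mult_less_top)
  have bound: "norm (indicator {0<..t} s * (complex_of_real (?e s) * NN (picard k s) n)) \<le> enn2real (?p s)" for k s
  proof -
    have "ennreal (norm (indicator {0<..t} s * (complex_of_real (?e s) * NN (picard k s) n))) \<le> ?p s"
    proof (cases "s \<in> {0<..t}")
      case True
      then have "ennreal (norm (NN (picard k s) n)) \<le> EN (mlim s) n"
        using majd_NN[OF majd_self fin4_mlim, of "picard k s" s] norm_picard_le[of s] by (simp add: majd_def)
      then show ?thesis using True by (simp add: norm_mult ennreal_mult mult_left_mono)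
    qed simp
    then have "ennreal (norm (indicator {0<..t} s * (complex_of_real (?e s) * NN (picard k s) n))) \<le> ennreal (enn2real (?p s))"
      using pf[of s] by simp
    then show ?thesis by (subst (asm) ennreal_le_iff) auto
  qed
  have "(\<integral>\<^sup>+s. ennreal (enn2real (?p s)) \<partial>lborel) = (\<integral>\<^sup>+s. ?p s \<partial>lborel)"
    by (intro nn_integral_cong) (use pf in simp)
  also have "\<dots> < \<infinity>" by (rule nn_integral_EN_finite[OF t])
  finally have int: "integrable lborel (\<lambda>s. enn2real (?p s))"
    by (intro integrableI_bounded) auto
  have "(\<lambda>k. sint {0<..t} (\<lambda>s. complex_of_real (?e s) * NN (picard k s) n))
    \<longlonglongrightarrow> (sint {0<..t} (\<lambda>s. complex_of_real (?e s) * NN (sol s) n))"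
  proof (rule integral_dominated_convergence[OF _ _ int])
    show "AE s in lborel. (\<lambda>k. indicator {0<..t} s * (complex_of_real (?e s) * NN (picard k s) n))
       \<longlonglongrightarrow> indicator {0<..t} s * (complex_of_real (?e s) * NN (sol s) n)"
    proof (intro AE_I2)
      fix s
      show "(\<lambda>k. indicator {0<..t} s * (complex_of_real (?e s) * NN (picard k s) n))
       \<longlonglongrightarrow> indicator {0<..t} s * (complex_of_real (?e s) * NN (sol s) n)"
      proof (cases "s \<in> {0<..t}")
        case True
        then have "(\<lambda>k. NN (picard k s) n) \<longlonglongrightarrow> NN (sol s) n"
          by (intro NN_tendsto[OF majd_self sol_lim fin4_mlim]) (auto intro: norm_picard_le)
        then show ?thesis by (intro tendsto_mult tendsto_const)
      qed simp
    qed
  qed (use bound in auto)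
  then have "(\<lambda>k. picard (Suc k) t n) \<longlonglongrightarrow> of_real (exp (- lam n * t)) * A n +
     (sint {0<..t} (\<lambda>s. of_real (?e s) * NN (sol s) n))"
    unfolding picard.simps by (intro tendsto_add tendsto_const)
  moreover have "(\<lambda>k. picard (Suc k) t n) \<longlonglongrightarrow> sol t n"
    using sol_lim[OF t] by (rule LIMSEQ_Suc)
  ultimately show ?thesis by (rule LIMSEQ_unique[rotated])
qed

text \<open>Each iterate inherits the symmetry from the datum and the nonlinearity, and
  coefficientwise limits keep it. This makes the constructed solution real-valued.\<close>

lemma hermit_sol: "hermit (sol t)" if "0 \<le> t"
proof -
  have lam: "lam (- n) = lam n" for n by (simp add: lam_def)
  have "hermit (picard k t)" for k t
  proof (induction k arbitrary: t)
    case (Suc k)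
    have NN: "NN (picard k s) (- n) = cnj (NN (picard k s) n)" for s n
      using hermit_NN[OF Suc] by (simp add: hermit_def)
    show ?case unfolding hermit_def
    proof
      fix n
      let ?h = "\<lambda>n s. indicator {0<..t} s * (complex_of_real (exp (- lam n * (t - s))) * NN (picard k s) n)"
      have "?h (- n) s = cnj (?h n s)" for s
        by (simp add: NN lam indicator_def)
      then have "(\<integral>s. ?h (- n) s \<partial>lborel) = cnj (\<integral>s. ?h n s \<partial>lborel)"
        by (simp only: Bochner_Integration.integral_cnj)
      then show "picard (Suc k) t (- n) = cnj (picard (Suc k) t n)"
        using hermit_A by (simp add: hermit_def lam picard.simps)
    qed
  qed (simp add: hermit_def)
  then have "picard k t (- n) = cnj (picard k t n)" for k n by (simp add: hermit_def)
  then have "(\<lambda>k. cnj (picard k t n)) \<longlonglongrightarrow> sol t (- n)" for n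
    using sol_lim[OF that, of "- n"] by simp
  moreover have "(\<lambda>k. cnj (picard k t n)) \<longlonglongrightarrow> cnj (sol t n)" for n
    by (intro tendsto_cnj sol_lim that)
  ultimately show ?thesis unfolding hermit_def by (auto intro: LIMSEQ_unique)
qed

lemma sol_0: "sol 0 = A"
  using duhamel_sol[of 0] by auto

lemma sol_freq_0: "0 \<le> t \<Longrightarrow> sol t 0 = 0"
  by (simp add: duhamel_sol A_0 NN_0)

end

section \<open>Fourier coefficients and series\<close>

text \<open>This is \<open>2 * pi\<close> times the Fourier coefficient of index \<open>- n\<close>;
  with this sign Parseval's identity becomes bilinear, without conjugates.\<close>

definition fpair :: "(real \<Rightarrow> complex) \<Rightarrow> int \<Rightarrow> complex" where
  "fpair h n = (LINT x:{0..2*pi}|lborel. cis (of_int n * x) * h x)"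

lemma set_integrable_continuous:
  "continuous_on {a..b} h \<Longrightarrow> set_integrable lborel {a..b} h"
  for h :: "real \<Rightarrow> complex"
  by (rule borel_integrable_atLeastAtMost')

lemma measurable_cis_of_int [measurable]: "(\<lambda>x. cis (of_int n * x)) \<in> borel_measurable borel"
  by (intro borel_measurable_continuous_onI continuous_intros)

text \<open>Parseval's identity by Fubini: the coefficients are summable and \<open>h\<close> is
  integrable on a period, so the double integral converges absolutely.\<close>

lemma synth_pairing:
  assumes a: "zsummable a" and h: "continuous_on {0..2*pi} h"
  shows "(LINT x:{0..2*pi}|lborel. synth a x * h x) = zsum (\<lambda>n. a n * fpair h n)"
proof -
  define H where "H x = indicator {0..2*pi} x *\<^sub>R h x" for x
  have H: "integrable lborel H"
    using set_integrable_continuous[OF h] by (simp add: set_integrable_def H_def[abs_def])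
  then have [measurable]: "H \<in> borel_measurable borel" by simp
  have *: "integrable (lborel \<Otimes>\<^sub>M count_space UNIV) (\<lambda>(x, n). a n * (cis (of_int n * x) * H x))"
  proof (rule integrableI_bounded)
    show meas: "(\<lambda>(x, n). a n * (cis (of_int n * x) * H x)) \<in> borel_measurable (lborel \<Otimes>\<^sub>M count_space UNIV)"
      by (rule measurable_case_lz) measurable
    have "(\<integral>\<^sup>+z. ennreal (norm (case z of (x, n) \<Rightarrow> a n * (cis (of_int n * x) * H x))) \<partial>(lborel \<Otimes>\<^sub>M count_space UNIV))
      = (\<integral>\<^sup>+x. esum (\<lambda>n. ennreal (norm (a n)) * ennreal (norm (H x))) \<partial>lborel)"
    proof -
      have "(\<lambda>z. ennreal (norm (case z of (x, n) \<Rightarrow> a n * (cis (of_int n * x) * H x)))) \<in> borel_measurable (lborel \<Otimes>\<^sub>M count_space UNIV)"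
        using meas by measurable
      from zz.M1.nn_integral_fst[OF this] show ?thesis
        by (simp add: norm_mult ennreal_mult)
    qed
    also have "\<dots> = esum (\<lambda>n. norm (a n)) * (\<integral>\<^sup>+x. norm (H x) \<partial>lborel)"
      by (simp add: nn_integral_cmult nn_integral_multc)
    also have "\<dots> < \<infinity>"
      using a H by (simp add: zsummable_iff integrable_iff_bounded ennreal_mult_less_top)
    finally show "(\<integral>\<^sup>+z. ennreal (norm (case z of (x, n) \<Rightarrow> a n * (cis (of_int n * x) * H x))) \<partial>(lborel \<Otimes>\<^sub>M count_space UNIV)) < \<infinity>" .
  qed
  have "(LINT x:{0..2*pi}|lborel. synth a x * h x) = (\<integral>x. zsum (\<lambda>n. a n * (cis (of_int n * x) * H x)) \<partial>lborel)"
    unfolding set_lebesgue_integral_def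
  proof (intro Bochner_Integration.integral_cong refl)
    fix x
    have "indicator {0..2*pi} x *\<^sub>R (synth a x * h x) = synth a x * H x" by (simp add: H_def)
    also have "\<dots> = zsum (\<lambda>n. a n * cis (of_int n * x) * H x)"
      unfolding synth_def by (rule integral_mult_left_zero[symmetric])
    finally show "indicator {0..2*pi} x *\<^sub>R (synth a x * h x) = zsum (\<lambda>n. a n * (cis (of_int n * x) * H x))"
      by (simp only: mult.assoc)
  qed
  also have "\<dots> = zsum (\<lambda>n. \<integral>x. a n * (cis (of_int n * x) * H x) \<partial>lborel)"
    by (rule lz.Fubini_integral[OF *, symmetric])
  also have "\<dots> = zsum (\<lambda>n. a n * fpair h n)"
  proof -
    have "(\<integral>x. cis (of_int n * x) * H x \<partial>lborel) = fpair h n" for n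
      unfolding fpair_def set_lebesgue_integral_def H_def by simp
    then show ?thesis by simp
  qed
  finally show ?thesis .
qed

lemma norm_fpair_le:
  assumes "\<And>x. x \<in> {0..2*pi} \<Longrightarrow> norm (h x) \<le> C" "continuous_on {0..2*pi} h"
  shows "norm (fpair h n) \<le> 2 * pi * C"
proof -
  have "norm (fpair h n) \<le> (LINT x:{0..2*pi}|lborel. norm (cis (of_int n * x) * h x))"
    unfolding fpair_def by (intro set_integral_norm_bound set_integrable_continuous continuous_intros assms)
  also have "\<dots> \<le> (LINT x:{0..2*pi}|lborel. C)"
    using assms by (intro set_integral_mono)
      (auto simp: norm_mult intro!: borel_integrable_atLeastAtMost' continuous_intros)
  also have "\<dots> = 2 * pi * C"
    by (simp add: set_lebesgue_integral_def)
  finally show ?thesis .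
qed

lemma cis_deriv: "((\<lambda>x. cis (of_int n * x)) has_vector_derivative (\<i> * of_int n * cis (of_int n * x))) (at x within S)"
proof -
  have "((\<lambda>z. exp (\<i> * (of_int n * z))) has_field_derivative \<i> * of_int n * exp (\<i> * (of_int n * of_real x))) (at (of_real x))"
    by (auto intro!: derivative_eq_intros)
  from has_vector_derivative_real_field[OF this, of S] show ?thesis
    by (simp add: cis_conv_exp)
qed

text \<open>Integration by parts over a period; the boundary terms cancel because
  \<open>h (2*pi) = h 0\<close>.\<close>

lemma fpair_deriv:
  assumes "\<And>x. x \<in> {0..2*pi} \<Longrightarrow> (h has_vector_derivative h' x) (at x within {0..2*pi})"
    and h': "continuous_on {0..2*pi} h'" and per: "h (2*pi) = h 0"
  shows "fpair h' n = - (\<i> * of_int n) * fpair h n"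
proof -
  have h: "continuous_on {0..2*pi} h"
    using assms(1) has_vector_derivative_continuous unfolding continuous_on_eq_continuous_within by blast
  have "(LINT x:{0..2*pi}|lborel. \<i> * of_int n * cis (of_int n * x) * h x + cis (of_int n * x) * h' x)
     = cis (of_int n * (2*pi)) * h (2*pi) - cis (of_int n * 0) * h 0"
    unfolding set_lebesgue_integral_def
    by (rule integral_FTC_atLeastAtMost)
       (auto intro!: continuous_intros h h' derivative_eq_intros has_vector_derivative_eq_rhs[OF has_vector_derivative_mult[OF cis_deriv assms(1)]])
  also have "\<dots> = 0"
    using per cis_multiple_2pi[of "of_int n"] by (simp add: mult_ac)
  finally have "0 = (LINT x:{0..2*pi}|lborel. (\<i> * of_int n) * (cis (of_int n * x) * h x)) + fpair h' n"
    unfolding fpair_def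
    by (subst (asm) set_integral_add) (auto simp: mult.assoc intro!: set_integrable_continuous continuous_intros h h')
  also have "(LINT x:{0..2*pi}|lborel. (\<i> * of_int n) * (cis (of_int n * x) * h x)) = \<i> * of_int n * fpair h n"
    unfolding fpair_def by (rule set_integral_mult_right)
  finally show ?thesis by (simp add: eq_neg_iff_add_eq_0 add.commute)
qed

lemma integral_cis: "(LINT x:{0..2*pi}|lborel. cis (of_int m * x)) = (if m = 0 then 2 * pi else 0)"
proof (cases "m = 0")
  case True
  then show ?thesis by (simp add: set_lebesgue_integral_def scaleR_conv_of_real)
next
  case False
  \<comment> \<open>Integration by parts against the constant 1, whose derivative is 0, shows that
    \<open>\<i> * m\<close> times the integral vanishes.\<close>
  have "fpair (\<lambda>_. 0) m = - (\<i> * of_int m) * fpair (\<lambda>_. 1) m"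
    by (rule fpair_deriv) auto
  with False show ?thesis by (simp add: fpair_def set_lebesgue_integral_def)
qed

lemma fcoeff_synth:
  assumes "zsummable a" "hermit a"
  shows "fcoeff (\<lambda>x. Re (synth a x)) n = a n"
proof -
  have "(LINT x:{0..2*pi}|lborel. complex_of_real (Re (synth a x)) * cis (- (of_int n * x)))
     = (LINT x:{0..2*pi}|lborel. synth a x * cis (of_int (- n) * x))"
    by (simp add: hermit_synth[OF assms(2)])
  also have "\<dots> = zsum (\<lambda>k. a k * fpair (\<lambda>x. cis (of_int (- n) * x)) k)"
    by (rule synth_pairing[OF assms(1)]) (intro continuous_intros)
  also have "\<dots> = zsum (\<lambda>k. indicator {n} k * (a n * (2 * pi)))"
  proof (rule Bochner_Integration.integral_cong[OF refl])
    fix k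
    have "fpair (\<lambda>x. cis (of_int (- n) * x)) k = (LINT x:{0..2*pi}|lborel. cis (of_int (k - n) * x))"
      unfolding fpair_def by (simp add: cis_mult algebra_simps)
    then show "a k * fpair (\<lambda>x. cis (of_int (- n) * x)) k = indicator {n} k * (a n * (2 * pi))"
      unfolding integral_cis by (auto simp: indicator_def)
  qed
  also have "\<dots> = a n * (2 * pi)"
  proof -
    have *: "{k. indicator {n} k * (a n * (2 * pi)) \<noteq> (0 :: complex)} = (if a n = 0 then {} else {n})"
      by (auto simp: indicator_def)
    have "finite {k. indicator {n} k * (a n * (2 * pi)) \<noteq> (0 :: complex)}" unfolding * by simp
    from lebesgue_integral_count_space_finite_support[of UNIV, simplified, OF this]
    show ?thesis unfolding * by (simp split: if_splits)
  qed
  finally show ?thesis by (simp add: fcoeff_def)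
qed

section \<open>Uniqueness of Fourier coefficients\<close>

lemma continuous_on_polynomial_cis:
  fixes p :: "complex \<Rightarrow> real"
  assumes "real_polynomial_function p"
  shows "continuous_on S (\<lambda>x. p (cis x))"
proof (rule continuous_on_compose2[where g=p and t=UNIV])
  show "continuous_on UNIV p"
    using continuous_real_polymonial_function[OF assms] by (simp add: continuous_at_imp_continuous_on)
qed (auto intro!: continuous_intros)

lemma set_integrable_of_real_mult:
  fixes f :: "real \<Rightarrow> real" and g :: "real \<Rightarrow> complex"
  assumes f: "set_integrable lborel {0..2*pi} f" and g: "continuous_on {0..2*pi} g"
  shows "set_integrable lborel {0..2*pi} (\<lambda>x. of_real (f x) * g x)"
proof -
  obtain B where B: "\<And>x. x \<in> {0..2*pi} \<Longrightarrow> norm (g x) \<le> B"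
    using compact_imp_bounded[OF compact_continuous_image[OF g compact_Icc]]
    unfolding bounded_iff by blast
  have "set_borel_measurable lborel {0..2*pi} g"
    using set_integrable_continuous[OF g] by (simp add: set_integrable_def set_borel_measurable_def)
  then have [measurable]: "(\<lambda>x. indicator {0..2*pi} x *\<^sub>R g x) \<in> borel_measurable lborel"
    by (simp add: set_borel_measurable_def)
  have [measurable]: "(\<lambda>x. indicator {0..2*pi} x *\<^sub>R f x) \<in> borel_measurable lborel"
    using f by (auto simp: set_integrable_def)
  have "integrable lborel (\<lambda>x. B * (indicator {0..2*pi} x *\<^sub>R f x))"
    using f by (simp add: set_integrable_def)
  then have "integrable lborel (\<lambda>x. complex_of_real (indicator {0..2*pi} x *\<^sub>R f x) * (indicator {0..2*pi} x *\<^sub>R g x))"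
  proof (rule Bochner_Integration.integrable_bound)
    show "AE x in lborel. norm (complex_of_real (indicator {0..2*pi} x *\<^sub>R f x) * (indicator {0..2*pi} x *\<^sub>R g x))
      \<le> norm (B * (indicator {0..2*pi} x *\<^sub>R f x))"
    proof (intro AE_I2)
      fix x
      have "\<bar>f x\<bar> * norm (g x) \<le> \<bar>B\<bar> * \<bar>f x\<bar>" if "x \<in> {0..2*pi}"
        using mult_right_mono[OF order.trans[OF B[OF that] abs_ge_self], of "\<bar>f x\<bar>"] by (simp add: mult.commute)
      then show "norm (complex_of_real (indicator {0..2*pi} x *\<^sub>R f x) * (indicator {0..2*pi} x *\<^sub>R g x))
        \<le> norm (B * (indicator {0..2*pi} x *\<^sub>R f x))"
        by (auto simp: indicator_def norm_mult abs_mult)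
    qed
  qed measurable
  moreover have "(\<lambda>x. complex_of_real (indicator {0..2*pi} x *\<^sub>R f x) * (indicator {0..2*pi} x *\<^sub>R g x))
      = (\<lambda>x. indicator {0..2*pi} x *\<^sub>R (of_real (f x) * g x))"
    by (auto simp: indicator_def fun_eq_iff)
  ultimately show ?thesis unfolding set_integrable_def by simp
qed

context
  fixes f :: "real \<Rightarrow> real"
  assumes f: "set_integrable lborel {0..2*pi} f" and coeffs: "\<And>n. fcoeff f n = 0"
begin

text \<open>The functional vanishes on exponentials, hence on polynomials in \<open>cis x\<close>,
  hence by density on continuous functions of the circle, and by dominated convergence on indicators
  of half-lines. These determine \<open>f\<close> up to null sets.\<close>

private definition L :: "(real \<Rightarrow> complex) \<Rightarrow> complex" where
  "L g = (LINT x:{0..2*pi}|lborel. of_real (f x) * g x)"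

private lemma L_add: "continuous_on {0..2*pi} g \<Longrightarrow> continuous_on {0..2*pi} h \<Longrightarrow> L (\<lambda>x. g x + h x) = L g + L h"
  unfolding L_def by (simp add: distrib_left set_integral_add set_integrable_of_real_mult[OF f])

private lemma L_cmult: "L (\<lambda>x. c * g x) = c * L g"
  unfolding L_def set_integral_mult_right[symmetric] by (simp only: mult_ac)

private lemma L_cis: "L (\<lambda>x. cis (of_int n * x)) = 0"
  using coeffs[of "- n"] by (simp add: L_def fcoeff_def)

text \<open>The quantifier over \<open>h\<close> carries the induction: the property that all
  products \<open>h * cis (n * x)\<close> are annihilated is stable under multiplying
  \<open>h\<close> by \<open>p (cis x)\<close>, so the product case is an iteration. A linear
  \<open>p\<close> shifts \<open>n\<close> by one in either direction.\<close>

private lemma L_polynomial: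
  assumes "real_polynomial_function p"
  shows "\<forall>h. continuous_on {0..2*pi} h \<and> (\<forall>n. L (\<lambda>x. h x * cis (of_int n * x)) = 0) \<longrightarrow>
    (\<forall>n. L (\<lambda>x. h x * of_real (p (cis x)) * cis (of_int n * x)) = 0)"
  using assms
proof (induction p rule: real_polynomial_function.induct)
  case (linear p)
  interpret bounded_linear p by fact
  \<comment> \<open>These express \<open>p 1 * cos x + p \<i> * sin x\<close> through
    \<open>cis x\<close> and \<open>cis (- x)\<close>.\<close>
  define c d where "c = Complex (p 1 / 2) (- p \<i> / 2)" and "d = Complex (p 1 / 2) (p \<i> / 2)"
  have p: "of_real (p (cis x)) = c * cis x + d * cis (- x)" for x
  proof -
    have "cis x = cos x *\<^sub>R 1 + sin x *\<^sub>R \<i>" by (simp add: complex_eq_iff)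
    then have "p (cis x) = cos x * p 1 + sin x * p \<i>" by (simp add: add scaleR)
    then show ?thesis by (simp add: complex_eq_iff c_def d_def field_simps)
  qed
  show ?case
  proof (intro allI impI, elim conjE)
    fix h n assume h: "continuous_on {0..2*pi} h" "\<forall>n. L (\<lambda>x. h x * cis (of_int n * x)) = 0"
    have "(\<lambda>x. h x * of_real (p (cis x)) * cis (of_int n * x)) =
      (\<lambda>x. c * (h x * cis (of_int (n + 1) * x)) + d * (h x * cis (of_int (n - 1) * x)))"
    proof
      fix x
      have "cis (of_int (n + 1) * x) = cis x * cis (of_int n * x)" "cis (of_int (n - 1) * x) = cis (- x) * cis (of_int n * x)"
        by (simp_all add: cis_mult algebra_simps)
      then show "h x * of_real (p (cis x)) * cis (of_int n * x) =
        c * (h x * cis (of_int (n + 1) * x)) + d * (h x * cis (of_int (n - 1) * x))"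
        unfolding p by (simp only: algebra_simps)
    qed
    then have "L (\<lambda>x. h x * of_real (p (cis x)) * cis (of_int n * x)) =
      c * L (\<lambda>x. h x * cis (of_int (n + 1) * x)) + d * L (\<lambda>x. h x * cis (of_int (n - 1) * x))"
      by (simp only: L_cmult[symmetric]) (rule L_add; intro continuous_intros h)
    also have "\<dots> = 0" using h(2) by (simp del: of_int_add of_int_diff)
    finally show "L (\<lambda>x. h x * of_real (p (cis x)) * cis (of_int n * x)) = 0" .
  qed
next
  case (const c)
  show ?case
  proof (intro allI impI, elim conjE)
    fix h n assume "\<forall>n. L (\<lambda>x. h x * cis (of_int n * x)) = 0"
    then have "of_real c * L (\<lambda>x. h x * cis (of_int n * x)) = 0" by simp
    then show "L (\<lambda>x. h x * of_real c * cis (of_int n * x)) = 0"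
      unfolding L_cmult[symmetric] by (simp only: mult_ac)
  qed
next
  case (add p q)
  have "continuous_on {0..2*pi} (\<lambda>x. p (cis x))" "continuous_on {0..2*pi} (\<lambda>x. q (cis x))"
    by (intro continuous_on_polynomial_cis add.hyps)+
  note c = this
  show ?case
  proof (intro allI impI, elim conjE)
    fix h n assume h: "continuous_on {0..2*pi} h" "\<forall>n. L (\<lambda>x. h x * cis (of_int n * x)) = 0"
    have "L (\<lambda>x. h x * of_real (p (cis x)) * cis (of_int n * x) + h x * of_real (q (cis x)) * cis (of_int n * x)) =
      L (\<lambda>x. h x * of_real (p (cis x)) * cis (of_int n * x)) + L (\<lambda>x. h x * of_real (q (cis x)) * cis (of_int n * x))"
      by (rule L_add; intro continuous_intros h c)
    also have "\<dots> = 0" using add.IH h by auto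
    finally show "L (\<lambda>x. h x * of_real (p (cis x) + q (cis x)) * cis (of_int n * x)) = 0"
      by (simp add: distrib_left distrib_right)
  qed
next
  case (mult p q)
  have c: "continuous_on {0..2*pi} (\<lambda>x. p (cis x))"
    by (intro continuous_on_polynomial_cis mult.hyps)
  show ?case
  proof (intro allI impI, elim conjE)
    fix h n assume h: "continuous_on {0..2*pi} h" "\<forall>n. L (\<lambda>x. h x * cis (of_int n * x)) = 0"
    have "continuous_on {0..2*pi} (\<lambda>x. h x * of_real (p (cis x)))"
      by (intro continuous_intros h c)
    moreover have "\<forall>n. L (\<lambda>x. h x * of_real (p (cis x)) * cis (of_int n * x)) = 0"
      using mult.IH(1) h by blast
    ultimately have "L (\<lambda>x. h x * of_real (p (cis x)) * of_real (q (cis x)) * cis (of_int n * x)) = 0"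
      using mult.IH(2) by blast
    then show "L (\<lambda>x. h x * of_real (p (cis x) * q (cis x)) * cis (of_int n * x)) = 0"
      by (simp add: mult_ac)
  qed
qed

text \<open>Stone-Weierstrass on the unit circle. The tolerance is divided by \<open>F + 1\<close>,
  with \<open>F\<close> the integral of \<open>|f|\<close>; the added 1 avoids division by
  zero.\<close>

private lemma L_circle:
  assumes g: "continuous_on (sphere 0 1) g"
  shows "L (\<lambda>x. of_real (g (cis x))) = 0"
proof -
  define F where "F = (LINT x:{0..2*pi}|lborel. \<bar>f x\<bar>)"
  have fa: "set_integrable lborel {0..2*pi} (\<lambda>x. \<bar>f x\<bar>)" using f by (rule set_integrable_abs)
  have F: "0 \<le> F" unfolding F_def unfolding set_lebesgue_integral_def by (rule Bochner_Integration.integral_nonneg) simp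
  have gc: "continuous_on {0..2*pi} (\<lambda>x. g (cis x))"
    by (rule continuous_on_compose2[OF g]) (auto intro!: continuous_intros)
  have "norm (L (\<lambda>x. of_real (g (cis x)))) \<le> e" if "0 < e" for e
  proof -
    have "0 < e / (F + 1)" using F that by simp
    then obtain p where p: "real_polynomial_function p" "\<And>z. z \<in> sphere 0 1 \<Longrightarrow> \<bar>g z - p z\<bar> < e / (F + 1)"
      using Stone_Weierstrass_real_polynomial_function[OF compact_sphere g] by metis
    have pc: "continuous_on {0..2*pi} (\<lambda>x. p (cis x))"
      by (rule continuous_on_polynomial_cis[OF p(1)])
    have "L (\<lambda>x. 1 * of_real (p (cis x)) * cis (of_int 0 * x)) = 0"
      using L_polynomial[OF p(1), rule_format, of "\<lambda>_. 1" 0] L_cis by auto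
    then have "L (\<lambda>x. of_real (g (cis x))) = L (\<lambda>x. of_real (g (cis x)) + (- 1) * of_real (p (cis x)))"
      by (subst L_add) (auto intro!: continuous_intros gc pc simp: L_cmult[of "- 1", simplified])
    also have "\<dots> = (LINT x:{0..2*pi}|lborel. of_real (f x) * of_real (g (cis x) - p (cis x)))"
      by (simp add: L_def)
    also have "norm \<dots> \<le> (LINT x:{0..2*pi}|lborel. norm (complex_of_real (f x) * of_real (g (cis x) - p (cis x))))"
      by (intro set_integral_norm_bound set_integrable_of_real_mult[OF f] continuous_intros gc pc)
    also have "\<dots> \<le> (LINT x:{0..2*pi}|lborel. e / (F + 1) * \<bar>f x\<bar>)"
    proof (rule set_integral_mono)
      show "set_integrable lborel {0..2*pi} (\<lambda>x. norm (complex_of_real (f x) * of_real (g (cis x) - p (cis x))))"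
        by (intro set_integrable_norm set_integrable_of_real_mult[OF f] continuous_intros gc pc)
      show "set_integrable lborel {0..2*pi} (\<lambda>x. e / (F + 1) * \<bar>f x\<bar>)" using fa by simp
      fix x assume "x \<in> {0..2*pi}"
      have "\<bar>g (cis x) - p (cis x)\<bar> \<le> e / (F + 1)" using p(2)[of "cis x"] by simp
      from mult_right_mono[OF this abs_ge_zero[of "f x"]]
      show "norm (complex_of_real (f x) * of_real (g (cis x) - p (cis x))) \<le> e / (F + 1) * \<bar>f x\<bar>"
        unfolding norm_mult norm_of_real by (simp only: mult.commute)
    qed
    also have "\<dots> = e / (F + 1) * F" unfolding F_def by simp
    also have "\<dots> \<le> e" using that F by (simp add: field_simps)
    finally show ?thesis .
  qed
  then show ?thesis by (metis field_le_epsilon add_0 norm_le_zero_iff)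
qed

text \<open>For \<open>c\<close> outside the period the integrand is either \<open>f\<close> itself,
  whose mean is zero, or 0. Otherwise the indicator is a pointwise limit of continuous functions on
  the circle, up to one point.\<close>

private lemma integral_tail:
  shows "(LINT x:{0..2*pi}|lborel. f x * indicator {c<..} x) = 0"
proof -
  consider "c < 0" | "0 \<le> c" "c < 2 * pi" | "2 * pi \<le> c" by linarith
  then show ?thesis
  proof cases
    case 1
    have "complex_of_real (LINT x:{0..2*pi}|lborel. f x * indicator {c<..} x) = L (\<lambda>x. cis (of_int 0 * x))"
      unfolding L_def set_integral_complex_of_real[symmetric]
      by (rule set_lebesgue_integral_cong) (use 1 in \<open>auto simp: indicator_def\<close>)
    then show ?thesis using L_cis[of 0] by simp
  next
    case 3
    have "(LINT x:{0..2*pi}|lborel. f x * indicator {c<..} x) = (LINT x:{0..2*pi}|lborel. 0)"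
      by (rule set_lebesgue_integral_cong) (use 3 in \<open>auto simp: indicator_def\<close>)
    then show ?thesis by simp
  next
    case 2
    define K where "K = cis ` {0..c}"
    have K: "compact K" "K \<noteq> {}"
      using 2 by (auto simp: K_def intro!: compact_continuous_image continuous_intros)
    have K_iff: "cis x \<in> K \<longleftrightarrow> x \<le> c" if "x \<in> {0..<2*pi}" for x
    proof
      assume "cis x \<in> K"
      then obtain y where "y \<in> {0..c}" "cis x = cis y" by (auto simp: K_def)
      then have "sin x = sin y \<and> cos x = cos y" by (metis cis.sel)
      then obtain m :: int where m: "x = y + 2 * pi * m" unfolding sin_cos_eq_iff by auto
      have "\<bar>x - y\<bar> < 2 * pi" using that 2 \<open>y \<in> {0..c}\<close> by auto
      then have "2 * pi * \<bar>real_of_int m\<bar> < 2 * pi * 1" unfolding m by (simp add: abs_mult)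
      then have "\<bar>real_of_int m\<bar> < 1" by simp
      then have "m = 0" by linarith
      then have "x = y" using m by simp
      then show "x \<le> c" using \<open>y \<in> {0..c}\<close> by simp
    qed (use that in \<open>auto simp: K_def\<close>)
    \<comment> \<open>Continuous on the circle, zero on the arc \<open>K\<close>, and increasing to
      1 off it because \<open>K\<close> is closed.\<close>
    let ?g = "\<lambda>(k::nat) z. min 1 (of_nat k * infdist z K)"
    have meas: "(\<lambda>x. indicator {0..2*pi} x *\<^sub>R f x) \<in> borel_measurable borel"
      using f by (auto simp: set_integrable_def)
    have "(\<lambda>k. \<integral>x. indicator {0..2*pi} x *\<^sub>R f x * ?g k (cis x) \<partial>lborel)
      \<longlonglongrightarrow> (\<integral>x. indicator {0..2*pi} x *\<^sub>R f x * indicator {c<..} x \<partial>lborel)"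
    proof (rule integral_dominated_convergence[where w="\<lambda>x. \<bar>indicator {0..2*pi} x *\<^sub>R f x\<bar>"])
      have [measurable]: "(\<lambda>x. infdist (cis x) K) \<in> borel_measurable borel"
        by (intro borel_measurable_continuous_onI continuous_intros)
      note [measurable] = meas
      show "(\<lambda>x. indicator {0..2*pi} x *\<^sub>R f x * indicator {c<..} x) \<in> borel_measurable lborel"
        "(\<lambda>x. indicator {0..2*pi} x *\<^sub>R f x * ?g k (cis x)) \<in> borel_measurable lborel" for k
        by measurable
      show "integrable lborel (\<lambda>x. \<bar>indicator {0..2*pi} x *\<^sub>R f x\<bar>)"
        using f by (simp add: set_integrable_def)
      \<comment> \<open>At this endpoint \<open>cis x = 1\<close> lies in \<open>K\<close> although
        \<open>x > c\<close>, so convergence fails there in general; the point is null.\<close>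
      have "AE x in lborel. x \<noteq> 2 * pi" by (rule AE_lborel_singleton)
      then show "AE x in lborel. (\<lambda>k. indicator {0..2*pi} x *\<^sub>R f x * ?g k (cis x))
        \<longlonglongrightarrow> indicator {0..2*pi} x *\<^sub>R f x * indicator {c<..} x"
      proof eventually_elim
        case (elim x)
        show ?case
        proof (cases "x \<in> {0..2*pi}")
          case True
          then have x: "x \<in> {0..<2*pi}" using elim by auto
          have "(\<lambda>k. ?g k (cis x)) \<longlonglongrightarrow> indicator {c<..} x"
          proof (cases "x \<le> c")
            case True
            then have "infdist (cis x) K = 0" using K_iff[OF x] by simp
            then show ?thesis using True by simp
          next
            case False
            then have pos: "0 < infdist (cis x) K"
              using K_iff[OF x] K infdist_pos_not_in_closed[of K] compact_imp_closed by auto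
            obtain m :: nat where m: "1 < of_nat m * infdist (cis x) K"
              using reals_Archimedean3[OF pos] by metis
            have "eventually (\<lambda>k. ?g k (cis x) = 1) sequentially"
              using eventually_ge_at_top[of m]
            proof eventually_elim
              case (elim k)
              then have "of_nat m * infdist (cis x) K \<le> of_nat k * infdist (cis x) K"
                using pos by (intro mult_right_mono) auto
              then show ?case using m by simp
            qed
            then show ?thesis using False by (simp add: tendsto_eventually)
          qed
          then show ?thesis by (intro tendsto_mult tendsto_const)
        qed simp
      qed
      show "AE x in lborel. norm (indicator {0..2*pi} x *\<^sub>R f x * ?g k (cis x)) \<le> \<bar>indicator {0..2*pi} x *\<^sub>R f x\<bar>" for k
        by (intro AE_I2) (auto simp: abs_mult infdist_nonneg intro!: mult_left_le)
    qed
    moreover have "(\<integral>x. indicator {0..2*pi} x *\<^sub>R f x * ?g k (cis x) \<partial>lborel) = 0" for k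
    proof -
      have "complex_of_real (LINT x:{0..2*pi}|lborel. f x * ?g k (cis x)) = L (\<lambda>x. of_real (?g k (cis x)))"
        unfolding L_def set_integral_complex_of_real[symmetric] by simp
      also have "\<dots> = 0" by (rule L_circle) (intro continuous_intros)
      finally show ?thesis by (simp add: set_lebesgue_integral_def mult.assoc)
    qed
    ultimately show ?thesis by (simp add: set_lebesgue_integral_def LIMSEQ_const_iff mult.assoc)
  qed
qed

lemma fourier_uniqueness: "AE x in lborel. x \<in> {0..2*pi} \<longrightarrow> f x = 0"
proof -
  define F where "F x = indicator {0..2*pi} x *\<^sub>R f x" for x
  have F: "integrable lborel F" using f by (simp add: set_integrable_def F_def[abs_def])
  then have [measurable]: "F \<in> borel_measurable borel" by simp
  \<comment> \<open>Since \<open>ennreal\<close> cuts negative values to 0, the two densities are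
    the positive and negative parts of \<open>f\<close>. The measures are finite and agree on all
    half-lines, hence coincide, and equal positive and negative parts are zero.\<close>
  let ?M = "density lborel (\<lambda>x. ennreal (F x))" and ?N = "density lborel (\<lambda>x. ennreal (- F x))"
  have fin: "(\<integral>\<^sup>+x. ennreal (F x) \<partial>lborel) < \<infinity>" "(\<integral>\<^sup>+x. ennreal (- F x) \<partial>lborel) < \<infinity>"
    using F by (simp_all add: real_integrable_def less_top)
  have e: "emeasure ?M {c<..} = (\<integral>\<^sup>+x. ennreal (F x * indicator {c<..} x) \<partial>lborel)"
    "emeasure ?N {c<..} = (\<integral>\<^sup>+x. ennreal (- (F x * indicator {c<..} x)) \<partial>lborel)" for c
    by (auto simp: emeasure_density indicator_def intro!: nn_integral_cong)
  have fin': "emeasure ?M {c<..} < \<infinity>" "emeasure ?N {c<..} < \<infinity>" for c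
    unfolding e
    by (rule le_less_trans[OF nn_integral_mono fin(1)], simp add: indicator_def)
       (rule le_less_trans[OF nn_integral_mono fin(2)], simp add: indicator_def)
  have "emeasure ?M {c<..} = emeasure ?N {c<..}" for c
  proof -
    have i: "integrable lborel (\<lambda>x. F x * indicator {c<..} x)"
      using integrable_mult_indicator[OF _ F, of "{c<..}"] by (simp add: mult_ac)
    have "0 = (\<integral>x. F x * indicator {c<..} x \<partial>lborel)"
      using integral_tail[of c] by (simp add: set_lebesgue_integral_def F_def mult_ac)
    also have "\<dots> = enn2real (emeasure ?M {c<..}) - enn2real (emeasure ?N {c<..})"
      unfolding e by (rule real_lebesgue_integral_def[OF i])
    finally have "ennreal (enn2real (emeasure ?M {c<..})) = ennreal (enn2real (emeasure ?N {c<..}))" by simp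
    then show ?thesis
      by (simp only: fin'[unfolded infinity_ennreal_def, THEN ennreal_enn2real])
  qed
  then have "?M = ?N"
    by (intro measure_eqI_lessThan fin') simp_all
  then have "AE x in lborel. ennreal (F x) = ennreal (- F x)"
    by (intro sigma_finite_measure.density_unique[OF lborel.sigma_finite_measure_axioms]) auto
  then show ?thesis
  proof eventually_elim
    case (elim x)
    show ?case
    proof
      assume "x \<in> {0..2*pi}"
      with elim have "ennreal (f x) = ennreal (- f x)" by (simp add: F_def)
      then show "f x = 0"
        by (metis ennreal_eq_0_iff ennreal_neg le_cases neg_0_le_iff_le neg_le_0_iff_le order_antisym)
    qed
  qed
qed

end

section \<open>Test functions\<close>

lemma smooth2_continuous: "smooth2 \<phi> \<Longrightarrow> continuous_on S (\<lambda>p. pd ds \<phi> (fst p) (snd p))"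
  unfolding smooth2_def using continuous_on_subset by blast

lemma smooth2_continuous_x:
  assumes "smooth2 \<phi>"
  shows "continuous_on S (\<lambda>x. pd ds \<phi> t x)"
proof -
  have "continuous_on S (Pair t)" by (intro continuous_intros)
  from continuous_on_compose2[OF smooth2_continuous[OF assms] this subset_UNIV]
  show ?thesis by simp
qed

lemma smooth2_deriv_x: "smooth2 \<phi> \<Longrightarrow> (pd ds \<phi> t has_real_derivative pd (False # ds) \<phi> t x) (at x)"
  unfolding smooth2_def by (auto simp: DERIV_deriv_iff_real_differentiable)

lemma smooth2_deriv_t: "smooth2 \<phi> \<Longrightarrow> ((\<lambda>s. pd ds \<phi> s x) has_real_derivative pd (True # ds) \<phi> t x) (at t)"
  unfolding smooth2_def by (auto simp: DERIV_deriv_iff_real_differentiable)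

lemma smooth2_bound:
  assumes "smooth2 \<phi>"
  obtains C where "0 \<le> C" "\<And>s x. s \<in> {0..T} \<Longrightarrow> x \<in> {0..2*pi} \<Longrightarrow> \<bar>pd ds \<phi> s x\<bar> \<le> C"
proof -
  have "compact ((\<lambda>p. pd ds \<phi> (fst p) (snd p)) ` ({0..T} \<times> {0..2*pi}))"
    by (intro compact_continuous_image smooth2_continuous assms compact_Times compact_Icc)
  then obtain C where "\<forall>y\<in>(\<lambda>p. pd ds \<phi> (fst p) (snd p)) ` ({0..T} \<times> {0..2*pi}). norm y \<le> C"
    using compact_imp_bounded bounded_iff by metis
  then have C: "\<bar>pd ds \<phi> s x\<bar> \<le> C" if "s \<in> {0..T}" "x \<in> {0..2*pi}" for s x
    using that by force
  show thesis
  proof (rule that)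
    show "0 \<le> \<bar>C\<bar>" by simp
    show "\<bar>pd ds \<phi> s x\<bar> \<le> \<bar>C\<bar>" if "s \<in> {0..T}" "x \<in> {0..2*pi}" for s x
      using C[OF that] by linarith
  qed
qed

lemma pd_periodic:
  assumes "\<And>t x. \<phi> t (x + 2*pi) = \<phi> t x"
  shows "pd [False] \<phi> t (x + 2*pi) = pd [False] \<phi> t x"
proof -
  have "((\<phi> t) has_field_derivative D) (at (x + 2*pi)) \<longleftrightarrow> ((\<phi> t) has_field_derivative D) (at x)" for D
    using DERIV_shift[of "\<phi> t" D x "2*pi"] assms by (simp add: fun_eq_iff)
  then show ?thesis by (simp add: deriv_def)
qed

definition fmode :: "(real \<Rightarrow> real) \<Rightarrow> int \<Rightarrow> complex" where
  "fmode h n = fpair (\<lambda>x. complex_of_real (h x)) n"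

lemma fmode_deriv:
  assumes "\<And>x. (h has_real_derivative h' x) (at x)" "continuous_on {0..2*pi} h'" "h (2*pi) = h 0"
  shows "fmode h' n = - (\<i> * of_int n) * fmode h n"
  unfolding fmode_def
proof (rule fpair_deriv)
  fix x
  show "((\<lambda>x. complex_of_real (h x)) has_vector_derivative complex_of_real (h' x)) (at x within {0..2*pi})"
    using assms(1)[of x] by (intro has_vector_derivative_of_real) (auto simp: has_field_derivative_at_within simp flip: has_real_derivative_iff_has_vector_derivative)
qed (use assms in \<open>auto intro!: continuous_intros\<close>)

lemma fmode_pd_x:
  assumes \<phi>: "smooth2 \<phi>" and per: "\<And>t x. \<phi> t (x + 2*pi) = \<phi> t x"
  shows "fmode (pd [False] \<phi> t) n = - (\<i> * of_int n) * fmode (\<phi> t) n"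
    and "fmode (pd [False, False] \<phi> t) n = - (of_int n)\<^sup>2 * fmode (\<phi> t) n"
proof -
  show 1: "fmode (pd [False] \<phi> t) n = - (\<i> * of_int n) * fmode (\<phi> t) n"
  proof (rule fmode_deriv)
    show "(\<phi> t has_real_derivative pd [False] \<phi> t x) (at x)" for x
      using smooth2_deriv_x[OF \<phi>, of "[]"] by simp
    show "\<phi> t (2*pi) = \<phi> t 0" using per[of t 0] by simp
  qed (rule smooth2_continuous_x[OF \<phi>])
  have "fmode (pd [False, False] \<phi> t) n = - (\<i> * of_int n) * fmode (pd [False] \<phi> t) n"
  proof (rule fmode_deriv)
    show "(pd [False] \<phi> t has_real_derivative pd [False, False] \<phi> t x) (at x)" for x
      by (rule smooth2_deriv_x[OF \<phi>])
    show "pd [False] \<phi> t (2*pi) = pd [False] \<phi> t 0"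
      using pd_periodic[of \<phi> t 0, OF per] by (simp only: add_0)
  qed (rule smooth2_continuous_x[OF \<phi>])
  then show "fmode (pd [False, False] \<phi> t) n = - (of_int n)\<^sup>2 * fmode (\<phi> t) n"
    unfolding 1 by (simp add: power2_eq_square algebra_simps)
qed

text \<open>Moves to the Henstock-Kurzweil integral, for which continuity in a parameter and
  Leibniz' rule are used below.\<close>

lemma fmode_integral:
  "continuous_on {0..2*pi} h \<Longrightarrow> fmode h n = integral (cbox 0 (2*pi)) (\<lambda>x. cis (of_int n * x) * of_real (h x))"
  unfolding fmode_def fpair_def
  by (subst set_borel_integral_eq_integral) (auto intro!: set_integrable_continuous continuous_intros)

lemma continuous_pd_cis:
  assumes "smooth2 \<phi>"
  shows "continuous_on (UNIV \<times> cbox 0 (2*pi)) (\<lambda>(t, x). cis (of_int n * x) * complex_of_real (pd ds \<phi> t x))"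
  unfolding case_prod_unfold
  by (intro continuous_on_mult continuous_on_of_real smooth2_continuous[OF assms]
      continuous_on_cis continuous_on_const continuous_on_snd continuous_on_id)

lemma continuous_fmode:
  assumes "smooth2 \<phi>"
  shows "continuous_on S (\<lambda>t. fmode (pd ds \<phi> t) n)"
proof -
  have "continuous_on UNIV (\<lambda>t. integral (cbox 0 (2*pi)) (\<lambda>x. cis (of_int n * x) * complex_of_real (pd ds \<phi> t x)))"
    by (rule integral_continuous_on_param[OF continuous_pd_cis[OF assms]])
  then have "continuous_on UNIV (\<lambda>t. fmode (pd ds \<phi> t) n)"
    by (simp add: fmode_integral smooth2_continuous_x[OF assms])
  then show ?thesis by (rule continuous_on_subset) simp
qed

lemma fmode_deriv_t:
  assumes "smooth2 \<phi>"
  shows "((\<lambda>t. fmode (\<phi> t) n) has_vector_derivative fmode (pd [True] \<phi> t) n) (at t)"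
proof -
  have "((\<lambda>t. integral (cbox 0 (2*pi)) (\<lambda>x. cis (of_int n * x) * complex_of_real (pd [] \<phi> t x)))
     has_vector_derivative integral (cbox 0 (2*pi)) (\<lambda>x. cis (of_int n * x) * complex_of_real (pd [True] \<phi> t x))) (at t within UNIV)"
  proof (rule leibniz_rule_vector_derivative)
    fix s x
    show "((\<lambda>s. cis (of_int n * x) * complex_of_real (pd [] \<phi> s x)) has_vector_derivative
      cis (of_int n * x) * complex_of_real (pd [True] \<phi> s x)) (at s within UNIV)"
      by (intro has_vector_derivative_mult_right has_vector_derivative_of_real smooth2_deriv_t assms)
    show "(\<lambda>x. cis (of_int n * x) * complex_of_real (pd [] \<phi> s x)) integrable_on cbox 0 (2*pi)"
      by (intro integrable_continuous continuous_intros smooth2_continuous_x[OF assms])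
  qed (use continuous_pd_cis[OF assms, of n "[True]"] in auto)
  then show ?thesis
    using smooth2_continuous_x[OF assms, of _ "[]"] smooth2_continuous_x[OF assms, of _ "[True]"]
    by (simp add: fmode_integral)
qed

lemma norm_fmode_le:
  assumes "\<And>x. x \<in> {0..2*pi} \<Longrightarrow> \<bar>h x\<bar> \<le> C" "continuous_on {0..2*pi} h"
  shows "norm (fmode h n) \<le> 2 * pi * C"
  unfolding fmode_def by (rule norm_fpair_le) (use assms in \<open>auto intro!: continuous_intros\<close>)

section \<open>Product rule for integral functions\<close>

lemma integral_Ioc_Icc:
  fixes f :: "real \<Rightarrow> complex"
  assumes [measurable]: "f \<in> borel_measurable borel"
  shows "sint {0<..t} f = (LINT s:{0..t}|lborel. f s)"
  unfolding set_lebesgue_integral_def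
proof (rule integral_cong_AE)
  show "AE s in lborel. indicator {0<..t} s * f s = indicator {0..t} s *\<^sub>R f s"
    using AE_lborel_singleton[of 0] by eventually_elim (auto simp: indicator_def)
qed simp_all

text \<open>The function \<open>b\<close> is merely an integral of an integrable \<open>G\<close>,
  so \<open>b * \<psi>\<close> is not differentiated. Both sides are compared by Fubini over the
  triangle \<open>r \<le> s \<le> t\<close>.\<close>

lemma integral_product_rule:
  fixes G b \<psi> \<psi>' :: "real \<Rightarrow> complex"
  assumes t: "0 \<le> t" and [measurable]: "G \<in> borel_measurable borel"
    and G: "integrable lborel (\<lambda>s. indicator {0<..t} s * G s)"
    and b: "\<And>s. 0 \<le> s \<Longrightarrow> s \<le> t \<Longrightarrow> b s = B + sint {0<..s} G"
    and \<psi>: "\<And>s. (\<psi> has_vector_derivative \<psi>' s) (at s)" and \<psi>': "continuous_on UNIV \<psi>'"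
  shows "b t * \<psi> t - B * \<psi> 0 = sint {0<..t} (\<lambda>s. G s * \<psi> s + b s * \<psi>' s)"
proof -
  have FTC: "(\<integral>s. indicator {r..t} s *\<^sub>R \<psi>' s \<partial>lborel) = \<psi> t - \<psi> r" if "r \<le> t" for r
    by (rule integral_FTC_atLeastAtMost[OF that])
       (auto intro: has_vector_derivative_at_within[OF \<psi>] continuous_on_subset[OF \<psi>'])
  have [measurable]: "\<psi>' \<in> borel_measurable borel"
    by (rule borel_measurable_continuous_onI[OF \<psi>'])
  have "continuous_on UNIV \<psi>"
    by (intro continuous_at_imp_continuous_on ballI has_vector_derivative_continuous[OF \<psi>])
  then have [measurable]: "\<psi> \<in> borel_measurable borel" by (rule borel_measurable_continuous_onI)
  have bdd: "\<exists>C. \<forall>s\<in>{0..t}. norm (g s) \<le> C" if "continuous_on UNIV g" for g :: "real \<Rightarrow> complex"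
    using compact_imp_bounded[OF compact_continuous_image[OF continuous_on_subset[OF that subset_UNIV] compact_Icc]]
    unfolding bounded_iff by blast
  obtain C where C: "\<And>s. s \<in> {0..t} \<Longrightarrow> norm (\<psi>' s) \<le> C" using bdd[OF \<psi>'] by blast
  obtain C' where C': "\<And>s. s \<in> {0..t} \<Longrightarrow> norm (\<psi> s) \<le> C'"
    using bdd[OF \<open>continuous_on UNIV \<psi>\<close>] by blast
  let ?I = "\<lambda>s. indicator {0<..t} s :: complex"
  let ?g = "\<lambda>r. ?I r * G r"
  \<comment> \<open>Integrating out \<open>r\<close> gives the part of
    \<open>b s * \<psi>' s\<close> due to \<open>G\<close>; integrating out \<open>s\<close> gives
    \<open>G r * (\<psi> t - \<psi> r)\<close>.\<close>
  let ?K = "\<lambda>(r, s). ?g r * (if r \<le> s \<and> s \<le> t then \<psi>' s else 0)"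
  have K: "integrable (lborel \<Otimes>\<^sub>M lborel) ?K"
  proof (rule Bochner_Integration.integrable_bound)
    have "integrable (lborel \<Otimes>\<^sub>M lborel) (\<lambda>x. ?g (fst x) * (indicator {0..t} (snd x) * complex_of_real C))"
    proof (rule lborel_pair.Fubini_integrable)
      show "integrable lborel (\<lambda>r. \<integral>s. norm (?g (fst (r, s)) * (indicator {0..t} (snd (r, s)) * complex_of_real C)) \<partial>lborel)"
      proof -
        have "(\<lambda>r. \<integral>s. norm (?g (fst (r, s)) * (indicator {0..t} (snd (r, s)) * complex_of_real C)) \<partial>lborel)
          = (\<lambda>r. norm (?g r) * (\<integral>s. norm (indicator {0..t} s * complex_of_real C) \<partial>lborel))"
          by (simp add: norm_mult)
        then show ?thesis using G by simp
      qed
      have "integrable lborel (\<lambda>s. indicator {0..t} s * complex_of_real C)"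
      proof -
        have "integrable lborel (\<lambda>s. indicator {0..t} s *\<^sub>R complex_of_real C)"
          by (rule borel_integrable_compact) auto
        moreover have "(\<lambda>s. indicator {0..t} s *\<^sub>R complex_of_real C) = (\<lambda>s. indicator {0..t} s * complex_of_real C)"
          by (auto simp: indicator_def fun_eq_iff)
        ultimately show ?thesis by simp
      qed
      then show "AE r in lborel. integrable lborel (\<lambda>s. ?g (fst (r, s)) * (indicator {0..t} (snd (r, s)) * complex_of_real C))"
        by simp
    qed measurable
    then show "integrable (lborel \<Otimes>\<^sub>M lborel) (\<lambda>(r, s). ?g r * (indicator {0..t} s * complex_of_real C))"
      by (simp add: case_prod_unfold)
    show "AE x in lborel \<Otimes>\<^sub>M lborel. norm (?K x) \<le> norm (case x of (r, s) \<Rightarrow> ?g r * (indicator {0..t} s * complex_of_real C))"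
    proof (intro AE_I2, clarify)
      fix r s
      have "norm (?g r) * norm (if r \<le> s \<and> s \<le> t then \<psi>' s else 0) \<le> norm (?g r) * \<bar>indicator {0..t} s * C\<bar>"
      proof (cases "0 < r")
        case True
        then show ?thesis using order.trans[OF C abs_ge_self, of s]
          by (intro mult_left_mono) (auto simp: indicator_def)
      qed simp
      then show "norm (?g r * (if r \<le> s \<and> s \<le> t then \<psi>' s else 0)) \<le> norm (?g r * (indicator {0..t} s * complex_of_real C))"
        by (auto simp: norm_mult indicator_def)
    qed
  qed measurable
  have bm: "integrable lborel (\<lambda>s. \<integral>r. ?K (r, s) \<partial>lborel)"
    using lborel_pair.integrable_snd[OF K] by simp
  have inner: "?I s * ((sint {0<..s} G) * \<psi>' s) = (\<integral>r. ?K (r, s) \<partial>lborel)" for s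
  proof (cases "s \<in> {0<..t}")
    case True
    have "(\<integral>r. ?K (r, s) \<partial>lborel) = (\<integral>r. (indicator {0<..s} r * G r) * \<psi>' s \<partial>lborel)"
      using True by (intro Bochner_Integration.integral_cong) (auto simp: indicator_def)
    then show ?thesis using True by simp
  next
    case False
    then have "(\<lambda>r. ?K (r, s)) = (\<lambda>r. 0)" by (auto simp: indicator_def fun_eq_iff)
    then show ?thesis using False by simp
  qed
  have B\<psi>': "integrable lborel (\<lambda>s. ?I s * (B * \<psi>' s))"
  proof -
    have "integrable lborel (\<lambda>s. indicator {0<..t} s *\<^sub>R (B * \<psi>' s))"
      by (rule integrableI_bounded_set_indicator[where B="norm B * C"])
         (use t in \<open>auto simp: norm_mult intro!: mult_left_mono C\<close>)
    moreover have "(\<lambda>s. indicator {0<..t} s *\<^sub>R (B * \<psi>' s)) = (\<lambda>s. ?I s * (B * \<psi>' s))"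
      by (auto simp: indicator_def fun_eq_iff)
    ultimately show ?thesis by simp
  qed
  have G\<psi>: "integrable lborel (\<lambda>s. ?I s * (G s * \<psi> s))"
  proof (rule Bochner_Integration.integrable_bound)
    show "integrable lborel (\<lambda>s. of_real C' * ?g s)" using G by simp
    show "AE s in lborel. norm (?I s * (G s * \<psi> s)) \<le> norm (of_real C' * ?g s)"
    proof (intro AE_I2)
      fix s
      show "norm (?I s * (G s * \<psi> s)) \<le> norm (of_real C' * ?g s)"
        using mult_left_mono[OF order.trans[OF C'[of s] abs_ge_self], of "norm (G s)"]
        by (auto simp: norm_mult indicator_def mult.commute)
    qed
  qed measurable
  have "(\<integral>s. ?I s * (G s * \<psi> s + b s * \<psi>' s) \<partial>lborel)
     = (\<integral>s. ?I s * (G s * \<psi> s) + (?I s * (B * \<psi>' s) + (\<integral>r. ?K (r, s) \<partial>lborel)) \<partial>lborel)"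
    unfolding inner[symmetric]
    by (intro Bochner_Integration.integral_cong refl) (auto simp: b indicator_def algebra_simps)
  also have "\<dots> = (\<integral>s. ?I s * (G s * \<psi> s) \<partial>lborel) + ((\<integral>s. ?I s * (B * \<psi>' s) \<partial>lborel) + (\<integral>s. \<integral>r. ?K (r, s) \<partial>lborel \<partial>lborel))"
    by (simp only: Bochner_Integration.integral_add[OF G\<psi> Bochner_Integration.integrable_add[OF B\<psi>' bm]]
        Bochner_Integration.integral_add[OF B\<psi>' bm])
  also have "(\<integral>s. ?I s * (B * \<psi>' s) \<partial>lborel) = B * (\<psi> t - \<psi> 0)"
    unfolding FTC[OF t, symmetric] by (subst integral_Ioc_Icc) (auto simp: set_lebesgue_integral_def)
  also have "(\<integral>s. \<integral>r. ?K (r, s) \<partial>lborel \<partial>lborel) = (\<integral>r. \<integral>s. ?K (r, s) \<partial>lborel \<partial>lborel)"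
    by (rule lborel_pair.Fubini_integral) (use K in \<open>simp add: case_prod_unfold cong: if_cong\<close>)
  also have "\<dots> = (\<integral>r. ?I r * G r * (\<psi> t - \<psi> r) \<partial>lborel)"
  proof (intro Bochner_Integration.integral_cong refl)
    fix r
    have "(\<integral>s. ?K (r, s) \<partial>lborel) = (\<integral>s. ?g r * (indicator {r..t} s *\<^sub>R \<psi>' s) \<partial>lborel)"
      by (intro Bochner_Integration.integral_cong refl) (simp add: indicator_def)
    also have "\<dots> = ?g r * (\<integral>s. indicator {r..t} s *\<^sub>R \<psi>' s \<partial>lborel)" by (rule integral_mult_right_zero)
    also have "\<dots> = ?I r * G r * (\<psi> t - \<psi> r)"
      by (cases "r \<le> t") (simp_all add: FTC)
    finally show "(\<integral>s. ?K (r, s) \<partial>lborel) = ?I r * G r * (\<psi> t - \<psi> r)" .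
  qed
  also have "\<dots> = (\<integral>r. ?g r * \<psi> t - ?I r * (G r * \<psi> r) \<partial>lborel)"
    by (simp add: algebra_simps)
  also have "\<dots> = (\<integral>r. ?g r \<partial>lborel) * \<psi> t - (\<integral>r. ?I r * (G r * \<psi> r) \<partial>lborel)"
    using G G\<psi> by (subst Bochner_Integration.integral_diff) auto
  also have "(\<integral>r. ?g r \<partial>lborel) = b t - B" using b[OF t] by simp
  finally show ?thesis by (simp add: algebra_simps)
qed

lemma zsummable_product:
  fixes a b :: "int \<Rightarrow> complex"
  assumes "zsummable a" "zsummable b"
  shows "zsummable (\<lambda>k. a k * b (n - k))"
proof -
  have "esum (\<lambda>k. ennreal (norm (a k * b (n - k)))) = econv (\<lambda>n. norm (a n)) (\<lambda>n. norm (b n)) n"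
    by (simp add: econv_def norm_mult ennreal_mult)
  also have "\<dots> < \<infinity>" using assms by (intro econv_finite) (simp_all add: zsummable_iff)
  finally show ?thesis by (simp add: zsummable_iff)
qed

lemma conv_add_right:
  assumes "zsummable a" "zsummable b" "zsummable c"
  shows "conv a (\<lambda>k. b k + c k) n = conv a b n + conv a c n"
  unfolding conv_def distrib_left
  by (rule Bochner_Integration.integral_add) (intro zsummable_product assms)+

lemma conv_cmult_right: "conv a (\<lambda>k. c * b k) n = c * conv a b n"
proof -
  have "conv a (\<lambda>k. c * b k) n = zsum (\<lambda>k. c * (a k * b (n - k)))"
    unfolding conv_def by (simp only: mult_ac)
  then show ?thesis by (simp add: conv_def)
qed

lemma synth_add:
  "zsummable a \<Longrightarrow> zsummable b \<Longrightarrow> synth (\<lambda>n. a n + b n) x = synth a x + synth b x"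
  unfolding synth_def distrib_right by (rule Bochner_Integration.integral_add) (intro zsummable_cis; assumption)+

lemma synth_cmult: "synth (\<lambda>n. c * a n) x = c * synth a x"
  unfolding synth_def mult.assoc by simp

text \<open>Summation over modes commutes with the time integral because the fluxes \<open>q\<close>
  are summable in \<open>n\<close> and integrable in time, while the test modes \<open>p\<close> are
  uniformly bounded.\<close>

lemma modes_Fubini:
  fixes q p :: "real \<Rightarrow> int \<Rightarrow> complex" and C :: real
  assumes q: "\<And>n. (\<lambda>s. q s n) \<in> borel_measurable borel" and p: "\<And>n. (\<lambda>s. p s n) \<in> borel_measurable borel"
    and p_le: "\<And>s n. s \<in> {0<..t} \<Longrightarrow> norm (p s n) \<le> C"
    and fin: "esint {0<..t} (\<lambda>s. esum (\<lambda>n. norm (q s n))) < \<infinity>"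
  shows "integrable lborel (\<lambda>s. indicator {0<..t} s * (q s n * p s n))"
    "zsummable (\<lambda>n. sint {0<..t} (\<lambda>s. q s n * p s n))"
    "zsum (\<lambda>n. sint {0<..t} (\<lambda>s. q s n * p s n)) =
     (sint {0<..t} (\<lambda>s. zsum (\<lambda>n. q s n * p s n)))"
proof -
  let ?h = "\<lambda>n s. indicator {0<..t} s * (q s n * p s n)"
  note [measurable] = q p
  have meas: "(\<lambda>(n, s). ?h n s) \<in> borel_measurable (count_space UNIV \<Otimes>\<^sub>M lborel)"
    by (rule measurable_case_zl) simp
  have int: "integrable (count_space UNIV \<Otimes>\<^sub>M lborel) (\<lambda>(n, s). ?h n s)"
  proof (rule integrableI_bounded[OF meas])
    have m: "(\<lambda>z. ennreal (norm (case z of (n, s) \<Rightarrow> ?h n s))) \<in> borel_measurable (count_space UNIV \<Otimes>\<^sub>M lborel)"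
      using meas by measurable
    have "(\<integral>\<^sup>+z. ennreal (norm (case z of (n, s) \<Rightarrow> ?h n s)) \<partial>(count_space UNIV \<Otimes>\<^sub>M lborel))
       = esum (\<lambda>n. \<integral>\<^sup>+s. ennreal (norm (?h n s)) \<partial>lborel)"
      using lborel.nn_integral_fst[OF m] by simp
    also have "\<dots> \<le> esum (\<lambda>n. \<integral>\<^sup>+s. ennreal \<bar>C\<bar> * (indicator {0<..t} s * ennreal (norm (q s n))) \<partial>lborel)"
    proof (intro nn_integral_mono)
      fix n s
      show "ennreal (norm (?h n s)) \<le> ennreal \<bar>C\<bar> * (indicator {0<..t} s * ennreal (norm (q s n)))"
      proof (cases "s \<in> {0<..t}")
        case True
        have "norm (q s n) * norm (p s n) \<le> norm (q s n) * \<bar>C\<bar>"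
          by (intro mult_left_mono order.trans[OF p_le[OF True] abs_ge_self]) simp
        then show ?thesis using True
          by (simp add: norm_mult mult.commute ennreal_leI flip: ennreal_mult)
      qed simp
    qed
    also have "\<dots> = ennreal \<bar>C\<bar> * esint {0<..t} (\<lambda>s. esum (\<lambda>n. norm (q s n)))"
    proof -
      have "esum (\<lambda>n. esint {0<..t} (\<lambda>s. ennreal (norm (q s n))))
         = (\<integral>\<^sup>+s. esum (\<lambda>n. indicator {0<..t} s * ennreal (norm (q s n))) \<partial>lborel)"
        by (rule zl.Fubini'[symmetric]) (simp add: measurable_case_zl)
      then show ?thesis by (simp add: nn_integral_cmult)
    qed
    also have "\<dots> < \<infinity>" using fin by (simp add: ennreal_mult_less_top)
    finally show "(\<integral>\<^sup>+z. ennreal (norm (case z of (n, s) \<Rightarrow> ?h n s)) \<partial>(count_space UNIV \<Otimes>\<^sub>M lborel)) < \<infinity>" .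
  qed
  show "integrable lborel (\<lambda>s. ?h n s)"
    using zl.AE_integrable_fst[OF int] by (simp add: AE_count_space)
  show "zsummable (\<lambda>n. \<integral>s. ?h n s \<partial>lborel)"
    using zl.integrable_fst[OF int] by simp
  have "zsum (\<lambda>n. \<integral>s. ?h n s \<partial>lborel) = (\<integral>s. zsum (\<lambda>n. ?h n s) \<partial>lborel)"
    using zl.Fubini_integral[OF int] by simp
  then show "zsum (\<lambda>n. \<integral>s. ?h n s \<partial>lborel) = sint {0<..t} (\<lambda>s. zsum (\<lambda>n. q s n * p s n))"
    by simp
qed

lemma integral_Ioc_of_real:
  fixes U :: "real \<Rightarrow> real \<Rightarrow> real"
  assumes [measurable]: "(\<lambda>p. U (fst p) (snd p)) \<in> borel_measurable borel"
    and Z: "\<And>s. s \<in> {0<..t} \<Longrightarrow> Z s = complex_of_real (LINT x:{0..2*pi}|lborel. U s x)"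
  shows "sint {0<..t} Z = complex_of_real (LINT s:{0..t}|lborel. LINT x:{0..2*pi}|lborel. U s x)"
proof -
  have [measurable]: "(\<lambda>p. U (fst p) (snd p)) \<in> borel_measurable (borel \<Otimes>\<^sub>M borel)"
    using assms(1) by (simp add: borel_prod)
  have [measurable]: "(\<lambda>s. LINT x:{0..2*pi}|lborel. U s x) \<in> borel_measurable borel"
    unfolding set_lebesgue_integral_def
    by (rule lborel.borel_measurable_lebesgue_integral) (simp add: case_prod_unfold)
  have "sint {0<..t} Z = sint {0<..t} (\<lambda>s. complex_of_real (LINT x:{0..2*pi}|lborel. U s x))"
    by (intro Bochner_Integration.integral_cong refl) (use Z in \<open>auto simp: indicator_def\<close>)
  also have "\<dots> = (LINT s:{0..t}|lborel. complex_of_real (LINT x:{0..2*pi}|lborel. U s x))"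
    by (rule integral_Ioc_Icc) simp
  finally show ?thesis by (simp only: set_integral_complex_of_real)
qed

lemma measurable_pd: "smooth2 \<phi> \<Longrightarrow> (\<lambda>p. pd ds \<phi> (fst p) (snd p)) \<in> borel_measurable borel"
  by (intro borel_measurable_continuous_onI smooth2_continuous)

context thin_film
begin

section \<open>The weak formulation\<close>

text \<open>Coefficients of the j-th space derivative of the solution; \<open>der\<close> is that
  derivative as a function.\<close>

definition dm :: "nat \<Rightarrow> real \<Rightarrow> int \<Rightarrow> complex" where "dm j t n = (\<i> * of_int n) ^ j * sol t n"

definition der :: "nat \<Rightarrow> real \<Rightarrow> real \<Rightarrow> real" where "der j t x = Re (synth (dm j t) x)"

text \<open>The Wiener norm of order 4 without exponential weight, as an extended number. It
  dominates all space derivatives up to order 4 uniformly in \<open>x\<close>.\<close>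

definition norm4 :: "real \<Rightarrow> ennreal" where
  "norm4 s = esum (\<lambda>n. ennreal ((1 + \<bar>of_int n\<bar>) ^ 4 * norm (sol s n)))"

lemma dm_0: "dm 0 t = sol t" by (simp add: dm_def fun_eq_iff)

lemma measurable_dm: "(\<lambda>s. dm j s n) \<in> borel_measurable borel"
  unfolding dm_def by (intro borel_measurable_times borel_measurable_const measurable_sol)

lemma hermit_dm: "0 \<le> t \<Longrightarrow> hermit (dm j t)"
  using hermit_sol[of t] by (simp add: hermit_def dm_def)

lemma measurable_der: "(\<lambda>p. der j (fst p) (snd p)) \<in> borel_measurable borel"
proof -
  have [measurable]: "(\<lambda>s. dm j s n) \<in> borel_measurable borel" for n by (rule measurable_dm)
  have "(\<lambda>p::real \<times> real. synth (dm j (fst p)) (snd p)) \<in> borel_measurable (borel \<Otimes>\<^sub>M borel)"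
    unfolding synth_def by (rule measurable_zsum) measurable
  then show ?thesis by (simp add: der_def borel_prod)
qed

lemma esum_sol_le: "0 \<le> t \<Longrightarrow> esum (\<lambda>n. norm (sol t n)) \<le> ennreal M0"
proof -
  assume t: "0 \<le> t"
  have "esum (\<lambda>n. norm (sol t n)) \<le> wsum 0 (W t) (mlim t)"
    unfolding wsum_def
  proof (intro nn_integral_mono)
    fix n
    have "ennreal (norm (sol t n)) \<le> 1 * mlim t n" using norm_sol_le[OF t] by simp
    also have "\<dots> \<le> W t n * mlim t n" by (intro mult_right_mono W_ge_1 t) simp
    finally show "ennreal (norm (sol t n)) \<le> ennreal (\<bar>of_int n\<bar> ^ 0) * (W t n * mlim t n)" by simp
  qed
  also have "\<dots> \<le> ennreal M0" by (rule wsum_mlim_le[OF t])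
  finally show ?thesis .
qed

lemma zsummable_sol: "0 \<le> t \<Longrightarrow> zsummable (sol t)"
  unfolding zsummable_iff by (rule le_less_trans[OF esum_sol_le]) simp_all

lemma fin4_sol: "0 < t \<Longrightarrow> fin4 (\<lambda>n. norm (sol t n))"
  by (rule fin4_mono[OF fin4_mlim]) (auto intro: norm_sol_le)

lemma esum_dm_le: "j \<le> 4 \<Longrightarrow> esum (\<lambda>n. norm (dm j t n)) \<le> norm4 t"
  unfolding norm4_def
proof (intro nn_integral_mono ennreal_leI)
  fix n assume j: "j \<le> 4"
  have "\<bar>real_of_int n\<bar> ^ j \<le> (1 + \<bar>of_int n\<bar>) ^ j" by (intro power_mono) auto
  also have "\<dots> \<le> (1 + \<bar>of_int n\<bar>) ^ 4" using j by (intro power_increasing) auto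
  finally show "norm (dm j t n) \<le> (1 + \<bar>of_int n\<bar>) ^ 4 * norm (sol t n)"
    unfolding dm_def norm_mult norm_power by (intro mult_right_mono) auto
qed

lemma weight4_le: "n \<noteq> 0 \<Longrightarrow> (1 + \<bar>real_of_int n\<bar>) ^ 4 \<le> 16 * \<bar>real_of_int n\<bar> ^ 4"
proof -
  assume "n \<noteq> 0"
  then have "1 \<le> \<bar>real_of_int n\<bar>" by linarith
  then have "(1 + \<bar>real_of_int n\<bar>) ^ 4 \<le> (2 * \<bar>real_of_int n\<bar>) ^ 4" by (intro power_mono) auto
  then show ?thesis by (simp add: power_mult_distrib)
qed

text \<open>The zero mean enters here: the homogeneous factor \<open>|n| ^ 4\<close> controls
  \<open>(1 + |n|) ^ 4\<close> only off the frequency 0, at the price of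
  \<open>16 = 2 ^ 4\<close>.\<close>

lemma esum_weight4_le:
  assumes t: "0 \<le> t" and w: "\<And>n. ennreal (w n) \<le> W t n" "\<And>n. 0 \<le> w n"
  shows "esum (\<lambda>n. ennreal ((1 + \<bar>of_int n\<bar>) ^ 4 * w n * norm (sol t n))) \<le> 16 * wsum 4 (W t) (mlim t)"
proof -
  have "esum (\<lambda>n. ennreal ((1 + \<bar>of_int n\<bar>) ^ 4 * w n * norm (sol t n)))
      \<le> esum (\<lambda>n. 16 * (ennreal (\<bar>of_int n\<bar> ^ 4) * (W t n * mlim t n)))"
  proof (intro nn_integral_mono)
    fix n
    show "ennreal ((1 + \<bar>of_int n\<bar>) ^ 4 * w n * norm (sol t n)) \<le> 16 * (ennreal (\<bar>of_int n\<bar> ^ 4) * (W t n * mlim t n))"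
    proof (cases "n = 0")
      case True
      then show ?thesis using sol_freq_0[OF t] by simp
    next
      case False
      have "ennreal ((1 + \<bar>of_int n\<bar>) ^ 4 * w n * norm (sol t n)) = ennreal ((1 + \<bar>of_int n\<bar>) ^ 4) * (ennreal (w n) * ennreal (norm (sol t n)))"
        using w by (simp add: ennreal_mult mult.assoc)
      also have "\<dots> \<le> ennreal (16 * \<bar>of_int n\<bar> ^ 4) * (W t n * mlim t n)"
        using w weight4_le[OF False] norm_sol_le[OF t] by (intro mult_mono ennreal_leI) auto
      also have "\<dots> = 16 * (ennreal (\<bar>of_int n\<bar> ^ 4) * (W t n * mlim t n))"
        by (simp add: ennreal_mult mult.assoc)
      finally show ?thesis .
    qed
  qed
  also have "\<dots> = 16 * wsum 4 (W t) (mlim t)" by (simp add: wsum_def nn_integral_cmult)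
  finally show ?thesis .
qed

lemma norm4_le: "0 \<le> t \<Longrightarrow> norm4 t \<le> 16 * wsum 4 (W t) (mlim t)"
  using esum_weight4_le[of t "\<lambda>_. 1"] W_ge_1[of t] by (simp add: norm4_def)

lemma norm4_finite: "0 < t \<Longrightarrow> norm4 t < \<infinity>"
proof -
  assume t: "0 < t"
  have "norm4 t \<le> esum (\<lambda>n. ennreal (16 * \<bar>of_int n\<bar> ^ 4) * ennreal (norm (sol t n)))"
    unfolding norm4_def
  proof (intro nn_integral_mono)
    fix n
    show "ennreal ((1 + \<bar>of_int n\<bar>) ^ 4 * norm (sol t n)) \<le> ennreal (16 * \<bar>of_int n\<bar> ^ 4) * ennreal (norm (sol t n))"
    proof (cases "n = 0")
      case True
      then show ?thesis using sol_freq_0[of t] t by simp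
    next
      case False
      show ?thesis using mult_right_mono[OF weight4_le[OF False] norm_ge_zero[of "sol t n"]]
        by (simp add: ennreal_leI flip: ennreal_mult)
    qed
  qed
  also have "\<dots> < \<infinity>" by (rule esum_ennreal_mult_finite[OF fin4_sol[OF t], where c=16]) simp
  finally show ?thesis .
qed

lemma measurable_norm4 [measurable]: "norm4 \<in> borel_measurable borel"
  unfolding norm4_def using measurable_sol by (intro measurable_esum) simp

lemma nn_integral_norm4_finite:
  assumes "0 \<le> t" shows "esint {0..t} norm4 < \<infinity>"
proof -
  have "esint {0..t} norm4 \<le> (\<integral>\<^sup>+s. 16 * (indicator {0..t} s * wsum 4 (W s) (mlim s)) \<partial>lborel)"
    by (intro nn_integral_mono) (use norm4_le in \<open>auto simp: indicator_def\<close>)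
  also have "\<dots> = 16 * diss mlim t"
    unfolding diss_def
    by (rule nn_integral_cmult) (auto intro!: borel_measurable_times_ennreal measurable_wsum simp: measurable_mlim measurable_W)
  also have "\<dots> < \<infinity>" using diss_mlim_finite[OF assms] by (simp add: ennreal_mult_less_top)
  finally show ?thesis .
qed

lemma zsummable_dm: "0 < t \<Longrightarrow> j \<le> 4 \<Longrightarrow> zsummable (dm j t)"
  unfolding zsummable_iff by (rule le_less_trans[OF esum_dm_le norm4_finite])

lemma synth_dm: "0 \<le> t \<Longrightarrow> synth (dm j t) x = complex_of_real (der j t x)"
  unfolding der_def by (rule hermit_synth[symmetric]) (rule hermit_dm)

lemma abs_der_le: "0 < t \<Longrightarrow> j \<le> 4 \<Longrightarrow> \<bar>der j t x\<bar> \<le> enn2real (norm4 t)"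
proof -
  assume t: "0 < t" and j: "j \<le> 4"
  have "ennreal \<bar>der j t x\<bar> \<le> ennreal (norm (synth (dm j t) x))"
    unfolding der_def by (intro ennreal_leI abs_Re_le_cmod)
  also have "\<dots> \<le> norm4 t" by (rule order.trans[OF norm_synth_le esum_dm_le[OF j]])
  also have "\<dots> = ennreal (enn2real (norm4 t))" using norm4_finite[OF t] by simp
  finally show ?thesis by (subst (asm) ennreal_le_iff) auto
qed

lemma abs_der_0_le: "0 \<le> t \<Longrightarrow> \<bar>der 0 t x\<bar> \<le> M0"
proof -
  assume t: "0 \<le> t"
  have "ennreal \<bar>der 0 t x\<bar> \<le> ennreal (norm (synth (sol t) x))"
    unfolding der_def dm_0 by (intro ennreal_leI abs_Re_le_cmod)
  also have "\<dots> \<le> ennreal M0" by (rule order.trans[OF norm_synth_le esum_sol_le[OF t]])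
  finally show ?thesis using M0_nonneg by (subst (asm) ennreal_le_iff) auto
qed

lemma per_der: "per (der j t)"
  by (simp add: per_def der_def synth_periodic)

text \<open>The disjunction reflects the regularity available: up to four derivatives for positive
  times, only the function itself at time 0.\<close>

lemma dm_pairing:
  assumes "0 < t \<and> j \<le> 4 \<or> 0 \<le> t \<and> j = 0" "continuous_on {0..2*pi} h"
  shows "zsum (\<lambda>n. dm j t n * fmode h n) = complex_of_real (LINT x:{0..2*pi}|lborel. der j t x * h x)"
proof -
  have s: "zsummable (dm j t)" and t: "0 \<le> t"
    using assms zsummable_dm zsummable_sol by (auto simp: dm_0)
  have "zsum (\<lambda>n. dm j t n * fmode h n) = (LINT x:{0..2*pi}|lborel. synth (dm j t) x * of_real (h x))"
    unfolding fmode_def by (rule synth_pairing[OF s, symmetric]) (intro continuous_intros assms)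
  also have "\<dots> = (LINT x:{0..2*pi}|lborel. complex_of_real (der j t x * h x))"
    by (simp add: synth_dm[OF t])
  finally show ?thesis by (simp only: set_integral_complex_of_real)
qed

text \<open>Parseval on both sides: the factor \<open>\<i> * n\<close> moves from the coefficients
  to the test function, where it is an integration by parts.\<close>

lemma weak_deriv_der:
  assumes t: "0 < t" and j: "j < 4"
  shows "weak_deriv (der j t) (der (Suc j) t)"
  unfolding weak_deriv_def
proof (intro conjI allI impI per_der)
  have [measurable]: "der (Suc j) t \<in> borel_measurable borel"
    using measurable_compose[OF measurable_Pair1' [of t borel borel] measurable_der[of "Suc j", folded borel_prod]]
    by (simp add: borel_prod)
  show "set_integrable lborel {0..2*pi} (der (Suc j) t)"
    unfolding set_integrable_def
    by (rule integrableI_bounded_set_indicator[where B="enn2real (norm4 t)"])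
       (use abs_der_le[OF t, of "Suc j"] j in auto)
  fix \<phi> assume \<phi>: "smooth1 \<phi> \<and> per \<phi>"
  have d: "(\<phi> has_real_derivative deriv \<phi> x) (at x)" for x
    using \<phi> unfolding smooth1_def DERIV_deriv_iff_real_differentiable
    by (metis funpow_0)
  have c: "continuous_on S \<phi>" for S
    using d by (intro continuous_at_imp_continuous_on ballI) (rule DERIV_isCont)
  have c': "continuous_on S (deriv \<phi>)" for S
  proof (intro continuous_at_imp_continuous_on ballI)
    fix x
    have "((deriv ^^ 1) \<phi>) differentiable (at x)" using \<phi> unfolding smooth1_def by blast
    then show "isCont (deriv \<phi>) x" by (simp add: differentiable_imp_continuous_within)
  qed
  have p: "\<phi> (2*pi) = \<phi> 0" using \<phi> unfolding per_def by (metis add_0)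
  have "complex_of_real (LINT x:{0..2*pi}|lborel. der j t x * deriv \<phi> x) = zsum (\<lambda>n. dm j t n * fmode (deriv \<phi>) n)"
    by (rule dm_pairing[symmetric]) (use t j c' in auto)
  also have "\<dots> = zsum (\<lambda>n. - (dm (Suc j) t n * fmode \<phi> n))"
    by (simp add: fmode_deriv[OF d c' p] dm_def algebra_simps)
  also have "\<dots> = - zsum (\<lambda>n. dm (Suc j) t n * fmode \<phi> n)" by simp
  also have "\<dots> = complex_of_real (- (LINT x:{0..2*pi}|lborel. der (Suc j) t x * \<phi> x))"
    by (subst dm_pairing) (use t j c in auto)
  finally show "(LINT x:{0..2*pi}|lborel. der j t x * deriv \<phi> x) = - (LINT x:{0..2*pi}|lborel. der (Suc j) t x * \<phi> x)"
    by (simp only: of_real_eq_iff)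
qed

end

lemma zsummable_mult_fmode:
  assumes "zsummable a" "continuous_on {0..2*pi} h"
  shows "zsummable (\<lambda>n. a n * fmode h n)"
proof -
  obtain C where "\<forall>x\<in>{0..2*pi}. norm (h x) \<le> C"
    using compact_imp_bounded[OF compact_continuous_image[OF assms(2) compact_Icc]]
    unfolding bounded_iff by blast
  then have C: "norm (fmode h n) \<le> 2 * pi * C" for n
    by (intro norm_fmode_le assms(2)) auto
  have "zsummable (\<lambda>n. of_real (2 * pi * C) * a n)" using assms(1) by simp
  then show ?thesis
  proof (rule Bochner_Integration.integrable_bound)
    show "AE n in count_space UNIV. norm (a n * fmode h n) \<le> norm (of_real (2 * pi * C) * a n)"
    proof (intro AE_I2)
      fix n
      have "norm (a n) * norm (fmode h n) \<le> norm (a n) * \<bar>2 * pi * C\<bar>"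
        by (intro mult_left_mono order.trans[OF C abs_ge_self]) simp
      then show "norm (a n * fmode h n) \<le> norm (of_real (2 * pi * C) * a n)"
        unfolding norm_mult norm_of_real by (simp only: mult.commute)
    qed
  qed simp
qed

context thin_film
begin

lemma integrable_NN:
  assumes t: "0 \<le> t"
  shows "integrable lborel (\<lambda>s. indicator {0<..t} s * (of_real (exp (- lam n * (t - s))) * NN (sol s) n))"
proof (rule integrableI_bounded)
  note [measurable] = measurable_NN[OF measurable_sol]
  show "(\<lambda>s. indicator {0<..t} s * (of_real (exp (- lam n * (t - s))) * NN (sol s) n)) \<in> borel_measurable lborel"
    by measurable
  have "(\<integral>\<^sup>+s. ennreal (norm (indicator {0<..t} s * (of_real (exp (- lam n * (t - s))) * NN (sol s) n))) \<partial>lborel)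
    \<le> esint {0<..t} (\<lambda>s. ennreal (exp (- lam n * (t - s))) * EN (mlim s) n)"
  proof (intro nn_integral_mono)
    fix s
    show "ennreal (norm (indicator {0<..t} s * (complex_of_real (exp (- lam n * (t - s))) * NN (sol s) n)))
       \<le> indicator {0<..t} s * (ennreal (exp (- lam n * (t - s))) * EN (mlim s) n)"
      using norm_NN_sol_le[of s n]
      by (cases "s \<in> {0<..t}") (auto simp: norm_mult ennreal_mult intro!: mult_left_mono)
  qed
  also have "\<dots> < \<infinity>" by (rule nn_integral_EN_finite[OF t])
  finally show "(\<integral>\<^sup>+s. ennreal (norm (indicator {0<..t} s * (of_real (exp (- lam n * (t - s))) * NN (sol s) n))) \<partial>lborel) < \<infinity>" .
qed

text \<open>Weak form of the scalar equation \<open>a' = - \<lambda> a + N\<close> of one mode,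
  tested with the Fourier mode of \<open>\<phi>\<close>.\<close>

lemma mode_identity:
  assumes t: "0 \<le> t" and \<phi>: "smooth2 \<phi>"
  shows "sol t n * fmode (\<phi> t) n - A n * fmode (\<phi> 0) n = (\<integral>s. indicator {0<..t} s *
    (NN (sol s) n * fmode (\<phi> s) n + sol s n * (fmode (pd [True] \<phi> s) n - of_real (lam n) * fmode (\<phi> s) n)) \<partial>lborel)"
proof -
  \<comment> \<open>Integrating factor: \<open>exp (lam n * s) * sol s n\<close> is the datum plus
    an integral of \<open>G\<close>, so \<open>integral_product_rule\<close> applies. The inverse
    factor is given to the test function.\<close>
  define e where "e s = complex_of_real (exp (lam n * s))" for s
  define e' where "e' s = complex_of_real (exp (- lam n * s))" for s
  have ee': "e s * e' s = 1" for s unfolding e_def e'_def by (simp flip: of_real_mult exp_add)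
  have shift: "e s * complex_of_real (exp (- lam n * (s - r))) = e r" for r s
    unfolding e_def by (simp flip: of_real_mult exp_add add: algebra_simps)
  define G where "G s = e s * NN (sol s) n" for s
  define b where "b s = e s * sol s n" for s
  define \<psi> where "\<psi> s = e' s * fmode (\<phi> s) n" for s
  define \<psi>' where "\<psi>' s = e' s * (fmode (pd [True] \<phi> s) n - of_real (lam n) * fmode (\<phi> s) n)" for s
  have G_eq: "(\<lambda>r. indicator {0<..s} r * G r) =
    (\<lambda>r. e s * (indicator {0<..s} r * (complex_of_real (exp (- lam n * (s - r))) * NN (sol r) n)))" for s
  proof (rule ext)
    fix r
    have "indicator {0<..s} r * G r = indicator {0<..s} r * ((e s * complex_of_real (exp (- lam n * (s - r)))) * NN (sol r) n)"
      unfolding shift G_def ..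
    then show "indicator {0<..s} r * G r = e s * (indicator {0<..s} r * (complex_of_real (exp (- lam n * (s - r))) * NN (sol r) n))"
      by (simp only: mult_ac)
  qed
  have "b t * \<psi> t - A n * \<psi> 0 = sint {0<..t} (\<lambda>s. G s * \<psi> s + b s * \<psi>' s)"
  proof (rule integral_product_rule[OF t])
    show "G \<in> borel_measurable borel"
      unfolding G_def[abs_def] e_def using measurable_NN[OF measurable_sol] by simp
    show "integrable lborel (\<lambda>s. indicator {0<..t} s * G s)"
      unfolding G_eq by (intro integrable_mult_right integrable_NN[OF t])
    show "b s = A n + sint {0<..s} G" if "0 \<le> s" for s
    proof -
      have "b s = (e s * e' s) * A n + e s * sint {0<..s} (\<lambda>r. of_real (exp (- lam n * (s - r))) * NN (sol r) n)"
        unfolding b_def duhamel_sol[OF that, of n] e'_def by (simp only: distrib_left mult.assoc)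
      also have "\<dots> = A n + sint {0<..s} G"
        unfolding ee' G_eq integral_mult_right_zero by simp
      finally show ?thesis .
    qed
    show "(\<psi> has_vector_derivative \<psi>' s) (at s)" for s
    proof -
      have "((\<lambda>s. complex_of_real (exp (- lam n * s))) has_vector_derivative complex_of_real (- lam n * exp (- lam n * s))) (at s)"
        by (rule has_vector_derivative_of_real) (auto intro!: derivative_eq_intros)
      from has_vector_derivative_mult[OF this fmode_deriv_t[OF \<phi>, of n s]]
      show ?thesis
        unfolding \<psi>_def[abs_def] e'_def
        by (rule has_vector_derivative_eq_rhs) (simp add: \<psi>'_def e'_def algebra_simps)
    qed
    show "continuous_on UNIV \<psi>'"
    proof -
      have "continuous_on UNIV (\<lambda>s. complex_of_real (exp (- lam n * s)))" by (intro continuous_intros)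
      moreover have "continuous_on UNIV (\<lambda>s. fmode (\<phi> s) n)"
        using continuous_fmode[OF \<phi>, of UNIV "[]"] by simp
      ultimately show ?thesis
        unfolding \<psi>'_def[abs_def] e'_def
        by (intro continuous_on_mult continuous_on_diff continuous_on_const continuous_fmode[OF \<phi>])
    qed
  qed
  moreover have "b t * \<psi> t = (e t * e' t) * (sol t n * fmode (\<phi> t) n)"
    unfolding b_def \<psi>_def by (simp only: mult_ac)
  moreover have "\<psi> 0 = fmode (\<phi> 0) n" by (simp add: \<psi>_def e'_def)
  moreover have "G s * \<psi> s + b s * \<psi>' s = (e s * e' s) *
    (NN (sol s) n * fmode (\<phi> s) n + sol s n * (fmode (pd [True] \<phi> s) n - of_real (lam n) * fmode (\<phi> s) n))" for s
    unfolding G_def b_def \<psi>_def \<psi>'_def by (simp only: algebra_simps)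
  ultimately show ?thesis by (simp only: ee' mult_1_left)
qed

text \<open>Fourier coefficients of \<open>(1 + \<epsilon>\<zeta>) \<partial>\<^sup>j\<zeta>\<close> and \<open>(1 + \<epsilon>\<zeta>)^3 \<partial>\<^sup>2\<zeta>\<close>.\<close>

definition q1 :: "nat \<Rightarrow> real \<Rightarrow> int \<Rightarrow> complex" where
  "q1 j s n = dm j s n + conv (\<lambda>k. of_real eps * sol s k) (dm j s) n"

definition q2 :: "real \<Rightarrow> int \<Rightarrow> complex" where
  "q2 s n = dm 2 s n + conv (P3 (sol s)) (dm 2 s) n"

lemma measurable_q1: "(\<lambda>s. q1 j s n) \<in> borel_measurable borel"
  unfolding q1_def
  by (intro borel_measurable_add measurable_conv borel_measurable_times borel_measurable_const measurable_sol measurable_dm)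

lemma measurable_q2: "(\<lambda>s. q2 s n) \<in> borel_measurable borel"
  unfolding q2_def P3_def
  by (intro borel_measurable_add measurable_conv borel_measurable_times borel_measurable_const measurable_sol measurable_dm)

text \<open>\<open>z\<close> stands for the mode of the test function, so
  \<open>- (\<i> * n) * z\<close> and \<open>- n ^ 2 * z\<close> are the modes of its first two
  derivatives. The linear part is regrouped with the nonlinearity into the three fluxes of the weak
  formulation.\<close>

lemma NN_flux:
  assumes s: "0 < s"
  shows "NN (sol s) n * z - of_real (lam n) * (sol s n * z) =
    q1 1 s n * (- (\<i> * of_int n) * z) + of_real al * (q1 3 s n * (- (\<i> * of_int n) * z))
      - of_real be * (q2 s n * (- (of_int n)\<^sup>2 * z))"
proof -
  let ?e = "\<lambda>k. of_real eps * sol s k"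
  have sum: "zsummable ?e" using zsummable_sol[of s] s by simp
  have "(\<lambda>k. (\<i> * of_int k + of_real al * (\<i> * of_int k) ^ 3) * sol s k) = (\<lambda>k. dm 1 s k + of_real al * dm 3 s k)"
    by (simp add: dm_def fun_eq_iff algebra_simps)
  then have 1: "conv ?e (\<lambda>k. (\<i> * of_int k + of_real al * (\<i> * of_int k) ^ 3) * sol s k) n
     = conv ?e (dm 1 s) n + of_real al * conv ?e (dm 3 s) n"
    using zsummable_dm[OF s, of 1] zsummable_dm[OF s, of 3] by (simp add: conv_add_right[OF sum] conv_cmult_right)
  have 2: "(\<lambda>k. (\<i> * of_int k)\<^sup>2 * sol s k) = dm 2 s" by (simp add: dm_def fun_eq_iff)
  have d: "dm 1 s n = \<i> * of_int n * sol s n" "dm 2 s n = - (of_int n ^ 2) * sol s n" "dm 3 s n = - \<i> * of_int n ^ 3 * sol s n"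
  proof -
    have "\<i> ^ 3 = - \<i>" by (simp add: power3_eq_cube)
    then show "dm 1 s n = \<i> * of_int n * sol s n" "dm 2 s n = - (of_int n ^ 2) * sol s n" "dm 3 s n = - \<i> * of_int n ^ 3 * sol s n"
      by (simp_all add: dm_def power_mult_distrib)
  qed
  have l: "complex_of_real (lam n) = (of_real al + of_real be) * of_int n ^ 4 - of_int n ^ 2"
    by (simp add: lam_def)
  have i: "\<i> * (\<i> * z) = - z" for z by (simp flip: mult.assoc)
  show ?thesis
    unfolding NN_def 1 2 q1_def q2_def d l
    by (simp add: algebra_simps i power_numeral_reduce)
qed

lemma esum_norm_add_le:
  fixes a b :: "int \<Rightarrow> complex"
  shows "esum (\<lambda>n. norm (a n + b n)) \<le> esum (\<lambda>n. norm (a n)) + esum (\<lambda>n. norm (b n))"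
  by (subst nn_integral_add[symmetric]) (auto intro!: nn_integral_mono ennreal_norm_triangle simp del: ennreal_plus)

lemma esum_norm_conv_le:
  fixes a b :: "int \<Rightarrow> complex"
  shows "esum (\<lambda>n. norm (conv a b n)) \<le> esum (\<lambda>n. norm (a n)) * esum (\<lambda>n. norm (b n))"
  unfolding esum_econv_1[symmetric] by (intro nn_integral_mono norm_conv_le)

lemma esum_q1_le:
  assumes s: "0 \<le> s" and j: "j \<le> 4"
  shows "esum (\<lambda>n. norm (q1 j s n)) \<le> ennreal (1 + eps * M0) * norm4 s"
proof -
  have "esum (\<lambda>n. norm (of_real eps * sol s n)) = ennreal eps * esum (\<lambda>n. norm (sol s n))"
    using eps by (simp add: norm_mult ennreal_mult nn_integral_cmult)
  also have "\<dots> \<le> ennreal (eps * M0)"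
    using esum_sol_le[OF s] eps M0_nonneg by (simp add: ennreal_mult mult_left_mono)
  finally have e: "esum (\<lambda>n. norm (of_real eps * sol s n)) \<le> ennreal (eps * M0)" .
  have "esum (\<lambda>n. norm (q1 j s n)) \<le> norm4 s + ennreal (eps * M0) * norm4 s"
    unfolding q1_def
    by (intro order.trans[OF esum_norm_add_le] add_mono order.trans[OF esum_norm_conv_le] mult_mono e esum_dm_le j) auto
  also have "\<dots> = ennreal (1 + eps * M0) * norm4 s"
    using eps M0_nonneg by (simp add: distrib_right)
  finally show ?thesis .
qed

text \<open>This is \<open>(1 + eps * M0) ^ 3 - 1\<close>, the norm bound for the coefficients
  \<open>P3\<close>.\<close>

definition "KP = 3 * eps * M0 + 3 * eps\<^sup>2 * (M0 * M0) + eps ^ 3 * (M0 * (M0 * M0))"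

lemma KP_nonneg: "0 \<le> KP" using eps M0_nonneg by (simp add: KP_def)

lemma esum_P3_le:
  assumes s: "0 \<le> s"
  shows "esum (\<lambda>n. norm (P3 (sol s) n)) \<le> ennreal KP"
proof -
  let ?u = "\<lambda>n. ennreal (norm (sol s n))"
  have u: "esum ?u \<le> ennreal M0" by (rule esum_sol_le[OF s])
  then have fin: "esum ?u < \<infinity>" by (rule le_less_trans) simp
  have "esum (\<lambda>n. norm (P3 (sol s) n)) \<le> esum (EP3 ?u)"
    using majd_P3[OF majd_self fin, of "sol s"] by (intro nn_integral_mono) (simp add: majd_def)
  also have "\<dots> = ennreal (3 * eps) * esum ?u + ennreal (3 * eps\<^sup>2) * (esum ?u * esum ?u) + ennreal (eps ^ 3) * (esum ?u * (esum ?u * esum ?u))"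
    unfolding EP3_def by (simp add: nn_integral_add nn_integral_cmult esum_econv_1)
  also have "\<dots> \<le> ennreal (3 * eps) * ennreal M0 + ennreal (3 * eps\<^sup>2) * (ennreal M0 * ennreal M0) + ennreal (eps ^ 3) * (ennreal M0 * (ennreal M0 * ennreal M0))"
    by (intro add_mono mult_mono u) auto
  also have "\<dots> = ennreal KP"
    unfolding KP_def using eps M0_nonneg by (simp flip: ennreal_mult ennreal_plus)
  finally show ?thesis .
qed

lemma esum_q2_le:
  assumes s: "0 \<le> s"
  shows "esum (\<lambda>n. norm (q2 s n)) \<le> ennreal (1 + KP) * norm4 s"
proof -
  have "esum (\<lambda>n. norm (q2 s n)) \<le> norm4 s + ennreal KP * norm4 s"
    unfolding q2_def
    by (intro order.trans[OF esum_norm_add_le] add_mono order.trans[OF esum_norm_conv_le] mult_mono esum_P3_le s esum_dm_le) auto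
  also have "\<dots> = ennreal (1 + KP) * norm4 s"
    using KP_nonneg by (simp add: distrib_right)
  finally show ?thesis .
qed

lemma synth_q1:
  assumes s: "0 < s" and j: "j \<le> 4"
  shows "synth (q1 j s) x = of_real ((1 + eps * der 0 s x) * der j s x)"
proof -
  have e: "zsummable (\<lambda>k. of_real eps * sol s k)" and d: "zsummable (dm j s)"
    using zsummable_sol[of s] s zsummable_dm[OF s j] by auto
  have "synth (q1 j s) x = synth (dm j s) x + of_real eps * synth (dm 0 s) x * synth (dm j s) x"
    unfolding q1_def[abs_def] dm_0
    by (subst synth_add[OF d zsummable_conv[OF e d]]) (simp add: synth_conv[OF e d] synth_cmult)
  then show ?thesis using s by (simp add: synth_dm algebra_simps)
qed

lemma zsummable_P3: "0 \<le> s \<Longrightarrow> zsummable (P3 (sol s))"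
  unfolding zsummable_iff by (rule le_less_trans[OF esum_P3_le]) simp_all

text \<open>\<open>P3\<close> synthesizes to \<open>(1 + eps * \<zeta>) ^ 3 - 1\<close>, and the
  summand \<open>dm 2\<close> restores the missing 1.\<close>

lemma synth_q2:
  assumes s: "0 < s"
  shows "synth (q2 s) x = of_real ((1 + eps * der 0 s x) ^ 3 * der 2 s x)"
proof -
  have a: "zsummable (sol s)" and d: "zsummable (dm 2 s)" and p: "zsummable (P3 (sol s))"
    using zsummable_sol[of s] s zsummable_dm[OF s, of 2] zsummable_P3[of s] by auto
  note aa = zsummable_conv[OF a a]
  note aaa = zsummable_conv[OF a aa]
  let ?Z = "synth (sol s) x"
  have "synth (P3 (sol s)) x = of_real (3 * eps) * ?Z + of_real (3 * eps\<^sup>2) * (?Z * ?Z) + of_real (eps ^ 3) * (?Z * (?Z * ?Z))"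
  proof -
    have "synth (P3 (sol s)) x = synth (\<lambda>n. of_real (3 * eps) * sol s n + of_real (3 * eps\<^sup>2) * conv (sol s) (sol s) n) x
      + synth (\<lambda>n. of_real (eps ^ 3) * conv (sol s) (conv (sol s) (sol s)) n) x"
      unfolding P3_def[abs_def] by (rule synth_add) (use a aa aaa in auto)
    also have "synth (\<lambda>n. of_real (3 * eps) * sol s n + of_real (3 * eps\<^sup>2) * conv (sol s) (sol s) n) x
      = synth (\<lambda>n. of_real (3 * eps) * sol s n) x + synth (\<lambda>n. of_real (3 * eps\<^sup>2) * conv (sol s) (sol s) n) x"
      by (rule synth_add) (use a aa in auto)
    finally show ?thesis by (simp only: synth_cmult synth_conv[OF a a] synth_conv[OF a aa])
  qed
  moreover have "synth (q2 s) x = synth (dm 2 s) x + synth (P3 (sol s)) x * synth (dm 2 s) x"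
    unfolding q2_def[abs_def]
    by (subst synth_add[OF d zsummable_conv[OF p d]]) (simp add: synth_conv[OF p d])
  moreover have "?Z = of_real (der 0 s x)" using synth_dm[of s 0 x] s by (simp add: dm_0)
  ultimately show ?thesis
    using s by (simp add: synth_dm algebra_simps power3_eq_cube power2_eq_square)
qed

lemma flux_pairing:
  assumes s: "0 < s" and h: "continuous_on {0..2*pi} h"
  shows "j \<le> 4 \<Longrightarrow> zsum (\<lambda>n. q1 j s n * fmode h n) = of_real (LINT x:{0..2*pi}|lborel. (1 + eps * der 0 s x) * der j s x * h x)"
    and "zsum (\<lambda>n. q2 s n * fmode h n) = of_real (LINT x:{0..2*pi}|lborel. (1 + eps * der 0 s x) ^ 3 * der 2 s x * h x)"
proof -
  assume j: "j \<le> 4"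
  have "zsummable (q1 j s)" unfolding zsummable_iff
    by (rule le_less_trans[OF esum_q1_le]) (use s j norm4_finite[OF s] in \<open>auto simp: ennreal_mult_less_top\<close>)
  then show "zsum (\<lambda>n. q1 j s n * fmode h n) = of_real (LINT x:{0..2*pi}|lborel. (1 + eps * der 0 s x) * der j s x * h x)"
    unfolding fmode_def set_integral_complex_of_real[symmetric]
    by (subst synth_pairing[symmetric]) (auto simp: synth_q1[OF s j] intro!: continuous_on_of_real h)
next
  have "zsummable (q2 s)" unfolding zsummable_iff
    by (rule le_less_trans[OF esum_q2_le]) (use s norm4_finite[OF s] in \<open>auto simp: ennreal_mult_less_top\<close>)
  then show "zsum (\<lambda>n. q2 s n * fmode h n) = of_real (LINT x:{0..2*pi}|lborel. (1 + eps * der 0 s x) ^ 3 * der 2 s x * h x)"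
    unfolding fmode_def set_integral_complex_of_real[symmetric]
    by (subst synth_pairing[symmetric]) (auto simp: synth_q2[OF s] intro!: continuous_on_of_real h)
qed

lemma fin_flux:
  assumes t: "0 \<le> t" and q: "\<And>s. 0 \<le> s \<Longrightarrow> esum (\<lambda>n. norm (q s n)) \<le> ennreal K * norm4 s"
  shows "esint {0<..t} (\<lambda>s. esum (\<lambda>n. norm (q s n))) < \<infinity>"
proof -
  have "esint {0<..t} (\<lambda>s. esum (\<lambda>n. norm (q s n))) \<le> (\<integral>\<^sup>+s. ennreal K * (indicator {0..t} s * norm4 s) \<partial>lborel)"
    by (intro nn_integral_mono) (use q in \<open>auto simp: indicator_def\<close>)
  also have "\<dots> = ennreal K * esint {0..t} norm4" by (simp add: nn_integral_cmult)
  also have "\<dots> < \<infinity>" using nn_integral_norm4_finite[OF t] by (simp add: ennreal_mult_less_top)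
  finally show ?thesis .
qed

text \<open>The sum over \<open>n\<close> of the mode identities: \<open>modes_Fubini\<close> brings
  the sum inside the time integral, and Parseval turns it into a space integral.\<close>

lemma weak_form:
  assumes t: "0 \<le> t" and \<phi>: "smooth2 \<phi>" and per: "\<And>t x. \<phi> t (x + 2*pi) = \<phi> t x"
  shows "(LINT x:{0..2*pi}|lborel. der 0 t x * \<phi> t x)
          - (LINT x:{0..2*pi}|lborel. der 0 0 x * \<phi> 0 x)
          - (LINT s:{0..t}|lborel. LINT x:{0..2*pi}|lborel. der 0 s x * pd [True] \<phi> s x)
          = (LINT s:{0..t}|lborel. LINT x:{0..2*pi}|lborel. (1 + eps * der 0 s x) * der 1 s x * pd [False] \<phi> s x)
            + al * (LINT s:{0..t}|lborel. LINT x:{0..2*pi}|lborel. (1 + eps * der 0 s x) * der 3 s x * pd [False] \<phi> s x)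
            - be * (LINT s:{0..t}|lborel. LINT x:{0..2*pi}|lborel. (1 + eps * der 0 s x) ^ 3 * der 2 s x * pd [False, False] \<phi> s x)"
proof -
  let ?L = "LINT x:{0..2*pi}|lborel. der 0 t x * \<phi> t x" and ?B = "LINT x:{0..2*pi}|lborel. der 0 0 x * \<phi> 0 x"
  let ?T = "LINT s:{0..t}|lborel. LINT x:{0..2*pi}|lborel. der 0 s x * pd [True] \<phi> s x"
  let ?F1 = "LINT s:{0..t}|lborel. LINT x:{0..2*pi}|lborel. (1 + eps * der 0 s x) * der 1 s x * pd [False] \<phi> s x"
  let ?F3 = "LINT s:{0..t}|lborel. LINT x:{0..2*pi}|lborel. (1 + eps * der 0 s x) * der 3 s x * pd [False] \<phi> s x"
  let ?F2 = "LINT s:{0..t}|lborel. LINT x:{0..2*pi}|lborel. (1 + eps * der 0 s x) ^ 3 * der 2 s x * pd [False, False] \<phi> s x"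
  let ?Pt = "\<lambda>s n. fmode (pd [True] \<phi> s) n" and ?Px = "\<lambda>s n. fmode (pd [False] \<phi> s) n"
    and ?Pxx = "\<lambda>s n. fmode (pd [False, False] \<phi> s) n"
  have cont: "continuous_on S (\<lambda>x. pd ds \<phi> s x)" for S ds s by (rule smooth2_continuous_x[OF \<phi>])
  have pm: "(\<lambda>s. fmode (pd ds \<phi> s) n) \<in> borel_measurable borel" for ds n
    by (intro borel_measurable_continuous_onI continuous_fmode \<phi>)
  have pb: "\<exists>C. \<forall>s\<in>{0<..t}. \<forall>n. norm (fmode (pd ds \<phi> s) n) \<le> C" for ds
  proof -
    obtain C where C: "\<And>s x. s \<in> {0..t} \<Longrightarrow> x \<in> {0..2*pi} \<Longrightarrow> \<bar>pd ds \<phi> s x\<bar> \<le> C"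
      using smooth2_bound[OF \<phi>] by metis
    have "norm (fmode (pd ds \<phi> s) n) \<le> 2 * pi * C" if "s \<in> {0<..t}" for s n
      by (rule norm_fmode_le) (use C that in \<open>auto intro: cont\<close>)
    then show ?thesis by blast
  qed
  obtain C1 C2 C3 where C: "\<And>s n. s \<in> {0<..t} \<Longrightarrow> norm (?Pt s n) \<le> C1" "\<And>s n. s \<in> {0<..t} \<Longrightarrow> norm (?Px s n) \<le> C2"
    "\<And>s n. s \<in> {0<..t} \<Longrightarrow> norm (?Pxx s n) \<le> C3"
    using pb by meson
  have dm0: "esum (\<lambda>n. norm (dm 0 s n)) \<le> ennreal 1 * norm4 s" if "0 \<le> s" for s
    using esum_dm_le[of 0 s] by simp
  note I1 = modes_Fubini[of "dm 0" ?Pt, OF measurable_dm pm C(1) fin_flux[OF t dm0]]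
  note I2 = modes_Fubini[of "q1 1" ?Px, OF measurable_q1 pm C(2) fin_flux[OF t esum_q1_le]]
  note I3 = modes_Fubini[of "q1 3" ?Px, OF measurable_q1 pm C(2) fin_flux[OF t esum_q1_le]]
  note I4 = modes_Fubini[of q2 ?Pxx, OF measurable_q2 pm C(3) fin_flux[OF t esum_q2_le]]
  let ?i1 = "\<lambda>n. sint {0<..t} (\<lambda>s. dm 0 s n * ?Pt s n)"
  let ?i2 = "\<lambda>n. sint {0<..t} (\<lambda>s. q1 1 s n * ?Px s n)"
  let ?i3 = "\<lambda>n. sint {0<..t} (\<lambda>s. q1 3 s n * ?Px s n)"
  let ?i4 = "\<lambda>n. sint {0<..t} (\<lambda>s. q2 s n * ?Pxx s n)"
  \<comment> \<open>The integral is split into four parts, each integrable on its own, so that they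
    can be summed separately.\<close>
  have modes: "sol t n * fmode (\<phi> t) n - A n * fmode (\<phi> 0) n = ?i1 n + ?i2 n + of_real al * ?i3 n - of_real be * ?i4 n" for n
  proof -
    have "sol t n * fmode (\<phi> t) n - A n * fmode (\<phi> 0) n = (\<integral>s. indicator {0<..t} s * (dm 0 s n * ?Pt s n)
        + indicator {0<..t} s * (q1 1 s n * ?Px s n) + of_real al * (indicator {0<..t} s * (q1 3 s n * ?Px s n))
        - of_real be * (indicator {0<..t} s * (q2 s n * ?Pxx s n)) \<partial>lborel)"
      unfolding mode_identity[OF t \<phi>]
    proof (intro Bochner_Integration.integral_cong refl)
      fix s
      show "indicator {0<..t} s * (NN (sol s) n * fmode (\<phi> s) n + sol s n * (?Pt s n - of_real (lam n) * fmode (\<phi> s) n))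
        = indicator {0<..t} s * (dm 0 s n * ?Pt s n)
        + indicator {0<..t} s * (q1 1 s n * ?Px s n) + of_real al * (indicator {0<..t} s * (q1 3 s n * ?Px s n))
        - of_real be * (indicator {0<..t} s * (q2 s n * ?Pxx s n))"
      proof (cases "s \<in> {0<..t}")
        case True
        then have "NN (sol s) n * fmode (\<phi> s) n - of_real (lam n) * (sol s n * fmode (\<phi> s) n) =
          q1 1 s n * ?Px s n + of_real al * (q1 3 s n * ?Px s n) - of_real be * (q2 s n * ?Pxx s n)"
          unfolding fmode_pd_x[where \<phi>=\<phi>, OF \<phi> per] by (intro NN_flux) simp
        then show ?thesis using True by (simp add: dm_0 algebra_simps del: pd.simps)
      qed (simp del: pd.simps)
    qed
    also have "\<dots> = ?i1 n + ?i2 n + of_real al * ?i3 n - of_real be * ?i4 n"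
      using I1(1) I2(1) I3(1) I4(1) by (simp del: pd.simps)
    finally show ?thesis .
  qed
  have a: "zsummable (sol t)" and A: "zsummable A" and c0: "continuous_on {0..2*pi} (\<phi> s)" for s
    using zsummable_sol[OF t] summable_A cont[of _ "[]" s] by auto
  have "complex_of_real ?L - of_real ?B = zsum (\<lambda>n. sol t n * fmode (\<phi> t) n) - zsum (\<lambda>n. A n * fmode (\<phi> 0) n)"
    using dm_pairing[OF disjI2[OF conjI[OF t refl]] c0[of t]]
      dm_pairing[OF disjI2[OF conjI[OF order_refl refl]] c0[of 0]]
    by (simp only: dm_0 sol_0)
  also have "\<dots> = zsum (\<lambda>n. sol t n * fmode (\<phi> t) n - A n * fmode (\<phi> 0) n)"
    by (intro Bochner_Integration.integral_diff[symmetric] zsummable_mult_fmode a A c0)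
  also have "\<dots> = zsum ?i1 + zsum ?i2 + of_real al * zsum ?i3 - of_real be * zsum ?i4"
    unfolding modes using I1(2) I2(2) I3(2) I4(2) by (simp del: pd.simps)
  also have "zsum ?i1 = of_real ?T"
    by (rule trans[OF I1(3) integral_Ioc_of_real])
       (auto intro!: borel_measurable_times measurable_der measurable_pd[OF \<phi>] dm_pairing cont simp del: pd.simps)
  also have "zsum ?i2 = of_real ?F1"
    by (rule trans[OF I2(3) integral_Ioc_of_real])
       (auto intro!: borel_measurable_times borel_measurable_add borel_measurable_const measurable_der measurable_pd[OF \<phi>] flux_pairing cont simp del: pd.simps)
  also have "zsum ?i3 = of_real ?F3"
    by (rule trans[OF I3(3) integral_Ioc_of_real])
       (auto intro!: borel_measurable_times borel_measurable_add borel_measurable_const measurable_der measurable_pd[OF \<phi>] flux_pairing cont simp del: pd.simps)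
  also have "zsum ?i4 = of_real ?F2"
    by (rule trans[OF I4(3) integral_Ioc_of_real])
       (auto intro!: borel_measurable_times borel_measurable_power borel_measurable_add borel_measurable_const measurable_der measurable_pd[OF \<phi>] flux_pairing cont simp del: pd.simps)
  finally have "complex_of_real (?L - ?B) = of_real (?T + ?F1 + al * ?F3 - be * ?F2)"
    by (simp del: pd.simps)
  then have "?L - ?B = ?T + ?F1 + al * ?F3 - be * ?F2" by (simp only: of_real_eq_iff)
  then show ?thesis by simp
qed

end

section \<open>Wiener norms and conclusion\<close>

text \<open>Links the unconditional sums in the definition of the Wiener spaces with the extended
  sums of the estimates. If the sum diverges, both real values are 0 by convention.\<close>

lemma infsum_enn2real:
  fixes f :: "int \<Rightarrow> real"
  assumes nn: "\<And>n. 0 \<le> f n"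
  shows "f summable_on UNIV \<longleftrightarrow> esum (\<lambda>n. ennreal (f n)) < \<infinity>"
    and "infsum f UNIV = enn2real (esum (\<lambda>n. ennreal (f n)))"
proof -
  have "f summable_on UNIV \<longleftrightarrow> zsummable f"
    using abs_summable_equivalent[of f UNIV] nn by (simp add: abs_summable_on_def)
  then show 1: "f summable_on UNIV \<longleftrightarrow> esum (\<lambda>n. ennreal (f n)) < \<infinity>"
    using nn by (simp add: zsummable_iff)
  show "infsum f UNIV = enn2real (esum (\<lambda>n. ennreal (f n)))"
  proof (cases "f summable_on UNIV")
    case True
    then have z: "Infinite_Set_Sum.abs_summable_on f UNIV" "zsummable f"
      using \<open>f summable_on UNIV \<longleftrightarrow> zsummable f\<close> by (simp_all add: abs_summable_on_def)
    have "infsum f UNIV = infsetsum f UNIV"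
      by (rule infsetsum_infsum[symmetric]) (rule z)
    also have "\<dots> = zsum f" by (simp add: infsetsum_def)
    also have "\<dots> = enn2real (esum (\<lambda>n. ennreal (f n)))"
      by (rule integral_eq_nn_integral) (use nn in auto)
    finally show ?thesis .
  next
    case False
    then have "esum (\<lambda>n. ennreal (f n)) = top" using 1 by (metis infinity_ennreal_def top.not_eq_extremum)
    then show ?thesis using infsum_not_exists[OF False] by simp
  qed
qed

lemma hermit_fcoeff: "hermit (fcoeff f)"
  unfolding hermit_def
proof
  fix n
  let ?h = "\<lambda>n x. indicator {0..2*pi} x *\<^sub>R (complex_of_real (f x) * cis (- (of_int n * x)))"
  have "?h (- n) x = cnj (?h n x)" for x by (simp add: cis_cnj)
  then have "(\<integral>x. ?h (- n) x \<partial>lborel) = cnj (\<integral>x. ?h n x \<partial>lborel)"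
    by (simp only: Bochner_Integration.integral_cnj)
  then show "fcoeff f (- n) = cnj (fcoeff f n)"
    by (simp add: fcoeff_def set_lebesgue_integral_def)
qed

lemma fcoeff_diff:
  assumes "set_integrable lborel {0..2*pi} f" "set_integrable lborel {0..2*pi} g"
  shows "fcoeff (\<lambda>x. f x - g x) n = fcoeff f n - fcoeff g n"
proof -
  have c: "continuous_on {0..2*pi} (\<lambda>x. cis (- (of_int n * x)))" by (intro continuous_intros)
  show ?thesis
    using set_integral_diff(2)[OF set_integrable_of_real_mult[OF assms(1) c] set_integrable_of_real_mult[OF assms(2) c]]
    by (simp add: fcoeff_def left_diff_distrib right_diff_distrib)
qed

context thin_film
begin

lemma set_integrable_der_0:
  assumes t: "0 \<le> t"
  shows "set_integrable lborel {0..2*pi} (der 0 t)"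
proof -
  have [measurable]: "der 0 t \<in> borel_measurable borel"
    using measurable_compose[OF measurable_Pair1'[of t borel borel] measurable_der[of 0, folded borel_prod]]
    by (simp add: borel_prod)
  show ?thesis
    unfolding set_integrable_def
    by (rule integrableI_bounded_set_indicator[where B=M0]) (use abs_der_0_le[OF t] in auto)
qed

lemma fcoeff_der_0: "0 \<le> t \<Longrightarrow> fcoeff (der 0 t) n = sol t n"
  unfolding der_def[abs_def] dm_0 by (rule fcoeff_synth[OF zsummable_sol hermit_sol])

lemma wnorm_der_0:
  assumes t: "0 \<le> t"
  shows "wiener_in r l (der 0 t) \<longleftrightarrow> esum (\<lambda>n. ennreal ((1 + \<bar>of_int n\<bar>) powr r * exp (l * \<bar>of_int n\<bar>) * norm (sol t n))) < \<infinity>"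
    and "wnorm r l (der 0 t) = enn2real (esum (\<lambda>n. ennreal ((1 + \<bar>of_int n\<bar>) powr r * exp (l * \<bar>of_int n\<bar>) * norm (sol t n))))"
  unfolding wiener_in_def wnorm_def fcoeff_der_0[OF t]
  by (subst infsum_enn2real; simp add: per_der set_integrable_der_0[OF t])+

text \<open>\<open>e0\<close> and \<open>e4\<close> are the Wiener norms of orders 0 and 4 with
  radius \<open>\<nu> * t\<close>, taken in \<open>[0, \<infinity>]\<close> so that membership means
  finiteness.\<close>

definition e0 :: "real \<Rightarrow> real \<Rightarrow> ennreal" where
  "e0 \<nu> t = esum (\<lambda>n. ennreal (exp (\<nu> * t * \<bar>of_int n\<bar>) * norm (sol t n)))"

definition e4 :: "real \<Rightarrow> real \<Rightarrow> ennreal" where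
  "e4 \<nu> t = esum (\<lambda>n. ennreal ((1 + \<bar>of_int n\<bar>) ^ 4 * exp (\<nu> * t * \<bar>of_int n\<bar>) * norm (sol t n)))"

lemma measurable_e4: "e4 \<nu> \<in> borel_measurable borel"
  unfolding e4_def using measurable_sol by (intro measurable_esum) simp

lemma wiener_der_0:
  assumes t: "0 \<le> t"
  shows "wiener_in 0 (\<nu> * t) (der 0 t) \<longleftrightarrow> e0 \<nu> t < \<infinity>" "wnorm 0 (\<nu> * t) (der 0 t) = enn2real (e0 \<nu> t)"
    "wiener_in 4 (\<nu> * t) (der 0 t) \<longleftrightarrow> e4 \<nu> t < \<infinity>" "wnorm 4 (\<nu> * t) (der 0 t) = enn2real (e4 \<nu> t)"
proof -
  have "(1 + \<bar>real_of_int n\<bar>) powr 0 = 1" "(1 + \<bar>real_of_int n\<bar>) powr 4 = (1 + \<bar>real_of_int n\<bar>) ^ 4" for n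
    by (simp_all add: powr_numeral add_pos_nonneg)
  then show "wiener_in 0 (\<nu> * t) (der 0 t) \<longleftrightarrow> e0 \<nu> t < \<infinity>" "wnorm 0 (\<nu> * t) (der 0 t) = enn2real (e0 \<nu> t)"
    "wiener_in 4 (\<nu> * t) (der 0 t) \<longleftrightarrow> e4 \<nu> t < \<infinity>" "wnorm 4 (\<nu> * t) (der 0 t) = enn2real (e4 \<nu> t)"
    unfolding wnorm_der_0[OF t] e0_def e4_def by simp_all
qed

lemma weight_le:
  assumes \<nu>: "\<nu> \<le> d / 2" and t: "0 \<le> t"
  shows "exp (\<nu> * t * \<bar>of_int n\<bar>) * exp (d / 64 * t) \<le> exp (th n * t)"
    "ennreal (exp (\<nu> * t * \<bar>of_int n\<bar>)) \<le> W t n"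
proof -
  have "\<nu> * (t * \<bar>of_int n\<bar>) \<le> d / 2 * (t * \<bar>of_int n\<bar>)"
    by (rule mult_right_mono[OF \<nu>]) (use t in simp)
  then have "\<nu> * t * \<bar>of_int n\<bar> + d / 64 * t \<le> th n * t"
    by (simp add: th_def algebra_simps)
  then show 1: "exp (\<nu> * t * \<bar>of_int n\<bar>) * exp (d / 64 * t) \<le> exp (th n * t)"
    by (simp flip: exp_add)
  have "exp (\<nu> * t * \<bar>of_int n\<bar>) * 1 \<le> exp (\<nu> * t * \<bar>of_int n\<bar>) * exp (d / 64 * t)"
    using d_pos t by (intro mult_left_mono) auto
  then show "ennreal (exp (\<nu> * t * \<bar>of_int n\<bar>)) \<le> W t n"
    unfolding W_def using 1 by (intro ennreal_leI) linarith
qed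

text \<open>No differential inequality is involved: the decay factor is part of the weight and is
  divided out of the uniform bound.\<close>

lemma e0_decay:
  assumes \<nu>: "\<nu> \<le> d / 2" and t: "0 \<le> t"
  shows "ennreal (exp (d / 64 * t)) * e0 \<nu> t \<le> wsum 0 (W t) (mlim t)"
proof -
  have "ennreal (exp (d / 64 * t)) * e0 \<nu> t = esum (\<lambda>n. ennreal (exp (d / 64 * t)) * ennreal (exp (\<nu> * t * \<bar>of_int n\<bar>) * norm (sol t n)))"
    by (simp add: e0_def nn_integral_cmult)
  also have "\<dots> \<le> wsum 0 (W t) (mlim t)"
    unfolding wsum_def
  proof (intro nn_integral_mono)
    fix n
    have "ennreal (exp (d / 64 * t)) * ennreal (exp (\<nu> * t * \<bar>of_int n\<bar>) * norm (sol t n))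
      = ennreal (exp (\<nu> * t * \<bar>of_int n\<bar>) * exp (d / 64 * t)) * ennreal (norm (sol t n))"
      by (simp add: ennreal_mult mult_ac)
    also have "\<dots> \<le> W t n * mlim t n"
      unfolding W_def by (intro mult_mono ennreal_leI weight_le \<nu> t norm_sol_le) auto
    finally show "ennreal (exp (d / 64 * t)) * ennreal (exp (\<nu> * t * \<bar>of_int n\<bar>) * norm (sol t n))
      \<le> ennreal (\<bar>of_int n\<bar> ^ 0) * (W t n * mlim t n)" by simp
  qed
  finally show ?thesis .
qed

lemma e0_le:
  assumes \<nu>: "\<nu> \<le> d / 2" and t: "0 \<le> t"
  shows "e0 \<nu> t \<le> wsum 0 (W t) (mlim t)"
proof -
  have "1 * e0 \<nu> t \<le> ennreal (exp (d / 64 * t)) * e0 \<nu> t"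
    using d_pos t by (intro mult_right_mono) auto
  also note e0_decay[OF \<nu> t]
  finally show ?thesis by simp
qed

text \<open>The factor 16 from \<open>esum_weight4_le\<close> turns the constant
  \<open>d / 64\<close> into \<open>16 / 64 * d\<close>, which the available
  \<open>29 / 64 * d\<close> covers.\<close>

lemma e4_energy:
  assumes \<nu>: "\<nu> \<le> d / 2" and t: "0 \<le> t"
  shows "e0 \<nu> t + ennreal (d / 64) * esint {0..t} (\<lambda>s. e4 \<nu> s) \<le> ennreal M0"
proof -
  have "esint {0..t} (\<lambda>s. e4 \<nu> s) \<le> (\<integral>\<^sup>+s. 16 * (indicator {0..t} s * wsum 4 (W s) (mlim s)) \<partial>lborel)"
  proof (intro nn_integral_mono)
    fix s
    have "e4 \<nu> s \<le> 16 * wsum 4 (W s) (mlim s)" if "0 \<le> s"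
      unfolding e4_def by (rule esum_weight4_le[OF that weight_le(2)[OF \<nu> that]]) simp
    then show "indicator {0..t} s * e4 \<nu> s \<le> 16 * (indicator {0..t} s * wsum 4 (W s) (mlim s))"
      by (auto simp: indicator_def)
  qed
  also have "\<dots> = 16 * diss mlim t"
    unfolding diss_def
    by (rule nn_integral_cmult) (auto intro!: borel_measurable_times_ennreal measurable_wsum simp: measurable_mlim measurable_W)
  finally have "ennreal (d / 64) * esint {0..t} (\<lambda>s. e4 \<nu> s) \<le> ennreal (d / 64) * (ennreal 16 * diss mlim t)"
    by (intro mult_left_mono) simp_all
  also have "\<dots> = ennreal (d / 64 * 16) * diss mlim t"
  proof -
    have "ennreal (d / 64 * 16) = ennreal (d / 64) * ennreal 16" by (rule ennreal_mult) (use d_pos in auto)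
    then show ?thesis by (simp only: mult.assoc)
  qed
  also have "\<dots> \<le> ennreal (29 / 64 * d) * diss mlim t"
    using d_pos by (intro mult_right_mono ennreal_leI) auto
  finally show ?thesis
    by (intro order.trans[OF add_mono[OF e0_le[OF \<nu> t]] energy_mlim[OF t]])
qed

lemma wiener_bounds:
  assumes \<nu>: "\<nu> < d / 2" and T: "0 < T"
  shows "\<forall>t\<in>{0..T}. wiener_in 0 (\<nu> * t) (der 0 t)"
    and "bdd_above ((\<lambda>t. wnorm 0 (\<nu> * t) (der 0 t)) ` {0..T})"
    and "AE t in lborel. t \<in> {0..T} \<longrightarrow> wiener_in 4 (\<nu> * t) (der 0 t)"
    and "set_integrable lborel {0..T} (\<lambda>t. wnorm 4 (\<nu> * t) (der 0 t))"
    and "\<forall>t\<in>{0..T}. wnorm 0 (\<nu> * t) (der 0 t) + d / 64 * (LINT s:{0..t}|lborel. wnorm 4 (\<nu> * s) (der 0 s)) \<le> M0 \<and>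
      wnorm 0 (\<nu> * t) (der 0 t) \<le> M0 * exp (- (t / 64) * d)"
    (is "\<forall>t\<in>_. ?E t \<and> ?D t")
proof -
  have \<nu>': "\<nu> \<le> d / 2" using \<nu> by simp
  note [measurable] = measurable_e4
  have e0M: "e0 \<nu> t \<le> ennreal M0" if "0 \<le> t" for t
    by (rule order.trans[OF e0_le[OF \<nu>' that] wsum_mlim_le[OF that]])
  have e0f: "e0 \<nu> t < \<infinity>" if "0 \<le> t" for t
    by (rule le_less_trans[OF e0M[OF that]]) simp
  have e4f: "esint {0..t} (\<lambda>s. e4 \<nu> s) < \<infinity>" if "0 \<le> t" for t
  proof -
    have "ennreal (d / 64) * esint {0..t} (\<lambda>s. e4 \<nu> s) \<le> ennreal M0"
      by (rule order.trans[OF _ e4_energy[OF \<nu>' that]]) simp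
    then have "ennreal (d / 64) * esint {0..t} (\<lambda>s. e4 \<nu> s) < \<infinity>"
      by (rule le_less_trans) simp
    then show ?thesis using d_pos by (auto simp: ennreal_mult_less_top)
  qed
  \<comment> \<open>At the possible times where \<open>e4\<close> is infinite,
    \<open>enn2real\<close> returns 0, so the real norm never exceeds the extended one.\<close>
  have le4: "ennreal (indicator {0..t} s * enn2real (e4 \<nu> s)) \<le> indicator {0..t} s * e4 \<nu> s" for t s :: real
    by (cases "e4 \<nu> s = top") (auto simp: indicator_def less_top)
  show "\<forall>t\<in>{0..T}. wiener_in 0 (\<nu> * t) (der 0 t)"
    using e0f by (simp add: wiener_der_0)
  have w0: "wnorm 0 (\<nu> * t) (der 0 t) = enn2real (e0 \<nu> t)" if "0 \<le> t" for t
    by (rule wiener_der_0(2)[OF that])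
  show "bdd_above ((\<lambda>t. wnorm 0 (\<nu> * t) (der 0 t)) ` {0..T})"
  proof (rule bdd_aboveI2)
    fix t assume "t \<in> {0..T}"
    then have t: "0 \<le> t" by simp
    have "enn2real (e0 \<nu> t) \<le> enn2real (ennreal M0)"
      by (rule enn2real_mono[OF e0M[OF t]]) simp
    then show "wnorm 0 (\<nu> * t) (der 0 t) \<le> M0" using M0_nonneg by (simp add: w0[OF t])
  qed
  have "AE t in lborel. indicator {0..T} t * e4 \<nu> t \<noteq> \<infinity>"
    by (rule nn_integral_PInf_AE) (use e4f[of T] T in auto)
  then show "AE t in lborel. t \<in> {0..T} \<longrightarrow> wiener_in 4 (\<nu> * t) (der 0 t)"
    by eventually_elim (auto simp: wiener_der_0 less_top)
  have c4: "indicator {0..t} s *\<^sub>R wnorm 4 (\<nu> * s) (der 0 s) = indicator {0..t} s * enn2real (e4 \<nu> s)" for t s :: real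
    by (auto simp: indicator_def wiener_der_0)
  show "set_integrable lborel {0..T} (\<lambda>t. wnorm 4 (\<nu> * t) (der 0 t))"
    unfolding set_integrable_def c4
  proof (rule integrableI_bounded)
    have "(\<integral>\<^sup>+s. ennreal (norm (indicator {0..T} s * enn2real (e4 \<nu> s))) \<partial>lborel) \<le> esint {0..T} (\<lambda>s. e4 \<nu> s)"
      by (intro nn_integral_mono) (use le4 in simp)
    also have "\<dots> < \<infinity>" using e4f T by simp
    finally show "(\<integral>\<^sup>+s. ennreal (norm (indicator {0..T} s * enn2real (e4 \<nu> s))) \<partial>lborel) < \<infinity>" .
  qed measurable
  show "\<forall>t\<in>{0..T}. ?E t \<and> ?D t"
  proof
    fix t assume "t \<in> {0..T}"
    then have t: "0 \<le> t" by simp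
    let ?J = "esint {0..t} (\<lambda>s. e4 \<nu> s)"
    have "(LINT s:{0..t}|lborel. wnorm 4 (\<nu> * s) (der 0 s)) = enn2real (\<integral>\<^sup>+s. ennreal (indicator {0..t} s * enn2real (e4 \<nu> s)) \<partial>lborel)"
      unfolding set_lebesgue_integral_def c4 by (rule integral_eq_nn_integral) auto
    also have "\<dots> \<le> enn2real ?J"
      by (intro enn2real_mono nn_integral_mono le4) (use e4f[OF t] in simp)
    finally have J: "(LINT s:{0..t}|lborel. wnorm 4 (\<nu> * s) (der 0 s)) \<le> enn2real ?J" .
    have "ennreal (enn2real (e0 \<nu> t) + d / 64 * enn2real ?J) = e0 \<nu> t + ennreal (d / 64) * ?J"
    proof -
      have "ennreal (x + c * y) = ennreal x + ennreal c * ennreal y" if "0 \<le> x" "0 \<le> c" "0 \<le> y" for x c y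
        using that by (simp add: ennreal_mult)
      from this[of "enn2real (e0 \<nu> t)" "d / 64" "enn2real ?J"] show ?thesis
        using e0f[OF t] e4f[OF t] d_pos by (simp only: ennreal_enn2real infinity_ennreal_def) simp
    qed
    also have "\<dots> \<le> ennreal M0" by (rule e4_energy[OF \<nu>' t])
    finally have "enn2real (e0 \<nu> t) + d / 64 * enn2real ?J \<le> M0"
      by (subst (asm) ennreal_le_iff) (rule M0_nonneg)
    moreover have "d / 64 * (LINT s:{0..t}|lborel. wnorm 4 (\<nu> * s) (der 0 s)) \<le> d / 64 * enn2real ?J"
      using J d_pos by (intro mult_left_mono) auto
    ultimately have 1: "?E t"
      unfolding w0[OF t] by linarith
    have "ennreal (exp (d / 64 * t) * enn2real (e0 \<nu> t)) = ennreal (exp (d / 64 * t)) * e0 \<nu> t"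
      using e0f[OF t] by (simp add: ennreal_mult)
    also have "\<dots> \<le> ennreal M0" by (rule order.trans[OF e0_decay[OF \<nu>' t] wsum_mlim_le[OF t]])
    finally have "exp (d / 64 * t) * enn2real (e0 \<nu> t) \<le> M0"
      by (subst (asm) ennreal_le_iff) (rule M0_nonneg)
    from mult_left_mono[OF this exp_ge_zero[of "- (t / 64) * d"]]
    have "(exp (- (t / 64) * d) * exp (d / 64 * t)) * enn2real (e0 \<nu> t) \<le> M0 * exp (- (t / 64) * d)"
      by (simp only: mult_ac)
    moreover have "exp (- (t / 64) * d) * exp (d / 64 * t) = 1" by (simp flip: exp_add)
    ultimately have 2: "?D t"
      unfolding w0[OF t] by (simp only: mult_1_left)
    show "?E t \<and> ?D t"
      using 1 2 by (rule conjI)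
  qed
qed

text \<open>The series at time 0 has the Fourier coefficients of \<open>\<zeta>0\<close>, so both
  agree almost everywhere by \<open>fourier_uniqueness\<close>. That suffices for the boundedness of
  the datum and for the initial term.\<close>

lemma weak_solution:
  assumes per0: "per \<zeta>0" and int0: "set_integrable lborel {0..2*pi} \<zeta>0" and A: "\<And>n. fcoeff \<zeta>0 n = A n"
    and al_eq: "al = sqrt \<mu> / bo" and be_eq: "be = \<mu> / 3" and T: "0 < T"
  shows "weak_sol eps \<mu> bo T \<zeta>0 (der 0)"
proof -
  have eq0: "AE x in lborel. x \<in> {0..2*pi} \<longrightarrow> \<zeta>0 x - der 0 0 x = 0"
  proof (rule fourier_uniqueness)
    show "set_integrable lborel {0..2*pi} (\<lambda>x. \<zeta>0 x - der 0 0 x)"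
      by (intro set_integral_diff int0 set_integrable_der_0) simp
    show "fcoeff (\<lambda>x. \<zeta>0 x - der 0 0 x) n = 0" for n
      by (subst fcoeff_diff[OF int0 set_integrable_der_0]) (simp_all add: A fcoeff_der_0 sol_0)
  qed
  have bdd0: "AE x in lborel. x \<in> {0..2*pi} \<longrightarrow> \<bar>\<zeta>0 x\<bar> \<le> M0"
    using eq0 by eventually_elim (use abs_der_0_le[of 0] in auto)
  let ?g = "\<lambda>s. enn2real (norm4 s)"
  have g: "set_integrable lborel {0..T} ?g"
    unfolding set_integrable_def
  proof (rule integrableI_bounded)
    have "ennreal (norm (indicator {0..T} s *\<^sub>R ?g s)) \<le> indicator {0..T} s * norm4 s" for s
      by (cases "norm4 s = top") (auto simp: indicator_def less_top)
    then have "(\<integral>\<^sup>+s. ennreal (norm (indicator {0..T} s *\<^sub>R ?g s)) \<partial>lborel) \<le> esint {0..T} (\<lambda>s. norm4 s)"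
      by (intro nn_integral_mono)
    also have "\<dots> < \<infinity>" using nn_integral_norm4_finite T by simp
    finally show "(\<integral>\<^sup>+s. ennreal (norm (indicator {0..T} s *\<^sub>R ?g s)) \<partial>lborel) < \<infinity>" .
  qed measurable
  have AEt: "AE t in lborel. t \<in> {0..T} \<longrightarrow>
      weak_deriv (der 0 t) (der 1 t) \<and> weak_deriv (der 1 t) (der 2 t) \<and> weak_deriv (der 2 t) (der 3 t) \<and>
      (AE x in lborel. x \<in> {0..2*pi} \<longrightarrow>
         \<bar>der 0 t x\<bar> \<le> ?g t \<and> \<bar>der 1 t x\<bar> \<le> ?g t \<and> \<bar>der 2 t x\<bar> \<le> ?g t \<and> \<bar>der 3 t x\<bar> \<le> ?g t)"
    \<comment> \<open>Time 0 is discarded, since summability of the derivatives is guaranteed for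
      positive times only.\<close>
    using AE_lborel_singleton[of 0]
  proof eventually_elim
    case (elim t)
    then have t: "0 < t" if "t \<in> {0..T}" using that by auto
    have "weak_deriv (der 0 t) (der 1 t)" "weak_deriv (der 1 t) (der 2 t)" "weak_deriv (der 2 t) (der 3 t)" if "t \<in> {0..T}"
      using weak_deriv_der[OF t[OF that], of 0] weak_deriv_der[OF t[OF that], of 1] weak_deriv_der[OF t[OF that], of 2]
      by (simp_all add: numeral_2_eq_2 numeral_3_eq_3)
    then show ?case using abs_der_le[OF t] by simp
  qed
  have init: "(LINT x:{0..2*pi}|lborel. \<zeta>0 x * \<phi> 0 x) = (LINT x:{0..2*pi}|lborel. der 0 0 x * \<phi> 0 x)"
    if \<phi>: "smooth2 \<phi>" for \<phi>
    unfolding set_lebesgue_integral_def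
  proof (rule integral_cong_AE)
    have [measurable]: "\<phi> 0 \<in> borel_measurable borel"
      using smooth2_continuous_x[OF \<phi>, of UNIV "[]" 0] by (intro borel_measurable_continuous_onI) simp
    have [measurable]: "(\<lambda>x. indicator {0..2*pi} x *\<^sub>R \<zeta>0 x) \<in> borel_measurable borel"
      "(\<lambda>x. indicator {0..2*pi} x *\<^sub>R der 0 0 x) \<in> borel_measurable borel"
      using int0 set_integrable_der_0[of 0] by (auto simp: set_integrable_def)
    have "(\<lambda>x. (indicator {0..2*pi} x *\<^sub>R \<zeta>0 x) * \<phi> 0 x) \<in> borel_measurable lborel"
      "(\<lambda>x. (indicator {0..2*pi} x *\<^sub>R der 0 0 x) * \<phi> 0 x) \<in> borel_measurable lborel"
      by measurable
    then show "(\<lambda>x. indicator {0..2*pi} x *\<^sub>R (\<zeta>0 x * \<phi> 0 x)) \<in> borel_measurable lborel"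
      "(\<lambda>x. indicator {0..2*pi} x *\<^sub>R (der 0 0 x * \<phi> 0 x)) \<in> borel_measurable lborel"
      by (simp_all only: real_scaleR_def mult.assoc)
    show "AE x in lborel. indicator {0..2*pi} x *\<^sub>R (\<zeta>0 x * \<phi> 0 x) = indicator {0..2*pi} x *\<^sub>R (der 0 0 x * \<phi> 0 x)"
      using eq0 by eventually_elim (auto simp: indicator_def)
  qed
  have weak: "(LINT x:{0..2*pi}|lborel. der 0 t x * \<phi> t x)
          - (LINT x:{0..2*pi}|lborel. \<zeta>0 x * \<phi> 0 x)
          - (LINT s:{0..t}|lborel. LINT x:{0..2*pi}|lborel. der 0 s x * pd [True] \<phi> s x)
          = (LINT s:{0..t}|lborel. LINT x:{0..2*pi}|lborel. (1 + eps * der 0 s x) * der 1 s x * pd [False] \<phi> s x)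
            + sqrt \<mu> / bo * (LINT s:{0..t}|lborel. LINT x:{0..2*pi}|lborel. (1 + eps * der 0 s x) * der 3 s x * pd [False] \<phi> s x)
            - \<mu> / 3 * (LINT s:{0..t}|lborel. LINT x:{0..2*pi}|lborel. (1 + eps * der 0 s x) ^ 3 * der 2 s x * pd [False, False] \<phi> s x)"
    if "smooth2 \<phi> \<and> (\<forall>t x. \<phi> t (x + 2*pi) = \<phi> t x)" "t \<in> {0..T}" for \<phi> t
    using that unfolding init[OF conjunct1[OF that(1)]] al_eq[symmetric] be_eq[symmetric]
    by (intro weak_form) auto
  show ?thesis
    unfolding weak_sol_def
  proof (rule conjI[OF per0], rule conjI, rule exI[of _ M0], rule bdd0, rule exI[of _ "der 1"],
      rule exI[of _ "der 2"], rule exI[of _ "der 3"], rule exI[of _ ?g], rule exI[of _ M0],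
      intro conjI allI impI ballI per_der measurable_der g AEt weak)
    show "AE p in lborel. p \<in> {0..T} \<times> {0..2*pi} \<longrightarrow> \<bar>der 0 (fst p) (snd p)\<bar> \<le> M0"
      using abs_der_0_le by (intro AE_I2) auto
  qed auto
qed

end

theorem theorem4p6:
  fixes \<epsilon> :: real
  assumes "0 < \<epsilon>" and "\<epsilon> \<le> 1"
  shows "\<exists>bo0>0. \<forall>bo \<mu> (\<zeta>0 :: real \<Rightarrow> real).
    0 < bo \<and> bo < bo0 \<and> 0 < \<mu> \<and> \<mu> < 1 \<and> sqrt \<mu> / bo + \<mu> / 3 > 1 \<and>
    wiener_in 0 0 \<zeta>0 \<and> fcoeff \<zeta>0 0 = 0 \<and>
    wnorm 0 0 \<zeta>0 < (sqrt \<mu> / bo + \<mu> / 3 - 1) / (128 * \<epsilon> * (sqrt \<mu> / bo + 55 / 6 * \<mu> + 1))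
    \<longrightarrow>
    (\<exists>\<zeta> :: real \<Rightarrow> real \<Rightarrow> real.
      (\<forall>T>0. weak_sol \<epsilon> \<mu> bo T \<zeta>0 \<zeta>) \<and>
      (\<forall>\<nu> T. 0 \<le> \<nu> \<and> \<nu> < (sqrt \<mu> / bo + \<mu> / 3 - 1) / 2 \<and> 0 < T \<longrightarrow>
         (\<forall>t\<in>{0..T}. wiener_in 0 (\<nu> * t) (\<zeta> t)) \<and>
         bdd_above ((\<lambda>t. wnorm 0 (\<nu> * t) (\<zeta> t)) ` {0..T}) \<and>
         (AE t in lborel. t \<in> {0..T} \<longrightarrow> wiener_in 4 (\<nu> * t) (\<zeta> t)) \<and>
         set_integrable lborel {0..T} (\<lambda>t. wnorm 4 (\<nu> * t) (\<zeta> t)) \<and>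
         (\<forall>t\<in>{0..T}.
            wnorm 0 (\<nu> * t) (\<zeta> t)
              + (sqrt \<mu> / bo + \<mu> / 3 - 1) / 64 * (LINT s:{0..t}|lborel. wnorm 4 (\<nu> * s) (\<zeta> s))
              \<le> wnorm 0 0 \<zeta>0 \<and>
            wnorm 0 (\<nu> * t) (\<zeta> t)
              \<le> wnorm 0 0 \<zeta>0 * exp (- (t / 64) * (sqrt \<mu> / bo + \<mu> / 3 - 1)))))"
proof (rule exI[of _ 1], intro conjI allI impI zero_less_one, elim conjE, goal_cases)
  case (1 bo \<mu> \<zeta>0)
  note bo = 1(1) and \<mu> = 1(3) and gt1 = 1(5) and W0 = 1(6) and mean = 1(7) and small = 1(8)
  define \<alpha> where "\<alpha> = sqrt \<mu> / bo"
  have \<alpha>: "0 \<le> \<alpha>" using bo \<mu> by (simp add: \<alpha>_def)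
  have e: "(\<lambda>n::int. (1 + \<bar>real_of_int n\<bar>) powr 0 * exp (0 * \<bar>real_of_int n\<bar>) * cmod (fcoeff \<zeta>0 n)) = (\<lambda>n. cmod (fcoeff \<zeta>0 n))"
    by (auto simp: fun_eq_iff)
  have "(\<lambda>n. cmod (fcoeff \<zeta>0 n)) summable_on UNIV" using W0 unfolding wiener_in_def e by simp
  then have sum: "zsummable (fcoeff \<zeta>0)"
    by (subst (asm) infsum_enn2real) (simp_all add: zsummable_iff)
  have "wnorm 0 0 \<zeta>0 = enn2real (esum (\<lambda>n. ennreal (cmod (fcoeff \<zeta>0 n))))"
    unfolding wnorm_def e by (rule infsum_enn2real) simp
  also have "\<dots> = zsum (\<lambda>n. cmod (fcoeff \<zeta>0 n))"
    by (rule integral_eq_nn_integral[symmetric]) auto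
  finally have wn: "wnorm 0 0 \<zeta>0 = zsum (\<lambda>n. cmod (fcoeff \<zeta>0 n))" .
  define m where "m = wnorm 0 0 \<zeta>0"
  have m0: "0 \<le> m" unfolding m_def wn by simp
  have "0 < 128 * \<epsilon> * (\<alpha> + 55 / 6 * \<mu> + 1)" using assms \<alpha> \<mu> by (intro mult_pos_pos) auto
  then have "m * (128 * \<epsilon> * (\<alpha> + 55 / 6 * \<mu> + 1)) < \<alpha> + \<mu> / 3 - 1"
    using small by (simp add: m_def \<alpha>_def pos_less_divide_eq)
  \<comment> \<open>The locale asks for \<open>5 * (\<mu> / 3) = 5 / 3 * \<mu>\<close>, which lies
    below the given \<open>55 / 6 * \<mu>\<close>.\<close>
  moreover have "m * (128 * \<epsilon> * (1 + \<alpha> + 5 * (\<mu> / 3))) \<le> m * (128 * \<epsilon> * (\<alpha> + 55 / 6 * \<mu> + 1))"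
    using assms \<mu> m0 by (intro mult_left_mono) auto
  ultimately have small': "128 * \<epsilon> * m * (1 + \<alpha> + 5 * (\<mu> / 3)) \<le> \<alpha> + \<mu> / 3 - 1"
    by (simp only: mult_ac)
  interpret thin_film \<epsilon> \<alpha> "\<mu> / 3" "fcoeff \<zeta>0"
    by unfold_locales
       (use assms \<alpha> \<mu> gt1 mean sum small' hermit_fcoeff in \<open>simp_all add: \<alpha>_def m_def wn\<close>)
  have d: "sqrt \<mu> / bo + \<mu> / 3 - 1 = d" unfolding d_def by (simp add: \<alpha>_def)
  have M: "wnorm 0 0 \<zeta>0 = M0" by (simp add: wn M0_def)
  show ?case
    unfolding d M
  proof (rule exI[of _ "der 0"], intro conjI allI impI)
    show "weak_sol \<epsilon> \<mu> bo T \<zeta>0 (der 0)" if "0 < T" for T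
      using W0 that by (intro weak_solution) (simp_all add: wiener_in_def \<alpha>_def)
  qed (elim conjE; rule wiener_bounds; assumption)+
qed

end
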